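(* Let $L$ and $L^*$ be two Finsler structures on a manifold $M$, with no relation assumed between them, and let $B(\overline X,\overline Y)=\nabla^*_{\beta\overline X}\overline Y-\nabla_{\beta\overline X}\overline Y$, where $\nabla,\nabla^*$ are the Cartan connections of $(M,L)$, $(M,L^* )$. Suppose that $B(\overline V,\overline V)=0$ along $\tilde c$ for every geodesic $c$ in $M$ (geodesic of $(M,L)$), where $\overline V=\overline\eta|_{\tilde c(t)}$. Then the two Finsler manifolds $(M,L)$ and $(M,L^* )$ have the same Jacobi fields.
   Context: $M$ is a finite-dimensional $C^\infty$ manifold and all objects are $C^\infty$. $\pi:\mathcal TM\to M$ is the bundle of nonzero tangent vectors; $\pi^{-1}(TM)\to\mathcal TM$ is the pullback of $TM$ by $\pi$. Sections of $\pi^{-1}(TM)$ are called $\pi$-vector fields, form the module $\mathfrak X(\pi(M))$, and are written $\overline X$. $\overline\eta(u)=(u,u)$ is the fundamental $\pi$-vector field. There is an exact sequence $0\to\pi^{-1}(TM)\xrightarrow{\gamma}T(\mathcal TM)\xrightarrow{\rho}\pi^{-1}(TM)\to0$, where $\gamma(u,v)$ is the vertical lift of $v$ to $u$ and $\rho(X)=(u,d\pi(X))$ for $X\in T_u(\mathcal TM)$. For a connection $\nabla$ on $\pi^{-1}(TM)$, its connection map is $K(X)=\nabla_X\overline\eta$, $X\in T(\mathcal TM)$. The horizontal space is $H_u=\{X\in T_u(\mathcal TM):K(X)=0\}$, the vertical space is $V_u=\ker\rho_u$; $\nabla$ is regular if $T_u(\mathcal TM)=V_u\oplus H_u$ for all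 $u$, and then $\beta=(\rho|_{H})^{-1}:\pi^{-1}(TM)\to H$. The torsion form is $\mathbf T(X,Y)=\nabla_X\rho Y-\nabla_Y\rho X-\rho[X,Y]$, with $S(\overline X,\overline Y)=\mathbf T(\beta\overline X,\beta\overline Y)$ and $T(\overline X,\overline Y)=\mathbf T(\gamma\overline X,\beta\overline Y)$. The curvature is $\mathbf R(X,Y)=[\nabla_Y,\nabla_X]+\nabla_{[X,Y]}$ (note the sign), and $R(\overline X,\overline Y)\overline Z=\mathbf R(\beta\overline X,\beta\overline Y)\overline Z$. A Finsler structure $L:TM\to[0,\infty)$ is smooth on $\mathcal TM$, positively homogeneous of degree 1 on fibres, with $g$ := fibrewise Hessian of $\frac12L^2$ positive definite (a metric on $\pi^{-1}(TM)$). Its Cartan connection is the unique regular connection $\nabla$ on $\pi^{-1}(TM)$ with $\nabla g=0$, $S=0$ and $g(T(\overline X,\overline Y),\overline Z)=g(T(\overline X,\overline Z),\overline Y)$; it satisfies $K\circ\gamma=\mathrm{id}$, so $X=\gamma KX+\beta\rho X$. Objects of $(M,L^* )$ carry an asterisk ($\nabla^*,\beta^*,R^*,\dots$). Curves: a regular curve $c:I\to M$ has nowhere vanishing velocity; its canonical lift is $\tilde c(t)=dc/dt\in\mathcal TM$. $D/dt$ (resp. $D^*/dt$) is the covariant derivative along $\tilde c$ induced by $\nabla$ (resp. $\nabla^*$). $c$ is a geodesic of $(M,L)$ if $D\overline V/dt=0$, where $\overline V=\overline\eta|_{\tilde c(t)}=(dc/dt,dc/dt)$; similarly for $(M,L^*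 )$ with $D^*/dt$. The lift of a vector field $J$ along $c$ is $\overline J(\tilde c(t))=(\tilde c(t),J(c(t)))$. A Jacobi field of $(M,L)$ is a vector field $J$ along a geodesic $c$ of $(M,L)$ with $\frac{D^2\overline J}{dt^2}+R(\overline V,\overline J)\overline V=0$; a Jacobi field of $(M,L^* )$ is a vector field $J$ along a geodesic $c$ of $(M,L^* )$ with $\frac{D^{*2}\overline J}{dt^2}+R^*(\overline V,\overline J)\overline V=0$. *)

theory Defs
  imports "HOL-Analysis.Analysis" "HOL-Library.Function_Algebras"
begin

section \<open>Smooth maps between Euclidean spaces\<close>

text \<open>
  Derivatives are taken within the set, so that the same notion serves for open subsets of a
  Euclidean space and for arbitrary nondegenerate real intervals (one-sided derivatives at the
  endpoints). It is used for such sets only; there derivatives within the set are unique.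
\<close>

fun Ck_on :: "nat \<Rightarrow> 'a::euclidean_space set \<Rightarrow> ('a \<Rightarrow> 'b::euclidean_space) \<Rightarrow> bool" where
  "Ck_on 0 S f \<longleftrightarrow> continuous_on S f"
| "Ck_on (Suc k) S f \<longleftrightarrow>
     (\<exists>D. (\<forall>x\<in>S. (f has_derivative D x) (at x within S)) \<and> (\<forall>h. Ck_on k S (\<lambda>x. D x h)))"

definition smooth_on :: "'a::euclidean_space set \<Rightarrow> ('a \<Rightarrow> 'b::euclidean_space) \<Rightarrow> bool" where
  "smooth_on S f \<longleftrightarrow> (\<forall>k. Ck_on k S f)"


section \<open>Smooth manifolds\<close>

text \<open>
  A manifold is given by a smooth atlas \<open>A\<close>: a set of charts \<open>(U, \<phi>)\<close>, where \<open>\<phi>\<close> is injective on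
  the chart domain \<open>U\<close> with open image in the Euclidean space \<open>'e\<close>. Its points are the elements of
  the chart domains, and its topology is the one determined by the charts. The atlas need not be
  maximal.
\<close>

type_synonym ('a, 'e) chart = "'a set \<times> ('a \<Rightarrow> 'e)"

definition points :: "('a, 'e) chart set \<Rightarrow> 'a set" where
  "points A = (\<Union>(U, \<phi>)\<in>A. U)"

definition mfd_open :: "('a, 'e::euclidean_space) chart set \<Rightarrow> 'a set \<Rightarrow> bool" where
  "mfd_open A W \<longleftrightarrow> W \<subseteq> points A \<and> (\<forall>(U, \<phi>)\<in>A. open (\<phi> ` (U \<inter> W)))"

definition smooth_atlas :: "('a, 'e::euclidean_space) chart set \<Rightarrow> bool" where
  "smooth_atlas A \<longleftrightarrow>
     (\<forall>(U, \<phi>)\<in>A. inj_on \<phi> U \<and> open (\<phi> ` U)) \<and>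
     (\<forall>(U, \<phi>)\<in>A. \<forall>(V, \<psi>)\<in>A. open (\<phi> ` (U \<inter> V)) \<and>
        smooth_on (\<phi> ` (U \<inter> V)) (\<psi> \<circ> inv_into U \<phi>))"

definition mfd_topology :: "('a, 'e::euclidean_space) chart set \<Rightarrow> 'a topology" where
  "mfd_topology A = topology (mfd_open A)"

definition smooth_manifold :: "('a, 'e::euclidean_space) chart set \<Rightarrow> bool" where
  "smooth_manifold A \<longleftrightarrow>
     smooth_atlas A \<and> Hausdorff_space (mfd_topology A) \<and> second_countable (mfd_topology A)"

lemma istopology_mfd_open:
  assumes "smooth_atlas A"
  shows "istopology (mfd_open A)"
  unfolding istopology_def
proof (intro conjI allI impI)
  fix S T assume S: "mfd_open A S" and T: "mfd_open A T"
  have "open (\<phi> ` (U \<inter> (S \<inter> T)))" if "(U, \<phi>) \<in> A" for U \<phi>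
  proof -
    have "inj_on \<phi> U" "open (\<phi> ` (U \<inter> S))" "open (\<phi> ` (U \<inter> T))"
      using assms S T that by (auto simp: smooth_atlas_def mfd_open_def)
    moreover have "\<phi> ` (U \<inter> (S \<inter> T)) = \<phi> ` (U \<inter> S) \<inter> \<phi> ` (U \<inter> T)"
      using \<open>inj_on \<phi> U\<close> by (auto simp: inj_on_def)
    ultimately show ?thesis by auto
  qed
  then show "mfd_open A (S \<inter> T)"
    using S by (auto simp: mfd_open_def)
next
  fix \<K> assume K: "\<forall>S\<in>\<K>. mfd_open A S"
  have "open (\<phi> ` (U \<inter> \<Union>\<K>))" if "(U, \<phi>) \<in> A" for U \<phi>
  proof -
    have "\<phi> ` (U \<inter> \<Union>\<K>) = (\<Union>S\<in>\<K>. \<phi> ` (U \<inter> S))" by blast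
    moreover have "\<forall>S\<in>\<K>. open (\<phi> ` (U \<inter> S))"
      using K that by (auto simp: mfd_open_def)
    ultimately show ?thesis by auto
  qed
  then show "mfd_open A (\<Union>\<K>)"
    using K by (auto simp: mfd_open_def)
qed

definition smooth_fun_on :: "('a, 'e::euclidean_space) chart set \<Rightarrow> 'a set \<Rightarrow> ('a \<Rightarrow> real) \<Rightarrow> bool" where
  "smooth_fun_on A W f \<longleftrightarrow>
     mfd_open A W \<and> (\<forall>(U, \<phi>)\<in>A. smooth_on (\<phi> ` (U \<inter> W)) (f \<circ> inv_into U \<phi>))"

definition smooth_near :: "('a, 'e::euclidean_space) chart set \<Rightarrow> 'a \<Rightarrow> ('a \<Rightarrow> real) \<Rightarrow> bool" where
  "smooth_near A p f \<longleftrightarrow> (\<exists>W. p \<in> W \<and> smooth_fun_on A W f)"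

definition smooth_map ::
  "('a, 'e::euclidean_space) chart set \<Rightarrow> ('b, 'f::euclidean_space) chart set \<Rightarrow> ('a \<Rightarrow> 'b) \<Rightarrow> bool" where
  "smooth_map A B F \<longleftrightarrow>
     (\<forall>p\<in>points A. \<exists>(U, \<phi>)\<in>A. \<exists>(V, \<psi>)\<in>B. \<exists>W. mfd_open A W \<and> p \<in> W \<and> W \<subseteq> U \<and> F ` W \<subseteq> V \<and>
        smooth_on (\<phi> ` W) (\<psi> \<circ> F \<circ> inv_into U \<phi>))"

definition smooth_curve ::
  "('a, 'e::euclidean_space) chart set \<Rightarrow> real set \<Rightarrow> (real \<Rightarrow> 'a) \<Rightarrow> bool" where
  "smooth_curve A I c \<longleftrightarrow>
     (\<forall>t\<in>I. \<exists>(U, \<phi>)\<in>A. \<exists>d>0. c ` (I \<inter> ball t d) \<subseteq> U \<and> smooth_on (I \<inter> ball t d) (\<phi> \<circ> c))"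


section \<open>Tangent vectors and vector fields\<close>

text \<open>
  A tangent vector at \<open>p\<close> is the velocity of a smooth curve through \<open>p\<close>, regarded as the operator
  that differentiates functions smooth near \<open>p\<close> along the curve. To make it a total function of
  \<open>f\<close>, it takes the value \<open>0\<close> on functions that are not smooth near \<open>p\<close>. The vector space
  operations are the pointwise ones.
\<close>

type_synonym 'a tvec = "('a \<Rightarrow> real) \<Rightarrow> real"

definition tscale :: "real \<Rightarrow> 'a tvec \<Rightarrow> 'a tvec" (infixr "\<cdot>" 75) where
  "r \<cdot> v = (\<lambda>f. r * v f)"

definition velocity ::
  "('a, 'e::euclidean_space) chart set \<Rightarrow> real set \<Rightarrow> (real \<Rightarrow> 'a) \<Rightarrow> real \<Rightarrow> 'a tvec" where
  "velocity A I c t =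
     (\<lambda>f. if smooth_near A (c t) f then vector_derivative (f \<circ> c) (at t within I) else 0)"

definition tangent_space :: "('a, 'e::euclidean_space) chart set \<Rightarrow> 'a \<Rightarrow> 'a tvec set" where
  "tangent_space A p =
     {velocity A {-\<epsilon><..<\<epsilon>} \<alpha> 0 | \<epsilon> \<alpha>. \<epsilon> > 0 \<and> smooth_curve A {-\<epsilon><..<\<epsilon>} \<alpha> \<and> \<alpha> 0 = p}"

definition differential ::
  "('b, 'f::euclidean_space) chart set \<Rightarrow> ('a \<Rightarrow> 'b) \<Rightarrow> 'a \<Rightarrow> 'a tvec \<Rightarrow> 'b tvec" where
  "differential B F p v = (\<lambda>f. if smooth_near B (F p) f then v (f \<circ> F) else 0)"

text \<open>
  The tangent bundle consists of pairs \<open>(p, v)\<close>. The chart \<open>(U, \<phi>)\<close> induces the chart that maps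
  \<open>(p, v)\<close> to \<open>\<phi> p\<close> and the components \<open>v(\<phi>\<^sup>b)\<close> of \<open>v\<close>, where \<open>\<phi>\<^sup>b\<close> are the coordinate functions.
\<close>

definition tangent_bundle :: "('a, 'e::euclidean_space) chart set \<Rightarrow> ('a \<times> 'a tvec) set" where
  "tangent_bundle A = {(p, v). p \<in> points A \<and> v \<in> tangent_space A p}"

definition slit_bundle :: "('a, 'e::euclidean_space) chart set \<Rightarrow> ('a \<times> 'a tvec) set" where
  "slit_bundle A = {(p, v) \<in> tangent_bundle A. v \<noteq> 0}"

definition tangent_coords :: "('a \<Rightarrow> 'e::euclidean_space) \<Rightarrow> 'a \<times> 'a tvec \<Rightarrow> 'e \<times> 'e" where
  "tangent_coords \<phi> = (\<lambda>(p, v). (\<phi> p, \<Sum>b\<in>Basis. v (\<lambda>q. \<phi> q \<bullet> b) *\<^sub>R b))"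

definition tangent_atlas ::
  "('a, 'e::euclidean_space) chart set \<Rightarrow> ('a \<times> 'a tvec, 'e \<times> 'e) chart set" where
  "tangent_atlas A = (\<lambda>(U, \<phi>). ({u \<in> tangent_bundle A. fst u \<in> U}, tangent_coords \<phi>)) ` A"

definition slit_atlas ::
  "('a, 'e::euclidean_space) chart set \<Rightarrow> ('a \<times> 'a tvec, 'e \<times> 'e) chart set" where
  "slit_atlas A = (\<lambda>(U, \<phi>). ({u \<in> slit_bundle A. fst u \<in> U}, tangent_coords \<phi>)) ` A"

definition vector_fields :: "('a, 'e::euclidean_space) chart set \<Rightarrow> ('a \<Rightarrow> 'a tvec) set" where
  "vector_fields A =
     {X. (\<forall>p\<in>points A. X p \<in> tangent_space A p) \<and> smooth_map A (tangent_atlas A) (\<lambda>p. (p, X p))}"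

definition lie_bracket ::
  "('a, 'e::euclidean_space) chart set \<Rightarrow> ('a \<Rightarrow> 'a tvec) \<Rightarrow> ('a \<Rightarrow> 'a tvec) \<Rightarrow> 'a \<Rightarrow> 'a tvec" where
  "lie_bracket A X Y p =
     (\<lambda>f. if smooth_near A p f then X p (\<lambda>q. Y q f) - Y p (\<lambda>q. X q f) else 0)"


section \<open>The pullback bundle and its connections\<close>

text \<open>
  The fibre of the pullback bundle over a nonzero tangent vector \<open>u\<close> is
  \<open>{u} \<times> tangent_space A (fst u)\<close>; its elements are represented by their second components.
  Accordingly a section is a map that assigns to \<open>u\<close> a tangent vector at the foot point of \<open>u\<close>.
  Values of sections and vector fields outside the slit tangent bundle are immaterial.
\<close>

type_synonym 'a pi_field = "'a \<times> 'a tvec \<Rightarrow> 'a tvec"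

definition pi_vector_fields :: "('a, 'e::euclidean_space) chart set \<Rightarrow> 'a pi_field set" where
  "pi_vector_fields A =
     {Y. (\<forall>u\<in>slit_bundle A. Y u \<in> tangent_space A (fst u)) \<and>
         smooth_map (slit_atlas A) (tangent_atlas A) (\<lambda>u. (fst u, Y u))}"

definition fundamental_field :: "'a pi_field" where
  "fundamental_field u = snd u"

definition rho ::
  "('a, 'e::euclidean_space) chart set \<Rightarrow> 'a \<times> 'a tvec \<Rightarrow> ('a \<times> 'a tvec) tvec \<Rightarrow> 'a tvec" where
  "rho A u X = differential A fst u X"

definition gamma ::
  "('a, 'e::euclidean_space) chart set \<Rightarrow> 'a \<times> 'a tvec \<Rightarrow> 'a tvec \<Rightarrow> ('a \<times> 'a tvec) tvec" where
  "gamma A u v = velocity (slit_atlas A) UNIV (\<lambda>s. (fst u, snd u + s \<cdot> v)) 0"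

text \<open>
  A connection \<open>N\<close> is written \<open>N u X Y\<close> for the covariant derivative at \<open>u\<close> of the section \<open>Y\<close> in
  the direction of the tangent vector \<open>X\<close> at \<open>u\<close>.
\<close>

type_synonym 'a pi_conn = "'a \<times> 'a tvec \<Rightarrow> ('a \<times> 'a tvec) tvec \<Rightarrow> 'a pi_field \<Rightarrow> 'a tvec"

definition pi_connection :: "('a, 'e::euclidean_space) chart set \<Rightarrow> 'a pi_conn \<Rightarrow> bool" where
  "pi_connection A N \<longleftrightarrow>
     (\<forall>u\<in>slit_bundle A. \<forall>X\<in>tangent_space (slit_atlas A) u. \<forall>Y\<in>pi_vector_fields A.
        N u X Y \<in> tangent_space A (fst u)) \<and>
     (\<forall>u\<in>slit_bundle A. \<forall>X\<in>tangent_space (slit_atlas A) u. \<forall>X'\<in>tangent_space (slit_atlas A) u.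
        \<forall>Y\<in>pi_vector_fields A. \<forall>r s. N u (r \<cdot> X + s \<cdot> X') Y = r \<cdot> N u X Y + s \<cdot> N u X' Y) \<and>
     (\<forall>u\<in>slit_bundle A. \<forall>X\<in>tangent_space (slit_atlas A) u.
        \<forall>Y\<in>pi_vector_fields A. \<forall>Z\<in>pi_vector_fields A. N u X (Y + Z) = N u X Y + N u X Z) \<and>
     (\<forall>u\<in>slit_bundle A. \<forall>X\<in>tangent_space (slit_atlas A) u. \<forall>Y\<in>pi_vector_fields A.
        \<forall>f. smooth_fun_on (slit_atlas A) (slit_bundle A) f \<longrightarrow>
          N u X (\<lambda>w. f w \<cdot> Y w) = X f \<cdot> Y u + f u \<cdot> N u X Y) \<and>
     (\<forall>X\<in>vector_fields (slit_atlas A). \<forall>Y\<in>pi_vector_fields A.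
        (\<lambda>u. N u (X u) Y) \<in> pi_vector_fields A)"

definition connection_map :: "'a pi_conn \<Rightarrow> 'a \<times> 'a tvec \<Rightarrow> ('a \<times> 'a tvec) tvec \<Rightarrow> 'a tvec" where
  "connection_map N u X = N u X fundamental_field"

definition horizontal_space ::
  "('a, 'e::euclidean_space) chart set \<Rightarrow> 'a pi_conn \<Rightarrow> 'a \<times> 'a tvec \<Rightarrow> ('a \<times> 'a tvec) tvec set" where
  "horizontal_space A N u = {X \<in> tangent_space (slit_atlas A) u. connection_map N u X = 0}"

definition vertical_space ::
  "('a, 'e::euclidean_space) chart set \<Rightarrow> 'a \<times> 'a tvec \<Rightarrow> ('a \<times> 'a tvec) tvec set" where
  "vertical_space A u = {X \<in> tangent_space (slit_atlas A) u. rho A u X = 0}"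

definition regular_connection :: "('a, 'e::euclidean_space) chart set \<Rightarrow> 'a pi_conn \<Rightarrow> bool" where
  "regular_connection A N \<longleftrightarrow> pi_connection A N \<and>
     (\<forall>u\<in>slit_bundle A.
        tangent_space (slit_atlas A) u
          = {X + Y | X Y. X \<in> vertical_space A u \<and> Y \<in> horizontal_space A N u} \<and>
        vertical_space A u \<inter> horizontal_space A N u = {0})"

definition beta ::
  "('a, 'e::euclidean_space) chart set \<Rightarrow> 'a pi_conn \<Rightarrow> 'a \<times> 'a tvec \<Rightarrow> 'a tvec \<Rightarrow> ('a \<times> 'a tvec) tvec" where
  "beta A N u = inv_into (horizontal_space A N u) (rho A u)"

definition torsion_form ::
  "('a, 'e::euclidean_space) chart set \<Rightarrow> 'a pi_conn \<Rightarrow>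
     ('a \<times> 'a tvec \<Rightarrow> ('a \<times> 'a tvec) tvec) \<Rightarrow> ('a \<times> 'a tvec \<Rightarrow> ('a \<times> 'a tvec) tvec) \<Rightarrow> 'a pi_field" where
  "torsion_form A N X Y u =
     N u (X u) (\<lambda>w. rho A w (Y w)) - N u (Y u) (\<lambda>w. rho A w (X w))
       - rho A u (lie_bracket (slit_atlas A) X Y u)"

definition horizontal_torsion ::
  "('a, 'e::euclidean_space) chart set \<Rightarrow> 'a pi_conn \<Rightarrow> 'a pi_field \<Rightarrow> 'a pi_field \<Rightarrow> 'a pi_field" where
  "horizontal_torsion A N X Y =
     torsion_form A N (\<lambda>u. beta A N u (X u)) (\<lambda>u. beta A N u (Y u))"

definition mixed_torsion ::
  "('a, 'e::euclidean_space) chart set \<Rightarrow> 'a pi_conn \<Rightarrow> 'a pi_field \<Rightarrow> 'a pi_field \<Rightarrow> 'a pi_field" where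
  "mixed_torsion A N X Y =
     torsion_form A N (\<lambda>u. gamma A u (X u)) (\<lambda>u. beta A N u (Y u))"

text \<open>Note the sign: this is the curvature \<open>[\<nabla>\<^sub>Y, \<nabla>\<^sub>X] + \<nabla>\<^bsub>[X, Y]\<^esub>\<close>.\<close>

definition curvature_form ::
  "('a, 'e::euclidean_space) chart set \<Rightarrow> 'a pi_conn \<Rightarrow>
     ('a \<times> 'a tvec \<Rightarrow> ('a \<times> 'a tvec) tvec) \<Rightarrow> ('a \<times> 'a tvec \<Rightarrow> ('a \<times> 'a tvec) tvec) \<Rightarrow>
     'a pi_field \<Rightarrow> 'a pi_field" where
  "curvature_form A N X Y Z u =
     N u (Y u) (\<lambda>w. N w (X w) Z) - N u (X u) (\<lambda>w. N w (Y w) Z)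
       + N u (lie_bracket (slit_atlas A) X Y u) Z"

definition horizontal_curvature ::
  "('a, 'e::euclidean_space) chart set \<Rightarrow> 'a pi_conn \<Rightarrow>
     'a pi_field \<Rightarrow> 'a pi_field \<Rightarrow> 'a pi_field \<Rightarrow> 'a pi_field" where
  "horizontal_curvature A N X Y Z =
     curvature_form A N (\<lambda>u. beta A N u (X u)) (\<lambda>u. beta A N u (Y u)) Z"

text \<open>
  The horizontal curvature is tensorial; this is its value at \<open>u\<close> on elements \<open>x\<close>, \<open>y\<close>, \<open>z\<close> of the
  fibre over \<open>u\<close>, obtained from arbitrary extensions of these to global sections.
\<close>

definition horizontal_curvature_at ::
  "('a, 'e::euclidean_space) chart set \<Rightarrow> 'a pi_conn \<Rightarrow> 'a \<times> 'a tvec \<Rightarrow>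
     'a tvec \<Rightarrow> 'a tvec \<Rightarrow> 'a tvec \<Rightarrow> 'a tvec" where
  "horizontal_curvature_at A N u x y z =
     (THE r. \<exists>X\<in>pi_vector_fields A. \<exists>Y\<in>pi_vector_fields A. \<exists>Z\<in>pi_vector_fields A.
        X u = x \<and> Y u = y \<and> Z u = z \<and> r = horizontal_curvature A N X Y Z u)"


section \<open>Finsler structures and the Cartan connection\<close>

definition fundamental_tensor ::
  "('a \<times> 'a tvec \<Rightarrow> real) \<Rightarrow> 'a \<times> 'a tvec \<Rightarrow> 'a tvec \<Rightarrow> 'a tvec \<Rightarrow> real" where
  "fundamental_tensor L u x y =
     deriv (\<lambda>s. deriv (\<lambda>t. (L (fst u, snd u + s \<cdot> x + t \<cdot> y))\<^sup>2 / 2) 0) 0"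

definition finsler_structure ::
  "('a, 'e::euclidean_space) chart set \<Rightarrow> ('a \<times> 'a tvec \<Rightarrow> real) \<Rightarrow> bool" where
  "finsler_structure A L \<longleftrightarrow>
     (\<forall>u\<in>tangent_bundle A. L u \<ge> 0) \<and>
     smooth_fun_on (slit_atlas A) (slit_bundle A) L \<and>
     (\<forall>(p, v)\<in>tangent_bundle A. \<forall>r>0. L (p, r \<cdot> v) = r * L (p, v)) \<and>
     (\<forall>u\<in>slit_bundle A. \<forall>x\<in>tangent_space A (fst u). x \<noteq> 0 \<longrightarrow> fundamental_tensor L u x x > 0)"

definition metric_connection ::
  "('a, 'e::euclidean_space) chart set \<Rightarrow> ('a \<times> 'a tvec \<Rightarrow> real) \<Rightarrow> 'a pi_conn \<Rightarrow> bool" where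
  "metric_connection A L N \<longleftrightarrow>
     (\<forall>u\<in>slit_bundle A. \<forall>X\<in>tangent_space (slit_atlas A) u.
      \<forall>Y\<in>pi_vector_fields A. \<forall>Z\<in>pi_vector_fields A.
        X (\<lambda>w. fundamental_tensor L w (Y w) (Z w))
          = fundamental_tensor L u (N u X Y) (Z u) + fundamental_tensor L u (Y u) (N u X Z))"

definition cartan_connection ::
  "('a, 'e::euclidean_space) chart set \<Rightarrow> ('a \<times> 'a tvec \<Rightarrow> real) \<Rightarrow> 'a pi_conn \<Rightarrow> bool" where
  "cartan_connection A L N \<longleftrightarrow>
     regular_connection A N \<and>
     metric_connection A L N \<and>
     (\<forall>X\<in>pi_vector_fields A. \<forall>Y\<in>pi_vector_fields A. \<forall>u\<in>slit_bundle A.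
        horizontal_torsion A N X Y u = 0) \<and>
     (\<forall>X\<in>pi_vector_fields A. \<forall>Y\<in>pi_vector_fields A. \<forall>Z\<in>pi_vector_fields A. \<forall>u\<in>slit_bundle A.
        fundamental_tensor L u (mixed_torsion A N X Y u) (Z u)
          = fundamental_tensor L u (mixed_torsion A N X Z u) (Y u))"

definition connection_difference ::
  "('a, 'e::euclidean_space) chart set \<Rightarrow> 'a pi_conn \<Rightarrow> 'a pi_conn \<Rightarrow>
     'a pi_field \<Rightarrow> 'a pi_field \<Rightarrow> 'a pi_field" where
  "connection_difference A N N' X Y u = N' u (beta A N u (X u)) Y - N u (beta A N u (X u)) Y"


section \<open>Geodesics and Jacobi fields\<close>

text \<open>
  Parameter domains of curves are arbitrary nondegenerate intervals, open or not, bounded or not.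
\<close>

definition regular_curve ::
  "('a, 'e::euclidean_space) chart set \<Rightarrow> real set \<Rightarrow> (real \<Rightarrow> 'a) \<Rightarrow> bool" where
  "regular_curve A I c \<longleftrightarrow>
     is_interval I \<and> interior I \<noteq> {} \<and> smooth_curve A I c \<and> (\<forall>t\<in>I. velocity A I c t \<noteq> 0)"

definition canonical_lift ::
  "('a, 'e::euclidean_space) chart set \<Rightarrow> real set \<Rightarrow> (real \<Rightarrow> 'a) \<Rightarrow> real \<Rightarrow> 'a \<times> 'a tvec" where
  "canonical_lift A I c t = (c t, velocity A I c t)"

text \<open>
  The covariant derivative along a curve \<open>\<sigma>\<close> in the slit tangent bundle, of a section \<open>W\<close> along
  \<open>\<sigma>\<close>. Near \<open>t\<close>, write \<open>W = \<Sum>i<n. a i \<cdot> (E i \<circ> \<sigma>)\<close> with global sections \<open>E i\<close> and smooth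
  coefficients \<open>a i\<close>; then the Leibniz rule and the requirement that \<open>E i \<circ> \<sigma>\<close> be differentiated by
  means of \<open>N\<close> determine the derivative, independently of the chosen representation.
\<close>

definition cov_deriv_along ::
  "('a, 'e::euclidean_space) chart set \<Rightarrow> 'a pi_conn \<Rightarrow> real set \<Rightarrow> (real \<Rightarrow> 'a \<times> 'a tvec) \<Rightarrow>
     (real \<Rightarrow> 'a tvec) \<Rightarrow> real \<Rightarrow> 'a tvec" where
  "cov_deriv_along A N I \<sigma> W t =
     (THE z. \<exists>(n::nat) E a. \<exists>d>0.
        (\<forall>i<n. E i \<in> pi_vector_fields A \<and> smooth_on (I \<inter> ball t d) (a i :: real \<Rightarrow> real)) \<and>
        (\<forall>s\<in>I \<inter> ball t d. W s = (\<Sum>i<n. a i s \<cdot> E i (\<sigma> s))) \<and>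
        z = (\<Sum>i<n. vector_derivative (a i) (at t within I) \<cdot> E i (\<sigma> t)
                     + a i t \<cdot> N (\<sigma> t) (velocity (slit_atlas A) I \<sigma> t) (E i)))"

definition geodesic ::
  "('a, 'e::euclidean_space) chart set \<Rightarrow> 'a pi_conn \<Rightarrow> real set \<Rightarrow> (real \<Rightarrow> 'a) \<Rightarrow> bool" where
  "geodesic A N I c \<longleftrightarrow>
     regular_curve A I c \<and>
     (\<forall>t\<in>I. cov_deriv_along A N I (canonical_lift A I c)
               (\<lambda>s. fundamental_field (canonical_lift A I c s)) t = 0)"

definition vector_field_along ::
  "('a, 'e::euclidean_space) chart set \<Rightarrow> real set \<Rightarrow> (real \<Rightarrow> 'a) \<Rightarrow> (real \<Rightarrow> 'a tvec) \<Rightarrow> bool" where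
  "vector_field_along A I c J \<longleftrightarrow>
     (\<forall>t\<in>I. J t \<in> tangent_space A (c t)) \<and> smooth_curve (tangent_atlas A) I (\<lambda>t. (c t, J t))"

text \<open>
  Since elements of the pullback bundle are represented by their second components, the lift of
  \<open>J\<close> to a section along the canonical lift of \<open>c\<close> is \<open>J\<close> itself.
\<close>

definition jacobi_field ::
  "('a, 'e::euclidean_space) chart set \<Rightarrow> 'a pi_conn \<Rightarrow> real set \<Rightarrow> (real \<Rightarrow> 'a) \<Rightarrow>
     (real \<Rightarrow> 'a tvec) \<Rightarrow> bool" where
  "jacobi_field A N I c J \<longleftrightarrow>
     geodesic A N I c \<and> vector_field_along A I c J \<and>
     (let \<sigma> = canonical_lift A I c; V = (\<lambda>t. fundamental_field (\<sigma> t)); D = cov_deriv_along A N I \<sigma>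
      in \<forall>t\<in>I. D (D J) t + horizontal_curvature_at A N (\<sigma> t) (V t) (J t) (V t) = 0)"

end

theory Submission
  imports Defs
begin

text \<open>
  In a chart, with coordinates \<open>(x, y)\<close> of the slit tangent bundle and energy \<open>e = L\<^sup>2/2\<close>, the symmetry
  of the mixed torsion and metricity give \<open>K(a, b) = b + P a\<close>, so that \<open>\<beta> a = (a, -P a)\<close> and the
  geodesics are the integral curves of the spray \<open>\<beta>\<eta> = (y, -H)\<close>, \<open>H = P y\<close>. Metricity and \<open>S = 0\<close> imply
  the Euler-Lagrange equation for \<open>H\<close>; its derivative in the direction of \<open>y\<close> yields \<open>\<partial>H/\<partial>y = 2 P\<close>, so
  the spray determines \<open>K\<close> and \<open>\<beta>\<close>.

  A geodesic starts in every nonzero tangent vector, hence \<open>B(V, V) = 0\<close> along all geodesics means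
  that the spray of \<open>L\<close> is horizontal for \<open>\<nabla>\<^sup>*\<close>. Therefore the two sprays coincide, and with them \<open>K\<close> and
  \<open>\<beta>\<close>. Along geodesics the covariant derivative in the direction of the spray is
  \<open>\<nabla>\<^bsub>\<beta>\<eta>\<^esub> Y = \<rho>[\<beta>\<eta>, \<beta>Y]\<close>, because \<open>S = 0\<close> and \<open>K \<circ> \<beta> = 0\<close>, and the curvature term is
  \<open>R(V, J)V = K[\<beta>V, \<beta>J]\<close>. Hence the two Jacobi equations are the same.
\<close>


section \<open>Calculus of smooth maps\<close>

text \<open>A connection acts on global sections, given as total functions, and its axioms do not
  say directly that its value at a point depends only on the section near that point. Coordinate
  computations therefore use global frames cut off by bump functions. Where locality would normally
  be invoked, metricity takes its place: pairing with the metric moves the differentiation onto a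
  test section. This gives tensoriality of the curvature in its last argument and uniqueness of the
  covariant derivative along a curve. Homogeneity of \<open>L\<close> enters as Euler's relation for
  the energy. The factor 2 in the derivative of \<open>H\<close> has two sources: one copy of
  \<open>P\<close> comes from metricity along the spray, the other from the varying direction of the
  spray itself. The two connections may differ as a whole. The Jacobi equation sees only
  \<open>K\<close>, \<open>\<beta>\<close> and derivatives along the spray: its curvature term is
  the curvature applied to \<open>\<eta>\<close>, for which both iterated horizontal derivatives
  vanish.\<close>

lemma linear_eq_sum_Basis:
  fixes f :: "'a::euclidean_space \<Rightarrow> 'b::real_vector"
  assumes "linear f" shows "f x = (\<Sum>b\<in>Basis. (x \<bullet> b) *\<^sub>R f b)"
proof -
  have "f x = f (\<Sum>b\<in>Basis. (x \<bullet> b) *\<^sub>R b)" by (simp add: euclidean_representation)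
  then show ?thesis by (simp add: linear_sum[OF assms] linear_cmul[OF assms])
qed

lemma Ck_on_subset: "Ck_on k S f \<Longrightarrow> T \<subseteq> S \<Longrightarrow> Ck_on k T f"
proof (induction k arbitrary: f)
  case 0
  then show ?case by (auto intro: continuous_on_subset)
next
  case (Suc k)
  then obtain D where "\<forall>x\<in>S. (f has_derivative D x) (at x within S)" "\<forall>h. Ck_on k S (\<lambda>x. D x h)"
    by auto
  then show ?case
    using Suc by (auto intro!: exI[of _ D] intro: has_derivative_subset)
qed

lemma Ck_on_cong: "Ck_on k S f \<Longrightarrow> (\<And>x. x \<in> S \<Longrightarrow> f x = g x) \<Longrightarrow> Ck_on k S g"
proof (induction k arbitrary: f g)
  case 0
  then show ?case using continuous_on_eq[of S f g] by simp
next
  case (Suc k)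
  then obtain D where "\<forall>x\<in>S. (f has_derivative D x) (at x within S)" "\<forall>h. Ck_on k S (\<lambda>x. D x h)"
    by auto
  then show ?case
    using Suc.prems(2) by (auto intro!: exI[of _ D] has_derivative_transform[of _ S g f])
qed

lemma Ck_on_Suc_imp: "Ck_on (Suc k) S f \<Longrightarrow> Ck_on k S f"
proof (induction k arbitrary: f)
  case 0
  then show ?case by (auto intro: has_derivative_continuous_on)
next
  case (Suc k)
  from Suc.prems obtain D where "\<forall>x\<in>S. (f has_derivative D x) (at x within S)"
    and "\<forall>h. Ck_on (Suc k) S (\<lambda>x. D x h)"
    by auto
  then have "\<forall>h. Ck_on k S (\<lambda>x. D x h)" using Suc.IH by blast
  then show ?case using \<open>\<forall>x\<in>S. _\<close> by auto
qed

lemma Ck_on_const: "Ck_on k S (\<lambda>x. c)"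
  by (induction k arbitrary: c) (auto intro!: exI[of _ "\<lambda>_ _. 0"])

lemma Ck_on_bounded_linear:
  assumes "bounded_linear f" shows "Ck_on k S f"
  using assms
  by (cases k) (auto intro!: exI[of _ "\<lambda>_. f"] Ck_on_const bounded_linear.has_derivative[OF assms]
      linear_continuous_on bounded_linear_imp_has_derivative)

lemma Ck_on_add: "Ck_on k S f \<Longrightarrow> Ck_on k S g \<Longrightarrow> Ck_on k S (\<lambda>x. f x + g x)"
proof (induction k arbitrary: f g)
  case 0
  then show ?case by (auto intro: continuous_on_add)
next
  case (Suc k)
  then obtain D E where "\<forall>x\<in>S. (f has_derivative D x) (at x within S)" "\<forall>h. Ck_on k S (\<lambda>x. D x h)"
    "\<forall>x\<in>S. (g has_derivative E x) (at x within S)" "\<forall>h. Ck_on k S (\<lambda>x. E x h)"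
    by auto
  then show ?case using Suc.IH
    by (auto intro!: exI[of _ "\<lambda>x h. D x h + E x h"] has_derivative_add)
qed

lemma Ck_on_sum: "(\<And>i. i \<in> I \<Longrightarrow> Ck_on k S (f i)) \<Longrightarrow> Ck_on k S (\<lambda>x. \<Sum>i\<in>I. f i x)"
  by (induction I rule: infinite_finite_induct) (auto intro: Ck_on_const Ck_on_add)

lemma Ck_on_bilinear:
  assumes "bounded_bilinear P"
  shows "Ck_on k S f \<Longrightarrow> Ck_on k S g \<Longrightarrow> Ck_on k S (\<lambda>x. P (f x) (g x))"
proof (induction k arbitrary: f g)
  case 0
  then show ?case by (auto intro: bounded_bilinear.continuous_on[OF assms])
next
  case (Suc k)
  then obtain D E where "\<forall>x\<in>S. (f has_derivative D x) (at x within S)" "\<forall>h. Ck_on k S (\<lambda>x. D x h)"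
    "\<forall>x\<in>S. (g has_derivative E x) (at x within S)" "\<forall>h. Ck_on k S (\<lambda>x. E x h)"
    by auto
  moreover have "Ck_on k S f" "Ck_on k S g" using Suc.prems Ck_on_Suc_imp by blast+
  ultimately show ?case using Suc.IH
    by (auto intro!: exI[of _ "\<lambda>x h. P (f x) (E x h) + P (D x h) (g x)"] Ck_on_add
        bounded_bilinear.FDERIV[OF assms])
qed

text \<open>In the derivative \<open>E (f x) (D x h)\<close> of the composition the direction
  \<open>D x h\<close> varies with \<open>x\<close>, whereas \<open>Ck_on\<close> controls
  \<open>E\<close> for fixed directions only. Expansion over the basis reduces this to products to
  which the induction hypothesis applies.\<close>

lemma Ck_on_compose:
  "Ck_on k T g \<Longrightarrow> Ck_on k S f \<Longrightarrow> f ` S \<subseteq> T \<Longrightarrow> Ck_on k S (\<lambda>x. g (f x))"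
proof (induction k arbitrary: f g)
  case 0
  then show ?case by (auto intro: continuous_on_compose2)
next
  case (Suc k)
  then obtain D E where D: "\<forall>x\<in>S. (f has_derivative D x) (at x within S)" "\<forall>h. Ck_on k S (\<lambda>x. D x h)"
    and E: "\<forall>x\<in>T. (g has_derivative E x) (at x within T)" "\<forall>h. Ck_on k T (\<lambda>x. E x h)"
    by auto
  have f: "Ck_on k S f" using Suc.prems Ck_on_Suc_imp by blast
  have 1: "((\<lambda>x. g (f x)) has_derivative (\<lambda>h. E (f x) (D x h))) (at x within S)" if "x \<in> S" for x
  proof (rule has_derivative_in_compose[where f = f and g = g and g' = "E (f x)" and f' = "D x"])
    show "(f has_derivative D x) (at x within S)" using D(1) that by blast
    show "(g has_derivative E (f x)) (at (f x) within f ` S)"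
      by (rule has_derivative_subset[OF _ Suc.prems(3)]) (use E(1) that Suc.prems(3) in blast)
  qed
  have 2: "Ck_on k S (\<lambda>x. E (f x) (D x h))" for h
  proof -
    have "Ck_on k S (\<lambda>x. \<Sum>b\<in>Basis. (D x h \<bullet> b) *\<^sub>R E (f x) b)"
      by (intro Ck_on_sum Ck_on_bilinear[OF bounded_bilinear_scaleR]
          Ck_on_bilinear[OF bounded_bilinear_inner] Ck_on_const Suc.IH f Suc.prems(3))
        (use D E in auto)
    moreover have "(\<Sum>b\<in>Basis. (D x h \<bullet> b) *\<^sub>R E (f x) b) = E (f x) (D x h)" if "x \<in> S" for x
    proof -
      have "linear (E (f x))"
        using E(1) that Suc.prems(3) by (auto intro: has_derivative_linear)
      then show ?thesis
        using linear_eq_sum_Basis[of "E (f x)" "D x h"] by simp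
    qed
    ultimately show ?thesis by (rule Ck_on_cong)
  qed
  show ?case unfolding Ck_on.simps using 1 2
    by (intro exI[of _ "\<lambda>x h. E (f x) (D x h)"]) blast
qed

lemma smooth_on_subset: "smooth_on S f \<Longrightarrow> T \<subseteq> S \<Longrightarrow> smooth_on T f"
  by (auto simp: smooth_on_def intro: Ck_on_subset)

lemma smooth_on_cong: "smooth_on S f \<Longrightarrow> (\<And>x. x \<in> S \<Longrightarrow> f x = g x) \<Longrightarrow> smooth_on S g"
  unfolding smooth_on_def by (blast intro: Ck_on_cong)

lemma smooth_on_const: "smooth_on S (\<lambda>x. c)"
  by (simp add: smooth_on_def Ck_on_const)

lemma smooth_on_bounded_linear: "bounded_linear f \<Longrightarrow> smooth_on S f"
  by (simp add: smooth_on_def Ck_on_bounded_linear)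

lemma smooth_on_linear: "linear f \<Longrightarrow> smooth_on S f"
  by (simp add: smooth_on_bounded_linear linear_conv_bounded_linear)

lemma smooth_on_id: "smooth_on S (\<lambda>x. x)"
  by (intro smooth_on_bounded_linear bounded_linear_ident)

lemma smooth_on_fst: "smooth_on S fst"
  by (intro smooth_on_bounded_linear bounded_linear_fst)

lemma smooth_on_snd: "smooth_on S snd"
  by (intro smooth_on_bounded_linear bounded_linear_snd)

lemma smooth_on_add: "smooth_on S f \<Longrightarrow> smooth_on S g \<Longrightarrow> smooth_on S (\<lambda>x. f x + g x)"
  by (auto simp: smooth_on_def intro: Ck_on_add)

lemma smooth_on_sum: "(\<And>i. i \<in> I \<Longrightarrow> smooth_on S (f i)) \<Longrightarrow> smooth_on S (\<lambda>x. \<Sum>i\<in>I. f i x)"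
  by (auto simp: smooth_on_def intro: Ck_on_sum)

lemma smooth_on_scaleR:
  "smooth_on S f \<Longrightarrow> smooth_on S g \<Longrightarrow> smooth_on S (\<lambda>x. f x *\<^sub>R g x)"
  by (auto simp: smooth_on_def intro: Ck_on_bilinear[OF bounded_bilinear_scaleR])

lemma smooth_on_mult:
  fixes f g :: "'a::euclidean_space \<Rightarrow> real"
  shows "smooth_on S f \<Longrightarrow> smooth_on S g \<Longrightarrow> smooth_on S (\<lambda>x. f x * g x)"
  by (auto simp: smooth_on_def intro: Ck_on_bilinear[OF bounded_bilinear_mult])

lemma smooth_on_inner:
  "smooth_on S f \<Longrightarrow> smooth_on S g \<Longrightarrow> smooth_on S (\<lambda>x. f x \<bullet> g x)"
  by (auto simp: smooth_on_def intro: Ck_on_bilinear[OF bounded_bilinear_inner])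

lemma smooth_on_compose:
  "smooth_on T g \<Longrightarrow> smooth_on S f \<Longrightarrow> f ` S \<subseteq> T \<Longrightarrow> smooth_on S (\<lambda>x. g (f x))"
  unfolding smooth_on_def by (blast intro: Ck_on_compose)

lemma smooth_on_minus: "smooth_on S f \<Longrightarrow> smooth_on S (\<lambda>x. - f x)"
  using smooth_on_compose[OF smooth_on_linear[OF module_hom_uminus], of S f UNIV] by simp

lemma smooth_on_diff: "smooth_on S f \<Longrightarrow> smooth_on S g \<Longrightarrow> smooth_on S (\<lambda>x. f x - g x)"
  using smooth_on_add[OF _ smooth_on_minus, of S f g] by simp

lemma smooth_on_fst_comp: "smooth_on S f \<Longrightarrow> smooth_on S (\<lambda>x. fst (f x))"
  using smooth_on_compose[OF smooth_on_fst, of S f UNIV] by simp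

lemma smooth_on_snd_comp: "smooth_on S f \<Longrightarrow> smooth_on S (\<lambda>x. snd (f x))"
  using smooth_on_compose[OF smooth_on_snd, of S f UNIV] by simp

lemma smooth_on_Pair:
  assumes "smooth_on S f" "smooth_on S g" shows "smooth_on S (\<lambda>x. (f x, g x))"
proof -
  have "smooth_on S (\<lambda>x. (f x, 0))"
    by (rule smooth_on_compose[OF smooth_on_bounded_linear, of "\<lambda>a. (a, 0)" S f UNIV])
      (use assms in \<open>auto intro: bounded_linear_Pair bounded_linear_ident bounded_linear_zero\<close>)
  moreover have "smooth_on S (\<lambda>x. (0, g x))"
    by (rule smooth_on_compose[OF smooth_on_bounded_linear, of "\<lambda>a. (0, a)" S g UNIV])
      (use assms in \<open>auto intro: bounded_linear_Pair bounded_linear_ident bounded_linear_zero\<close>)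
  ultimately have "smooth_on S (\<lambda>x. (f x, 0) + (0, g x))" by (rule smooth_on_add)
  then show ?thesis by simp
qed

lemmas smooth_intros = smooth_on_const smooth_on_id smooth_on_fst smooth_on_snd smooth_on_add
  smooth_on_sum smooth_on_scaleR smooth_on_mult smooth_on_inner smooth_on_minus smooth_on_diff
  smooth_on_fst_comp smooth_on_snd_comp smooth_on_Pair

lemma smooth_on_imp_continuous_on: "smooth_on S f \<Longrightarrow> continuous_on S f"
  unfolding smooth_on_def by (metis Ck_on.simps(1))

lemma smooth_on_has_derivative:
  assumes "smooth_on S f" "x \<in> S"
  shows "\<exists>D. (f has_derivative D) (at x within S)"
proof -
  have "Ck_on (Suc 0) S f" using assms(1) smooth_on_def by blast
  then show ?thesis using assms(2) by auto
qed

section \<open>Frechet derivatives on open sets\<close>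

abbreviation fder :: "('a::real_normed_vector \<Rightarrow> 'b::real_normed_vector) \<Rightarrow> 'a \<Rightarrow> 'a \<Rightarrow> 'b" where
  "fder f x \<equiv> frechet_derivative f (at x)"

lemma fder_eqI: "(f has_derivative D) (at x) \<Longrightarrow> fder f x = D"
  by (rule frechet_derivative_at[symmetric])

lemma smooth_on_fder:
  assumes "smooth_on S f" "open S" "x \<in> S"
  shows "(f has_derivative fder f x) (at x)"
proof -
  obtain D where "(f has_derivative D) (at x within S)"
    using smooth_on_has_derivative assms by blast
  then have *: "(f has_derivative D) (at x)" by (simp only: at_within_open[OF assms(3,2)])
  then show ?thesis by (simp only: fder_eqI[OF *])
qed

lemma linear_fder: "smooth_on S f \<Longrightarrow> open S \<Longrightarrow> x \<in> S \<Longrightarrow> linear (fder f x)"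
  by (meson has_derivative_linear smooth_on_fder)

lemma smooth_on_fder_const:
  assumes "smooth_on S f" "open S"
  shows "smooth_on S (\<lambda>x. fder f x h)"
  unfolding smooth_on_def
proof
  fix k
  have "Ck_on (Suc k) S f" using assms(1) smooth_on_def by blast
  then obtain D where D: "\<forall>x\<in>S. (f has_derivative D x) (at x within S)" "\<forall>h. Ck_on k S (\<lambda>x. D x h)"
    by auto
  have "D x = fder f x" if "x \<in> S" for x
    using D(1) that fder_eqI by (metis at_within_open[OF that assms(2)])
  then show "Ck_on k S (\<lambda>x. fder f x h)"
    by (intro Ck_on_cong[OF D(2)[rule_format, of h]]) simp
qed

text \<open>Expansion over the basis turns joint smoothness of a fibrewise linear expression into
  smoothness of its coefficient functions. Derivatives of transition maps, the vertical Hessian and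
  the coefficients of the nonlinear connection are all handled in this way.\<close>

lemma smooth_on_family:
  assumes lin: "\<And>x. x \<in> S \<Longrightarrow> linear (F x)" and F: "\<And>b. b \<in> Basis \<Longrightarrow> smooth_on S (\<lambda>x. F x b)"
    and g: "smooth_on S g"
  shows "smooth_on S (\<lambda>x. F x (g x))"
proof (rule smooth_on_cong)
  show "smooth_on S (\<lambda>x. \<Sum>b\<in>Basis. (g x \<bullet> b) *\<^sub>R F x b)"
    by (intro smooth_intros g F)
qed (simp add: linear_eq_sum_Basis[OF lin, symmetric])

lemma smooth_on_fder_app:
  assumes "smooth_on S f" "open S" "smooth_on S g"
  shows "smooth_on S (\<lambda>x. fder f x (g x))"
  by (rule smooth_on_family[OF linear_fder[OF assms(1,2)] smooth_on_fder_const[OF assms(1,2)] assms(3)])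

text \<open>The local witnesses \<open>D\<close> fit together because derivatives on open sets are
  unique: each of them coincides with \<open>fder f\<close>.\<close>

lemma Ck_on_open_local:
  assumes "open S" "\<And>x. x \<in> S \<Longrightarrow> \<exists>T. open T \<and> x \<in> T \<and> T \<subseteq> S \<and> Ck_on k T f"
  shows "Ck_on k S f"
  using assms(2)
proof (induction k arbitrary: f)
  case 0
  show ?case unfolding Ck_on.simps continuous_on_eq_continuous_at[OF assms(1)]
  proof
    fix x assume "x \<in> S"
    then obtain T where "open T" "x \<in> T" "continuous_on T f" using 0 by auto
    then show "isCont f x" using continuous_on_eq_continuous_at by blast
  qed
next
  case (Suc k)
  have *: "\<exists>T. open T \<and> x \<in> T \<and> T \<subseteq> S \<and> (\<forall>y\<in>T. (f has_derivative fder f y) (at y)) \<and>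
      (\<forall>h. Ck_on k T (\<lambda>y. fder f y h))" if "x \<in> S" for x
  proof -
    obtain T D where T: "open T" "x \<in> T" "T \<subseteq> S"
      and D: "\<forall>y\<in>T. (f has_derivative D y) (at y within T)" "\<forall>h. Ck_on k T (\<lambda>y. D y h)"
      using Suc.prems[of x] \<open>x \<in> S\<close> by auto
    have "(f has_derivative D y) (at y) \<and> fder f y = D y" if "y \<in> T" for y
      using D(1) that fder_eqI by (metis at_within_open[OF that T(1)])
    moreover have "Ck_on k T (\<lambda>y. fder f y h)" for h
      using calculation by (intro Ck_on_cong[OF D(2)[rule_format, of h]]) simp
    ultimately show ?thesis using T by metis
  qed
  have "Ck_on k S (\<lambda>y. fder f y h)" for h
  proof (rule Suc.IH)
    fix x assume "x \<in> S"
    then show "\<exists>T. open T \<and> x \<in> T \<and> T \<subseteq> S \<and> Ck_on k T (\<lambda>y. fder f y h)"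
      using *[OF \<open>x \<in> S\<close>] by fastforce
  qed
  moreover have "(f has_derivative fder f x) (at x within S)" if "x \<in> S" for x
    using *[OF that] has_derivative_at_withinI by blast
  ultimately show ?case unfolding Ck_on.simps by (intro exI[of _ "fder f"]) blast
qed

lemma smooth_on_open_local:
  assumes "open S" "\<And>x. x \<in> S \<Longrightarrow> \<exists>T. open T \<and> x \<in> T \<and> T \<subseteq> S \<and> smooth_on T f"
  shows "smooth_on S f"
  using assms unfolding smooth_on_def by (metis Ck_on_open_local)

lemma fder_cong:
  assumes "open S" "x \<in> S" "\<And>y. y \<in> S \<Longrightarrow> f y = g y"
  shows "fder f x = fder g x"
proof -
  have "(f has_derivative D) (at x) \<longleftrightarrow> (g has_derivative D) (at x)" for D
    using assms by (metis has_derivative_transform_within_open)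
  then show ?thesis unfolding frechet_derivative_def by (simp only:)
qed

lemma smooth_on_line_deriv:
  fixes F :: "'a::euclidean_space \<Rightarrow> real"
  assumes "smooth_on S F" "open S" "c + t *\<^sub>R v \<in> S"
  shows "((\<lambda>t. F (c + t *\<^sub>R v)) has_real_derivative fder F (c + t *\<^sub>R v) v) (at t)"
proof -
  have "((\<lambda>t. F (c + t *\<^sub>R v)) has_derivative (\<lambda>r. fder F (c + t *\<^sub>R v) (r *\<^sub>R v))) (at t)"
    by (rule has_derivative_compose[where g = F and f = "\<lambda>t. c + t *\<^sub>R v"
          and g' = "fder F (c + t *\<^sub>R v)" and f' = "\<lambda>r. r *\<^sub>R v"])
      (auto intro!: derivative_eq_intros smooth_on_fder[OF assms])
  moreover have "fder F (c + t *\<^sub>R v) (r *\<^sub>R v) = fder F (c + t *\<^sub>R v) v * r" for r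
    using linear_cmul[OF linear_fder[OF assms]] by simp
  ultimately show ?thesis by (simp add: has_field_derivative_def)
qed

text \<open>Schwarz's theorem; both mixed derivatives are limits of the same second difference quotient.\<close>

lemma second_difference:
  fixes f :: "'a::euclidean_space \<Rightarrow> real"
  assumes f: "smooth_on S f" and S: "open S" "ball x \<delta> \<subseteq> S"
    and s: "0 < s" "s * (norm h + norm k) < \<delta>"
  shows "\<exists>p\<in>ball x \<delta>. f (x + s *\<^sub>R h + s *\<^sub>R k) - f (x + s *\<^sub>R h) - f (x + s *\<^sub>R k) + f x
    = s\<^sup>2 * fder (\<lambda>z. fder f z h) p k"
proof -
  have inb: "x + a *\<^sub>R h + b *\<^sub>R k \<in> ball x \<delta>" if "0 \<le> a" "a \<le> s" "0 \<le> b" "b \<le> s" for a b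
  proof -
    have "norm (a *\<^sub>R h + b *\<^sub>R k) \<le> a * norm h + b * norm k"
      using that by (metis abs_of_nonneg norm_scaleR norm_triangle_ineq)
    also have "\<dots> \<le> s * norm h + s * norm k"
      using that by (intro add_mono mult_right_mono) auto
    also have "\<dots> < \<delta>" using s by (simp add: algebra_simps)
    finally show ?thesis by (simp add: dist_norm norm_minus_commute add.assoc add.commute)
  qed
  have inS: "x + a *\<^sub>R h + b *\<^sub>R k \<in> S" if "0 \<le> a" "a \<le> s" "0 \<le> b" "b \<le> s" for a b
    using inb[OF that] S(2) by blast
  note der = smooth_on_line_deriv[OF _ S(1)]
  have "\<exists>z>0. z < s \<and> (f (x + s *\<^sub>R k + s *\<^sub>R h) - f (x + s *\<^sub>R h)) - (f (x + s *\<^sub>R k + 0 *\<^sub>R h) - f (x + 0 *\<^sub>R h))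
      = (s - 0) * (fder f (x + s *\<^sub>R k + z *\<^sub>R h) h - fder f (x + z *\<^sub>R h) h)"
  proof (rule MVT2[OF s(1)])
    fix a assume a: "0 \<le> a" "a \<le> s"
    show "((\<lambda>a. f (x + s *\<^sub>R k + a *\<^sub>R h) - f (x + a *\<^sub>R h)) has_real_derivative
      fder f (x + s *\<^sub>R k + a *\<^sub>R h) h - fder f (x + a *\<^sub>R h) h) (at a)"
      using inS[of a s] inS[of a 0] a s
      by (intro DERIV_diff der f) (auto simp: algebra_simps)
  qed
  then obtain a where a: "0 < a" "a < s"
    and eq1: "f (x + s *\<^sub>R h + s *\<^sub>R k) - f (x + s *\<^sub>R h) - f (x + s *\<^sub>R k) + f x
      = s * (fder f (x + a *\<^sub>R h + s *\<^sub>R k) h - fder f (x + a *\<^sub>R h) h)"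
    by (auto simp: algebra_simps)
  have "\<exists>z>0. z < s \<and> fder f (x + a *\<^sub>R h + s *\<^sub>R k) h - fder f (x + a *\<^sub>R h + 0 *\<^sub>R k) h
      = (s - 0) * fder (\<lambda>z. fder f z h) (x + a *\<^sub>R h + z *\<^sub>R k) k"
  proof (rule MVT2[OF s(1)])
    fix b assume b: "0 \<le> b" "b \<le> s"
    show "((\<lambda>b. fder f (x + a *\<^sub>R h + b *\<^sub>R k) h) has_real_derivative
      fder (\<lambda>z. fder f z h) (x + a *\<^sub>R h + b *\<^sub>R k) k) (at b)"
      using inS[of a b] a b
      by (intro der[where F = "\<lambda>z. fder f z h"] smooth_on_fder_const f S) auto
  qed
  then obtain b where b: "0 < b" "b < s"
    and eq2: "fder f (x + a *\<^sub>R h + s *\<^sub>R k) h - fder f (x + a *\<^sub>R h) h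
      = s * fder (\<lambda>z. fder f z h) (x + a *\<^sub>R h + b *\<^sub>R k) k"
    by auto
  show ?thesis
    using inb[of a b] a b eq1 eq2 by (intro bexI[of _ "x + a *\<^sub>R h + b *\<^sub>R k"]) (auto simp: power2_eq_square)
qed

lemma fder_commute:
  fixes f :: "'a::euclidean_space \<Rightarrow> real"
  assumes f: "smooth_on S f" and S: "open S" "x \<in> S"
  shows "fder (\<lambda>z. fder f z h) x k = fder (\<lambda>z. fder f z k) x h"
proof (rule ccontr)
  define a b where "a z = fder (\<lambda>z. fder f z h) z k" and "b z = fder (\<lambda>z. fder f z k) z h" for z
  assume "\<not> ?thesis"
  then have ne: "a x \<noteq> b x" by (simp add: a_def b_def)
  define e where "e = dist (a x) (b x) / 2"
  have e: "e > 0" using ne by (simp add: e_def)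
  have "smooth_on S a" "smooth_on S b"
    unfolding a_def b_def by (intro smooth_on_fder_const f S)+
  then have "isCont a x" "isCont b x"
    using S smooth_on_imp_continuous_on continuous_on_eq_continuous_at by blast+
  then obtain d1 d2 where d: "d1 > 0" "\<And>z. dist z x < d1 \<Longrightarrow> dist (a z) (a x) < e"
    "d2 > 0" "\<And>z. dist z x < d2 \<Longrightarrow> dist (b z) (b x) < e"
    using e unfolding continuous_at_eps_delta dist_norm by (metis (no_types, lifting))
  obtain d3 where d3: "d3 > 0" "ball x d3 \<subseteq> S" using S open_contains_ball by blast
  define \<delta> where "\<delta> = min d3 (min d1 d2)"
  have \<delta>: "\<delta> > 0" "ball x \<delta> \<subseteq> S" using d d3 by (auto simp: \<delta>_def)
  \<comment> \<open>With this choice \<open>s * (norm h + norm k)\<close> is at most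
    \<open>\<delta> / 2\<close>; the summand 1 covers the case that \<open>h\<close> and
    \<open>k\<close> are both 0.\<close>
  define s where "s = \<delta> / (norm h + norm k + 1) / 2"
  have s0: "s > 0" using \<delta> by (simp add: s_def add_nonneg_pos)
  have pos: "norm h + norm k + 1 > 0" by (simp add: add_nonneg_pos)
  have "s * (norm h + norm k) \<le> s * (norm h + norm k + 1)" using s0 by simp
  also have "\<dots> = \<delta> / 2" unfolding s_def using pos by (simp add: field_simps)
  finally have s: "s * (norm h + norm k) < \<delta>" using \<delta> by simp
  obtain p where p: "p \<in> ball x \<delta>"
    "f (x + s *\<^sub>R h + s *\<^sub>R k) - f (x + s *\<^sub>R h) - f (x + s *\<^sub>R k) + f x = s\<^sup>2 * a p"
    using second_difference[OF f S(1) \<delta>(2) s0 s] unfolding a_def by blast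
  \<comment> \<open>Exchanging \<open>h\<close> and \<open>k\<close> leaves the second difference
    unchanged but produces the derivative in the other order.\<close>
  obtain q where q: "q \<in> ball x \<delta>"
    "f (x + s *\<^sub>R k + s *\<^sub>R h) - f (x + s *\<^sub>R k) - f (x + s *\<^sub>R h) + f x = s\<^sup>2 * b q"
    using second_difference[OF f S(1) \<delta>(2) s0, of k h] s unfolding b_def by (auto simp: add.commute)
  have "s\<^sup>2 * a p = s\<^sup>2 * b q" using p(2) q(2) by (simp add: algebra_simps)
  then have "a p = b q" using s0 by simp
  moreover have "dist (a p) (a x) < e" "dist (b q) (b x) < e"
    using d p(1) q(1) by (auto simp: \<delta>_def dist_commute)
  moreover have "dist (a x) (b x) \<le> dist (a p) (a x) + dist (b q) (b x)"
    unfolding \<open>a p = b q\<close> using dist_triangle3[of "a x" "b x" "b q"] by simp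
  ultimately have "dist (a x) (b x) < e + e" by linarith
  then show False by (simp add: e_def)
qed

section \<open>Bump functions\<close>

lemma smooth_on_inverse: "smooth_on {0<..} (inverse :: real \<Rightarrow> real)"
  unfolding smooth_on_def
proof
  fix k show "Ck_on k {0<..} (inverse :: real \<Rightarrow> real)"
  proof (induction k)
    case 0
    show ?case by (auto intro!: continuous_intros)
  next
    case (Suc k)
    have "Ck_on k {0<..} (\<lambda>x::real. - h * (inverse x * inverse x))" for h
      by (intro Ck_on_bilinear[OF bounded_bilinear_mult] Ck_on_const Suc)
    moreover have "((inverse :: real \<Rightarrow> real) has_derivative (\<lambda>h. - h * (inverse x * inverse x)))
        (at x within {0<..})" if "x \<in> {0<..}" for x
      by (rule has_derivative_eq_rhs[OF has_derivative_inverse']) (use that in \<open>auto simp: fun_eq_iff\<close>)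
    ultimately show ?case unfolding Ck_on.simps
      by (intro exI[of _ "\<lambda>x h. - h * (inverse x * inverse x)"]) blast
  qed
qed

text \<open>Differentiating exp (-1/t) produces powers of 1/t. The index \<open>n\<close> makes the
  family closed under differentiation up to linear combinations, so one induction over the order,
  for all \<open>n\<close> at once, yields smoothness.\<close>

definition flat_fun :: "nat \<Rightarrow> real \<Rightarrow> real" where
  "flat_fun n t = (if t \<le> 0 then 0 else inverse t ^ n * exp (- inverse t))"

lemma flat_fun_pos: "t > 0 \<Longrightarrow> flat_fun n t > 0"
  by (simp add: flat_fun_def)

lemma flat_fun_nonneg: "flat_fun n t \<ge> 0"
  by (simp add: flat_fun_def)

text \<open>With x = 1/t the limit from the right is that of x^n / exp x at infinity.\<close>

lemma flat_fun_tendsto_0: "(flat_fun n \<longlongrightarrow> 0) (at 0)"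
proof -
  have "((\<lambda>x. x ^ n / exp x) \<longlongrightarrow> 0) (at_top :: real filter)"
    by (rule tendsto_power_div_exp_0)
  then have "((\<lambda>t. inverse t ^ n / exp (inverse t)) \<longlongrightarrow> 0) (at_right (0::real))"
    by (rule filterlim_compose[OF _ filterlim_inverse_at_top_right])
  then have "(flat_fun n \<longlongrightarrow> 0) (at_right 0)"
    by (rule Lim_transform_eventually)
      (auto simp: flat_fun_def exp_minus divide_inverse eventually_at_filter)
  moreover have "(flat_fun n \<longlongrightarrow> 0) (at_left 0)"
    by (rule Lim_transform_eventually[OF tendsto_const])
      (auto simp: flat_fun_def eventually_at_filter)
  ultimately show ?thesis by (simp add: filterlim_split_at)
qed

lemma flat_fun_deriv:
  "(flat_fun n has_real_derivative flat_fun (n + 2) t - real n * flat_fun (n + 1) t) (at t)"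
proof -
  consider "t > 0" | "t < 0" | "t = 0" by linarith
  then show ?thesis
  proof cases
    case 1
    have "((\<lambda>t. inverse t ^ n * exp (- inverse t)) has_real_derivative
      flat_fun (n + 2) t - real n * flat_fun (n + 1) t) (at t)"
      using 1 by (auto intro!: derivative_eq_intros simp: flat_fun_def)
        (cases n; simp add: field_simps power2_eq_square)
    then show ?thesis
      by (rule has_field_derivative_transform_within_open[where S = "{0<..}"])
        (use 1 in \<open>auto simp: flat_fun_def\<close>)
  next
    case 2
    have "((\<lambda>t. 0) has_real_derivative 0) (at t)" by simp
    then have "(flat_fun n has_real_derivative 0) (at t)"
      by (rule has_field_derivative_transform_within_open[where S = "{..<0}"])
        (use 2 in \<open>auto simp: flat_fun_def\<close>)
    then show ?thesis using 2 by (simp add: flat_fun_def)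
  next
    case 3
    \<comment> \<open>At 0 the difference quotient is again a member of the family, so its limit is
      already known.\<close>
    have "(flat_fun n (0 + h) - flat_fun n 0) / h = flat_fun (n + 1) h" for h
      by (simp add: flat_fun_def divide_inverse)
    then show ?thesis using flat_fun_tendsto_0[of "n + 1"] 3
      by (simp add: DERIV_def flat_fun_def[of _ 0])
  qed
qed

lemma Ck_on_flat_fun: "Ck_on k UNIV (flat_fun n)"
proof (induction k arbitrary: n)
  case 0
  have "isCont (flat_fun n) t" for t using flat_fun_deriv DERIV_isCont by blast
  then show ?case by (simp add: continuous_on_eq_continuous_at)
next
  case (Suc k)
  have "Ck_on k UNIV (\<lambda>t. flat_fun (n + 2) t * h + - real n * h * flat_fun (n + 1) t)" for h
    by (intro Ck_on_add Ck_on_bilinear[OF bounded_bilinear_mult] Ck_on_const Suc)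
  moreover have "(flat_fun n has_derivative
      (\<lambda>h. flat_fun (n + 2) t * h + - real n * h * flat_fun (n + 1) t)) (at t within UNIV)" for t
    using flat_fun_deriv[of n t] unfolding has_field_derivative_def
    by (rule has_derivative_eq_rhs) (auto simp: fun_eq_iff algebra_simps)
  ultimately show ?case unfolding Ck_on.simps
    by (intro exI[of _ "\<lambda>t h. flat_fun (n + 2) t * h + - real n * h * flat_fun (n + 1) t"]) blast
qed

lemma bump_function_exists:
  fixes x0 :: "'a::euclidean_space"
  assumes "r > 0"
  obtains f :: "'a \<Rightarrow> real" where "smooth_on UNIV f" "\<And>x. x \<in> cball x0 r \<Longrightarrow> f x = 1"
    "\<And>x. x \<notin> cball x0 (2 * r) \<Longrightarrow> f x = 0"
proof -
  \<comment> \<open>\<open>q\<close> is at least 1 on the ball of radius \<open>r\<close> and at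
    most 0 from distance sqrt 2 * r on, in particular beyond \<open>2 * r\<close>. Using the squared
    distance keeps it smooth at \<open>x0\<close>.\<close>
  define q where "q x = 2 - (x - x0) \<bullet> (x - x0) / r\<^sup>2" for x :: 'a
  \<comment> \<open>The summands never vanish together, as \<open>t\<close> and \<open>1 - t\<close>
    are not both nonpositive. The quotient by \<open>d\<close> is 1 where the second summand
    vanishes and 0 where the first one does.\<close>
  define d where "d t = flat_fun 0 t + flat_fun 0 (1 - t)" for t
  define f where "f x = flat_fun 0 (q x) * inverse (d (q x))" for x
  have flat: "smooth_on UNIV (flat_fun 0)"
    by (simp add: smooth_on_def Ck_on_flat_fun)
  have dpos: "d t > 0" for t
    using flat_fun_pos[of t 0] flat_fun_pos[of "1 - t" 0] flat_fun_nonneg[of 0 t]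
      flat_fun_nonneg[of 0 "1 - t"] unfolding d_def by (cases "t > 0") auto
  have q: "smooth_on UNIV q"
    unfolding q_def divide_inverse by (intro smooth_intros)
  have d: "smooth_on UNIV d"
    unfolding d_def by (intro smooth_intros flat smooth_on_compose[OF flat]) auto
  have "smooth_on UNIV f"
    unfolding f_def
    by (intro smooth_on_mult smooth_on_compose[OF flat q] smooth_on_compose[OF smooth_on_inverse]
        smooth_on_compose[OF d q]) (auto simp: dpos)
  moreover have "f x = 1" if "x \<in> cball x0 r" for x
  proof -
    have "(x - x0) \<bullet> (x - x0) \<le> r\<^sup>2"
      using that power_mono[of "norm (x - x0)" r 2]
      by (simp add: dist_norm norm_minus_commute flip: power2_norm_eq_inner)
    then have "q x \<ge> 1" using assms by (simp add: q_def)
    then have "flat_fun 0 (1 - q x) = 0" by (simp add: flat_fun_def)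
    then show ?thesis using dpos[of "q x"] by (simp add: f_def d_def)
  qed
  moreover have "f x = 0" if "x \<notin> cball x0 (2 * r)" for x
  proof -
    have "2 * r < norm (x - x0)"
      using that by (simp add: dist_norm norm_minus_commute)
    then have "(2 * r)\<^sup>2 < (norm (x - x0))\<^sup>2" using assms by (intro power_strict_mono) auto
    moreover have "2 * r\<^sup>2 \<le> (2 * r)\<^sup>2" by (simp add: power_mult_distrib)
    ultimately have "2 * r\<^sup>2 \<le> (x - x0) \<bullet> (x - x0)"
      unfolding power2_norm_eq_inner by linarith
    then have "q x \<le> 0" using assms by (simp add: q_def field_simps)
    then show ?thesis by (simp add: f_def flat_fun_def)
  qed
  ultimately show ?thesis using that by blast
qed


section \<open>Integral curves\<close>

text \<open>On the compact ball the derivative is bounded along every basis vector, hence in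
  operator norm; convexity of the ball then permits the mean value inequality.\<close>

lemma smooth_on_lipschitz_cball:
  fixes F :: "'a::euclidean_space \<Rightarrow> 'b::euclidean_space"
  assumes F: "smooth_on S F" and S: "open S" "cball x0 r \<subseteq> S"
  obtains B where "B > 0" "\<And>x y. x \<in> cball x0 r \<Longrightarrow> y \<in> cball x0 r \<Longrightarrow> norm (F x - F y) \<le> B * norm (x - y)"
proof -
  have "\<exists>K. \<forall>x\<in>cball x0 r. norm (fder F x b) \<le> K" for b
  proof -
    have "continuous_on (cball x0 r) (\<lambda>x. fder F x b)"
      using smooth_on_imp_continuous_on[OF smooth_on_fder_const[OF F S(1)]] S(2) continuous_on_subset by blast
    then have "bounded ((\<lambda>x. fder F x b) ` cball x0 r)"
      by (intro compact_imp_bounded compact_continuous_image compact_cball)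
    then show ?thesis by (auto simp: bounded_iff)
  qed
  then obtain K where K: "\<And>b x. x \<in> cball x0 r \<Longrightarrow> norm (fder F x b) \<le> K b" by metis
  \<comment> \<open>The summand 1 makes \<open>B\<close> positive even for a constant
    \<open>F\<close>; the existence proof for integral curves divides by it.\<close>
  define B where "B = (\<Sum>b\<in>Basis. \<bar>K b\<bar>) + 1"
  have "B > 0" by (simp add: B_def add_nonneg_pos sum_nonneg)
  moreover have "norm (F x - F y) \<le> B * norm (x - y)" if "x \<in> cball x0 r" "y \<in> cball x0 r" for x y
  proof (rule differentiable_bound[OF convex_cball _ _ that])
    fix z assume z: "z \<in> cball x0 r"
    then have zS: "z \<in> S" using S(2) by blast
    show "(F has_derivative fder F z) (at z within cball x0 r)"
      using smooth_on_fder[OF F S(1) zS] by (rule has_derivative_at_withinI)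
    show "onorm (fder F z) \<le> B"
    proof (rule onorm_le)
      fix h
      have "norm (fder F z h) = norm (\<Sum>b\<in>Basis. (h \<bullet> b) *\<^sub>R fder F z b)"
        by (simp add: linear_eq_sum_Basis[OF linear_fder[OF F S(1) zS], of h])
      also have "\<dots> \<le> (\<Sum>b\<in>Basis. norm h * \<bar>K b\<bar>)"
      proof (rule sum_norm_le)
        fix b :: 'a assume b: "b \<in> Basis"
        have "norm (fder F z b) \<le> \<bar>K b\<bar>" using K[OF z, of b] by linarith
        then show "norm ((h \<bullet> b) *\<^sub>R fder F z b) \<le> norm h * \<bar>K b\<bar>"
          using Basis_le_norm[OF b, of h] by (simp add: mult_mono)
      qed
      also have "\<dots> = norm h * (\<Sum>b\<in>Basis. \<bar>K b\<bar>)" by (simp add: sum_distrib_left)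
      also have "\<dots> \<le> norm h * B" by (intro mult_left_mono) (auto simp: B_def)
      finally show "norm (fder F z h) \<le> B * norm h" by (simp add: mult.commute)
    qed
  qed
  ultimately show ?thesis using that by blast
qed

text \<open>Picard-Lindeloef on a one-sided interval. That is enough to start a geodesic, because
  parameter domains may contain an endpoint.\<close>

lemma integral_curve_exists:
  fixes F :: "'a::euclidean_space \<Rightarrow> 'a"
  assumes F: "smooth_on S F" and S: "open S" "x0 \<in> S"
  obtains \<epsilon> u where "\<epsilon> > 0" "u 0 = x0"
    "\<And>t. t \<in> {0..\<epsilon>} \<Longrightarrow> u t \<in> S \<and> (u has_vector_derivative F (u t)) (at t within {0..\<epsilon>})"
proof -
  obtain r where r: "r > 0" "cball x0 r \<subseteq> S" using S open_contains_cball by blast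
  have contF: "continuous_on (cball x0 r) F"
    using smooth_on_imp_continuous_on[OF F] r(2) continuous_on_subset by blast
  then have "bounded (F ` cball x0 r)"
    by (intro compact_imp_bounded compact_continuous_image compact_cball)
  then obtain M where M: "M > 0" "\<And>x. x \<in> cball x0 r \<Longrightarrow> norm (F x) \<le> M"
    by (auto simp: bounded_pos)
  obtain B where B: "B > 0"
    "\<And>x y. x \<in> cball x0 r \<Longrightarrow> y \<in> cball x0 r \<Longrightarrow> norm (F x - F y) \<le> B * norm (x - y)"
    using smooth_on_lipschitz_cball[OF F S(1) r(2)] by blast
  \<comment> \<open>The first bound keeps the Picard iterates in the ball, the second makes the
    Picard operator a contraction with constant 1/2.\<close>
  define \<epsilon> where "\<epsilon> = min (r / M) (1 / (2 * B))"
  have e: "\<epsilon> > 0" "M * \<epsilon> \<le> r" "B * \<epsilon> \<le> 1 / 2"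
    using r(1) M(1) B(1) by (auto simp: \<epsilon>_def min_def field_simps)
  \<comment> \<open>Clamping the time to \<open>{0..\<epsilon>}\<close> lets the Picard operator act
    on bounded continuous functions on the whole real line, which form a complete metric
    space.\<close>
  define cl where "cl t = max 0 (min \<epsilon> t)" for t
  have cl: "cl t \<in> {0..\<epsilon>}" for t using e by (auto simp: cl_def)
  have cl_id: "cl t = t" if "t \<in> {0..\<epsilon>}" for t using that by (auto simp: cl_def)
  define X where "X = {u :: real \<Rightarrow>\<^sub>C 'a. \<forall>t. apply_bcontfun u t \<in> cball x0 r}"
  define P where "P u t = x0 + integral {0..cl t} (\<lambda>s. F (apply_bcontfun u s))" for u t
  have cF: "continuous_on T (\<lambda>s. F (apply_bcontfun u s))" if "u \<in> X" for u T
    by (rule continuous_on_compose2[OF contF])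
      (use that in \<open>auto simp: X_def intro: continuous_on_apply_bcontfun\<close>)
  have Pin: "P u t \<in> cball x0 r" if u: "u \<in> X" for u t
  proof -
    have "norm (integral {0..cl t} (\<lambda>s. F (apply_bcontfun u s))) \<le> M * (cl t - 0)"
      by (rule integral_bound) (use cl[of t] cF[OF u] M(2) u in \<open>auto simp: X_def\<close>)
    also have "\<dots> \<le> M * \<epsilon>" using cl[of t] M(1) by simp
    also have "\<dots> \<le> r" by (rule e)
    finally show ?thesis by (simp add: P_def dist_norm)
  qed
  have Pcont: "continuous_on UNIV (P u)" if u: "u \<in> X" for u
  proof -
    have "continuous_on {0..\<epsilon>} (\<lambda>t. integral {0..t} (\<lambda>s. F (apply_bcontfun u s)))"
      by (intro indefinite_integral_continuous_1 integrable_continuous_interval cF u)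
    moreover have "continuous_on UNIV cl"
      unfolding cl_def by (intro continuous_intros)
    ultimately have "continuous_on UNIV (\<lambda>t. integral {0..cl t} (\<lambda>s. F (apply_bcontfun u s)))"
      by (rule continuous_on_compose2) (use cl in blast)
    then show ?thesis unfolding P_def by (intro continuous_on_add continuous_on_const)
  qed
  have Pbc: "P u \<in> bcontfun" if u: "u \<in> X" for u
  proof -
    have "range (P u) \<subseteq> cball x0 r" using Pin[OF u] by blast
    then have "bounded (range (P u))" using bounded_cball bounded_subset by blast
    then show ?thesis using Pcont[OF u] by (simp add: bcontfun_def)
  qed
  define \<Phi> where "\<Phi> u = Bcontfun (P u)" for u
  have app: "apply_bcontfun (\<Phi> u) t = P u t" if "u \<in> X" for u t
    using Pbc[OF that] by (simp add: \<Phi>_def Bcontfun_inverse)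
  have "closed X"
  proof -
    have "X = (\<Inter>t. (\<lambda>u. apply_bcontfun u t) -` cball x0 r)" by (auto simp: X_def)
    moreover have "closed ((\<lambda>u::real \<Rightarrow>\<^sub>C 'a. apply_bcontfun u t) -` cball x0 r)" for t
    proof (rule closed_vimage[OF closed_cball])
      show "continuous_on UNIV (\<lambda>u::real \<Rightarrow>\<^sub>C 'a. apply_bcontfun u t)"
        unfolding continuous_on_iff using dist_bounded le_less_trans by blast
    qed
    ultimately show ?thesis by auto
  qed
  then have "complete X" by (simp add: complete_eq_closed)
  moreover have "const_bcontfun x0 \<in> X" using r by (simp add: X_def)
  moreover have "\<Phi> ` X \<subseteq> X" using Pin app by (auto simp: X_def)
  moreover have "dist (\<Phi> u) (\<Phi> v) \<le> 1 / 2 * dist u v" if uv: "u \<in> X" "v \<in> X" for u v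
  proof (rule dist_bound)
    fix t
    have int: "(\<lambda>s. F (apply_bcontfun w s)) integrable_on {0..cl t}" if "w \<in> X" for w
      by (intro integrable_continuous_interval cF that)
    have "dist (apply_bcontfun (\<Phi> u) t) (apply_bcontfun (\<Phi> v) t)
      = norm (integral {0..cl t} (\<lambda>s. F (apply_bcontfun u s) - F (apply_bcontfun v s)))"
      by (simp add: app uv P_def dist_norm integral_diff int)
    also have "\<dots> \<le> (B * dist u v) * (cl t - 0)"
    proof (rule integral_bound)
      fix s assume "s \<in> {0..cl t}"
      have "norm (F (apply_bcontfun u s) - F (apply_bcontfun v s))
          \<le> B * norm (apply_bcontfun u s - apply_bcontfun v s)"
        using uv by (intro B(2)) (auto simp: X_def)
      also have "\<dots> \<le> B * dist u v"
        using B(1) dist_bounded[of u s v] by (simp add: dist_norm)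
      finally show "norm (F (apply_bcontfun u s) - F (apply_bcontfun v s)) \<le> B * dist u v" .
    qed (use cl[of t] in \<open>auto intro!: continuous_on_diff cF uv\<close>)
    also have "\<dots> \<le> (B * dist u v) * \<epsilon>"
      using cl[of t] B(1) by (intro mult_left_mono) auto
    also have "\<dots> = (B * \<epsilon>) * dist u v" by simp
    also have "\<dots> \<le> 1 / 2 * dist u v" using e by (intro mult_right_mono) auto
    finally show "dist (apply_bcontfun (\<Phi> u) t) (apply_bcontfun (\<Phi> v) t) \<le> 1 / 2 * dist u v" .
  qed
  ultimately have "\<exists>!u. u \<in> X \<and> \<Phi> u = u"
    by (intro Banach_fix[of X "1 / 2" \<Phi>]) auto
  then obtain u where u: "u \<in> X" "\<Phi> u = u" by blast
  have ut: "apply_bcontfun u t = x0 + integral {0..t} (\<lambda>s. F (apply_bcontfun u s))" if "t \<in> {0..\<epsilon>}" for t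
    using app[OF u(1), of t] u(2) cl_id[OF that] by (simp add: P_def)
  show ?thesis
  proof (rule that[of \<epsilon> "apply_bcontfun u"])
    show "apply_bcontfun u 0 = x0" using ut[of 0] e by simp
    fix t assume t: "t \<in> {0..\<epsilon>}"
    have "((\<lambda>t. integral {0..t} (\<lambda>s. F (apply_bcontfun u s))) has_vector_derivative F (apply_bcontfun u t))
        (at t within {0..\<epsilon>})"
      by (rule integral_has_vector_derivative[OF cF[OF u(1)] t])
    then have "((\<lambda>t. x0 + integral {0..t} (\<lambda>s. F (apply_bcontfun u s))) has_vector_derivative
        F (apply_bcontfun u t)) (at t within {0..\<epsilon>})"
      by (auto intro!: derivative_eq_intros)
    then have "(apply_bcontfun u has_vector_derivative F (apply_bcontfun u t)) (at t within {0..\<epsilon>})"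
      unfolding has_vector_derivative_def by - (rule has_derivative_transform[OF t ut])
    then show "apply_bcontfun u t \<in> S \<and> (apply_bcontfun u has_vector_derivative F (apply_bcontfun u t))
        (at t within {0..\<epsilon>})"
      using u(1) r(2) by (auto simp: X_def)
  qed (rule e)
qed

text \<open>Bootstrapping: if \<open>u\<close> is k times differentiable, so is
  \<open>F (u t)\<close>, which is the derivative of \<open>u\<close>.\<close>

lemma smooth_on_integral_curve:
  fixes F :: "'a::euclidean_space \<Rightarrow> 'a"
  assumes F: "smooth_on S F"
    and u: "\<And>t. t \<in> I \<Longrightarrow> u t \<in> S \<and> (u has_vector_derivative F (u t)) (at t within I)"
  shows "smooth_on I u"
  unfolding smooth_on_def
proof
  fix k show "Ck_on k I u"
  proof (induction k)
    case 0
    have "(u has_derivative (\<lambda>h. h *\<^sub>R F (u t))) (at t within I)" if "t \<in> I" for t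
      using u[OF that] by (simp add: has_vector_derivative_def)
    then show ?case unfolding Ck_on.simps by (rule has_derivative_continuous_on)
  next
    case (Suc k)
    have "Ck_on k I (\<lambda>t. F (u t))"
      using F u by (intro Ck_on_compose[of k S F I u] Suc) (auto simp: smooth_on_def)
    then have "Ck_on k I (\<lambda>t. h *\<^sub>R F (u t))" for h
      by (intro Ck_on_bilinear[OF bounded_bilinear_scaleR] Ck_on_const)
    moreover have "(u has_derivative (\<lambda>h. h *\<^sub>R F (u t))) (at t within I)" if "t \<in> I" for t
      using u[OF that] by (simp add: has_vector_derivative_def)
    ultimately show ?case unfolding Ck_on.simps
      by (intro exI[of _ "\<lambda>t h. h *\<^sub>R F (u t)"]) blast
  qed
qed

section \<open>Charts and tangent vectors\<close>

lemma openin_mfd_topology: "smooth_atlas A \<Longrightarrow> openin (mfd_topology A) W \<longleftrightarrow> mfd_open A W"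
  by (simp add: mfd_topology_def istopology_mfd_open topology_inverse')

lemma mfd_open_Int: "smooth_atlas A \<Longrightarrow> mfd_open A S \<Longrightarrow> mfd_open A T \<Longrightarrow> mfd_open A (S \<inter> T)"
  using istopology_mfd_open unfolding istopology_def by blast

lemma mfd_openD: "mfd_open A W \<Longrightarrow> (U, \<phi>) \<in> A \<Longrightarrow> open (\<phi> ` (U \<inter> W))"
  by (auto simp: mfd_open_def)

text \<open>The default 0 is that of \<open>velocity\<close>, so that velocities of curves and
  coordinate vectors can be equal as total operators on functions.\<close>

definition tvec :: "('a, 'e::euclidean_space) chart set \<Rightarrow> 'a set \<Rightarrow> ('a \<Rightarrow> 'e) \<Rightarrow> 'a \<Rightarrow> 'e \<Rightarrow> 'a tvec" where
  "tvec A U \<phi> p w = (\<lambda>f. if smooth_near A p f then fder (\<lambda>x. f (inv_into U \<phi> x)) (\<phi> p) w else 0)"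

definition comps :: "('a \<Rightarrow> 'e::euclidean_space) \<Rightarrow> 'a tvec \<Rightarrow> 'e" where
  "comps \<phi> v = (\<Sum>b\<in>Basis. v (\<lambda>q. \<phi> q \<bullet> b) *\<^sub>R b)"

lemma comps_inner: "b \<in> Basis \<Longrightarrow> comps \<phi> v \<bullet> b = v (\<lambda>q. \<phi> q \<bullet> b)"
  by (simp add: comps_def inner_sum_left inner_Basis if_distrib sum.delta cong: if_cong)

lemma comps_add: "comps \<phi> (v + w) = comps \<phi> v + comps \<phi> w"
  by (simp add: comps_def scaleR_add_left sum.distrib)

lemma comps_diff: "comps \<phi> (v - w) = comps \<phi> v - comps \<phi> w"
  by (simp add: comps_def scaleR_diff_left sum_subtractf fun_diff_def)

lemma comps_tscale: "comps \<phi> (r \<cdot> v) = r *\<^sub>R comps \<phi> v"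
  by (simp add: comps_def tscale_def scaleR_sum_right)

lemma comps_zero [simp]: "comps \<phi> 0 = 0"
  by (simp add: comps_def)

lemma tangent_coords_eq: "tangent_coords \<phi> u = (\<phi> (fst u), comps \<phi> (snd u))"
  by (simp add: tangent_coords_def comps_def split: prod.splits)

lemma fder_inner_right:
  assumes "smooth_on S f" "open S" "x \<in> S"
  shows "fder (\<lambda>x. f x \<bullet> b) x w = fder f x w \<bullet> b"
proof -
  have "((\<lambda>x. f x \<bullet> b) has_derivative (\<lambda>w. fder f x w \<bullet> b)) (at x)"
    by (intro has_derivative_inner_left smooth_on_fder[OF assms])
  then show ?thesis by (simp add: fder_eqI)
qed

lemma fder_bounded_linear: "bounded_linear f \<Longrightarrow> fder f x = f"
  by (intro fder_eqI bounded_linear_imp_has_derivative)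

locale chart =
  fixes A :: "('a, 'e::euclidean_space) chart set" and U :: "'a set" and \<phi> :: "'a \<Rightarrow> 'e"
  assumes atlas: "smooth_atlas A" and chart: "(U, \<phi>) \<in> A"
begin

abbreviation "\<iota> \<equiv> inv_into U \<phi>"

lemma inj: "inj_on \<phi> U" and open_image: "open (\<phi> ` U)"
  using atlas chart by (auto simp: smooth_atlas_def)

lemma iota_phi [simp]: "p \<in> U \<Longrightarrow> \<iota> (\<phi> p) = p"
  using inj by simp

lemma phi_iota [simp]: "x \<in> \<phi> ` U \<Longrightarrow> \<phi> (\<iota> x) = x"
  by (rule f_inv_into_f)

lemma iota_in [simp]: "x \<in> \<phi> ` U \<Longrightarrow> \<iota> x \<in> U"
  by (rule inv_into_into)

lemma U_subset_points: "U \<subseteq> points A"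
  using chart by (auto simp: points_def)

lemma open_overlap: "(V, \<psi>) \<in> A \<Longrightarrow> open (\<phi> ` (U \<inter> V))"
  using atlas chart by (fastforce simp: smooth_atlas_def)

lemma transition_smooth: "(V, \<psi>) \<in> A \<Longrightarrow> smooth_on (\<phi> ` (U \<inter> V)) (\<lambda>x. \<psi> (\<iota> x))"
  using atlas chart by (fastforce simp: smooth_atlas_def o_def)

lemma open_image_mfd_open: "mfd_open A W \<Longrightarrow> W \<subseteq> U \<Longrightarrow> open (\<phi> ` W)"
  using mfd_openD[OF _ chart] by (metis Int_absorb1)

text \<open>Openness is tested in all charts; in each of them the set is a preimage under a
  transition map, which is continuous on an open set.\<close>

lemma mfd_open_preimage:
  assumes S: "open S"
  shows "mfd_open A {p\<in>U. \<phi> p \<in> S}"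
  unfolding mfd_open_def
proof (intro conjI ballI, goal_cases)
  case 1
  then show ?case using U_subset_points by blast
next
  case (2 c)
  obtain V \<psi> where c: "c = (V, \<psi>)" by force
  interpret V: chart A V \<psi> using atlas 2 c by unfold_locales auto
  have "\<psi> ` (V \<inter> {p\<in>U. \<phi> p \<in> S}) = (\<lambda>x. \<phi> (V.\<iota> x)) -` S \<inter> \<psi> ` (V \<inter> U)"
    by (auto simp: image_iff)
  moreover have "open ((\<lambda>x. \<phi> (V.\<iota> x)) -` S \<inter> \<psi> ` (V \<inter> U))"
    using smooth_on_imp_continuous_on[OF V.transition_smooth[OF chart]] V.open_overlap[OF chart] S
    by (metis continuous_on_open_vimage)
  ultimately show ?case by (simp add: c)
qed

lemma mfd_open_U: "mfd_open A U"
  using mfd_open_preimage[OF open_UNIV] by simp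

lemma smooth_fun_onI:
  assumes W: "mfd_open A W" "W \<subseteq> U" and f: "smooth_on (\<phi> ` W) (\<lambda>x. f (\<iota> x))"
  shows "smooth_fun_on A W f"
  unfolding smooth_fun_on_def
proof (intro conjI W ballI, goal_cases)
  case (1 c)
  obtain V \<psi> where c: "c = (V, \<psi>)" by force
  interpret V: chart A V \<psi> using atlas 1 c by unfold_locales auto
  have "smooth_on (\<psi> ` (V \<inter> W)) (\<lambda>x. f (\<iota> (\<phi> (V.\<iota> x))))"
  proof (rule smooth_on_compose[OF f])
    show "smooth_on (\<psi> ` (V \<inter> W)) (\<lambda>x. \<phi> (V.\<iota> x))"
      by (rule smooth_on_subset[OF V.transition_smooth[OF chart]]) (use W in blast)
  qed auto
  then have "smooth_on (\<psi> ` (V \<inter> W)) (f \<circ> V.\<iota>)"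
    by (rule smooth_on_cong) (use W in auto)
  then show ?case by (simp add: c)
qed

lemma smooth_fun_onD: "smooth_fun_on A W f \<Longrightarrow> smooth_on (\<phi> ` (U \<inter> W)) (\<lambda>x. f (\<iota> x))"
  using chart by (fastforce simp: smooth_fun_on_def o_def)

lemma smooth_near_iff:
  assumes "p \<in> U"
  shows "smooth_near A p f \<longleftrightarrow> (\<exists>S. open S \<and> \<phi> p \<in> S \<and> S \<subseteq> \<phi> ` U \<and> smooth_on S (\<lambda>x. f (\<iota> x)))"
proof
  assume "smooth_near A p f"
  then obtain W where W: "p \<in> W" "smooth_fun_on A W f" by (auto simp: smooth_near_def)
  then have "open (\<phi> ` (U \<inter> W))" using mfd_openD[OF _ chart] by (auto simp: smooth_fun_on_def)
  then show "\<exists>S. open S \<and> \<phi> p \<in> S \<and> S \<subseteq> \<phi> ` U \<and> smooth_on S (\<lambda>x. f (\<iota> x))"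
    using smooth_fun_onD[OF W(2)] W(1) assms by blast
next
  assume "\<exists>S. open S \<and> \<phi> p \<in> S \<and> S \<subseteq> \<phi> ` U \<and> smooth_on S (\<lambda>x. f (\<iota> x))"
  then obtain S where S: "open S" "\<phi> p \<in> S" "S \<subseteq> \<phi> ` U" "smooth_on S (\<lambda>x. f (\<iota> x))" by blast
  have "smooth_fun_on A {p\<in>U. \<phi> p \<in> S} f"
    by (rule smooth_fun_onI) (auto intro: mfd_open_preimage S smooth_on_subset[OF S(4)])
  then show "smooth_near A p f" unfolding smooth_near_def
    using assms S(2) by (intro exI[of _ "{p\<in>U. \<phi> p \<in> S}"]) simp
qed

lemma smooth_near_coord: "p \<in> U \<Longrightarrow> smooth_near A p (\<lambda>q. \<phi> q \<bullet> b)"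
proof -
  assume p: "p \<in> U"
  have "smooth_on (\<phi> ` U) (\<lambda>x. x \<bullet> b)" by (intro smooth_intros)
  then have "smooth_on (\<phi> ` U) (\<lambda>x. \<phi> (\<iota> x) \<bullet> b)" by (rule smooth_on_cong) simp
  then show ?thesis using p open_image by (auto simp: smooth_near_iff)
qed

lemma tvec_apply:
  assumes "p \<in> U" "open S" "\<phi> p \<in> S" "S \<subseteq> \<phi> ` U" "smooth_on S (\<lambda>x. f (\<iota> x))"
  shows "tvec A U \<phi> p w f = fder (\<lambda>x. f (\<iota> x)) (\<phi> p) w"
  using assms smooth_near_iff by (auto simp: tvec_def)

lemma tvec_apply_cong:
  assumes "p \<in> U" "open S" "\<phi> p \<in> S" "S \<subseteq> \<phi> ` U" "smooth_on S g" "\<And>x. x \<in> S \<Longrightarrow> f (\<iota> x) = g x"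
  shows "tvec A U \<phi> p w f = fder g (\<phi> p) w"
proof -
  have "smooth_on S (\<lambda>x. f (\<iota> x))" by (rule smooth_on_cong[OF assms(5)]) (simp add: assms(6))
  then have "tvec A U \<phi> p w f = fder (\<lambda>x. f (\<iota> x)) (\<phi> p) w"
    using assms by (intro tvec_apply) auto
  also have "\<dots> = fder g (\<phi> p) w" using fder_cong[OF assms(2,3)] assms(6) by metis
  finally show ?thesis .
qed

lemma comps_tvec [simp]:
  assumes "p \<in> U" shows "comps \<phi> (tvec A U \<phi> p w) = w"
proof (rule euclidean_eqI)
  fix b :: 'e assume b: "b \<in> Basis"
  have "tvec A U \<phi> p w (\<lambda>q. \<phi> q \<bullet> b) = fder (\<lambda>x. x \<bullet> b) (\<phi> p) w"
    using assms open_image by (intro tvec_apply_cong[where S = "\<phi> ` U"] smooth_intros) auto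
  then show "comps \<phi> (tvec A U \<phi> p w) \<bullet> b = w \<bullet> b"
    by (simp add: comps_inner b fder_bounded_linear bounded_linear_inner_left)
qed

lemma tvec_linear:
  assumes "p \<in> U"
  shows "tvec A U \<phi> p (r *\<^sub>R w + s *\<^sub>R z) = r \<cdot> tvec A U \<phi> p w + s \<cdot> tvec A U \<phi> p z"
proof
  fix f
  show "tvec A U \<phi> p (r *\<^sub>R w + s *\<^sub>R z) f = (r \<cdot> tvec A U \<phi> p w + s \<cdot> tvec A U \<phi> p z) f"
  proof (cases "smooth_near A p f")
    case True
    then obtain S where "open S" "\<phi> p \<in> S" "smooth_on S (\<lambda>x. f (\<iota> x))"
      using smooth_near_iff[OF assms] by blast
    then have "linear (fder (\<lambda>x. f (\<iota> x)) (\<phi> p))" by (intro linear_fder)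
    then show ?thesis by (simp add: tvec_def True tscale_def linear_add linear_cmul)
  qed (simp add: tvec_def tscale_def)
qed

lemma tvec_add: "p \<in> U \<Longrightarrow> tvec A U \<phi> p (w + z) = tvec A U \<phi> p w + tvec A U \<phi> p z"
  using tvec_linear[of p 1 w 1 z] by (simp add: tscale_def)

lemma tvec_scaleR: "p \<in> U \<Longrightarrow> tvec A U \<phi> p (r *\<^sub>R w) = r \<cdot> tvec A U \<phi> p w"
  using tvec_linear[of p r w 0 0] by (simp add: tscale_def plus_fun_def)

lemma tvec_zero: "p \<in> U \<Longrightarrow> tvec A U \<phi> p 0 = 0"
  using tvec_scaleR[of p 0 0] by (simp add: tscale_def zero_fun_def)

text \<open>The chain rule for derivatives within \<open>I\<close>, so that endpoints of intervals
  are covered.\<close>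

lemma velocity_eq_tvec:
  assumes t: "t \<in> I" "at t within I \<noteq> bot" and d: "d > 0" "c ` (I \<inter> ball t d) \<subseteq> U"
    and der: "((\<lambda>s. \<phi> (c s)) has_vector_derivative w) (at t within I)"
  shows "velocity A I c t = tvec A U \<phi> (c t) w"
proof
  fix f
  have p: "c t \<in> U" using t d by auto
  show "velocity A I c t f = tvec A U \<phi> (c t) w f"
  proof (cases "smooth_near A (c t) f")
    case True
    then obtain S where S: "open S" "\<phi> (c t) \<in> S" "smooth_on S (\<lambda>x. f (\<iota> x))"
      using smooth_near_iff[OF p] by blast
    have "((\<lambda>x. f (\<iota> x)) has_derivative fder (\<lambda>x. f (\<iota> x)) (\<phi> (c t))) (at (\<phi> (c t)))"
      by (rule smooth_on_fder[OF S(3,1,2)])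
    then have "(((\<lambda>x. f (\<iota> x)) \<circ> (\<lambda>s. \<phi> (c s))) has_vector_derivative fder (\<lambda>x. f (\<iota> x)) (\<phi> (c t)) w)
        (at t within I)"
      using der by (rule vector_derivative_diff_chain_within[rotated, OF has_derivative_at_withinI])
    then have "((f \<circ> c) has_vector_derivative fder (\<lambda>x. f (\<iota> x)) (\<phi> (c t)) w) (at t within I)"
      by (rule has_vector_derivative_transform_within[OF _ d(1) t(1)])
        (use d in \<open>force simp: dist_commute\<close>)
    then show ?thesis using True t(2) by (simp add: velocity_def tvec_def vector_derivative_within)
  qed (simp add: velocity_def tvec_def)
qed

text \<open>The definition provides a smooth expression in some chart only. Continuity there keeps
  the curve in the overlap with \<open>U\<close> for a short time, and the transition map carries
  the expression over.\<close>

lemma smooth_curve_in_chart: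
  assumes c: "smooth_curve A I c" and t: "t \<in> I" "c t \<in> U"
  obtains d where "d > 0" "c ` (I \<inter> ball t d) \<subseteq> U" "smooth_on (I \<inter> ball t d) (\<lambda>s. \<phi> (c s))"
proof -
  obtain V \<psi> d where V: "(V, \<psi>) \<in> A" and d: "d > 0" "c ` (I \<inter> ball t d) \<subseteq> V"
    "smooth_on (I \<inter> ball t d) (\<psi> \<circ> c)"
    using c t(1) unfolding smooth_curve_def by blast
  interpret V: chart A V \<psi> using atlas V by unfold_locales auto
  have o: "open (\<psi> ` (V \<inter> U))" by (rule V.open_overlap[OF chart])
  have "continuous_on (I \<inter> ball t d) (\<psi> \<circ> c)" using d(3) by (rule smooth_on_imp_continuous_on)
  moreover have "t \<in> I \<inter> ball t d" using t d by auto
  moreover have "(\<psi> \<circ> c) t \<in> \<psi> ` (V \<inter> U)" using t d by (simp add: image_subset_iff)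
  ultimately obtain S where S: "open S" "t \<in> S" "\<forall>s\<in>I \<inter> ball t d \<inter> S. (\<psi> \<circ> c) s \<in> \<psi> ` (V \<inter> U)"
    using o unfolding continuous_on_topological by (metis Int_iff)
  obtain e where e: "e > 0" "ball t e \<subseteq> S" using S open_contains_ball by blast
  define d' where "d' = min d e"
  have cV: "c s \<in> V \<inter> U" if "s \<in> I \<inter> ball t d'" for s
  proof -
    have "s \<in> I \<inter> ball t d \<inter> S" using that e by (auto simp: d'_def)
    then have "c s \<in> V" "\<psi> (c s) \<in> \<psi> ` (V \<inter> U)" using d S by auto
    then show ?thesis using V.inj by (auto dest: inj_onD)
  qed
  have sm: "smooth_on (I \<inter> ball t d') (\<lambda>s. \<psi> (c s))"
    using smooth_on_subset[OF d(3), of "I \<inter> ball t d'"] unfolding d'_def o_def by fastforce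
  have "smooth_on (I \<inter> ball t d') (\<lambda>s. \<phi> (V.\<iota> (\<psi> (c s))))"
    by (rule smooth_on_compose[OF V.transition_smooth[OF chart] sm]) (use cV in auto)
  then have "smooth_on (I \<inter> ball t d') (\<lambda>s. \<phi> (c s))"
    by (rule smooth_on_cong) (use cV in auto)
  moreover have "d' > 0" using d e by (simp add: d'_def)
  ultimately show ?thesis using that[of d'] cV by blast
qed

lemma velocity_smooth_curve:
  assumes c: "smooth_curve A I c" and t: "t \<in> I" "c t \<in> U" "at t within I \<noteq> bot"
  obtains w where "((\<lambda>s. \<phi> (c s)) has_vector_derivative w) (at t within I)"
    "velocity A I c t = tvec A U \<phi> (c t) w"
proof -
  obtain d where d: "d > 0" "c ` (I \<inter> ball t d) \<subseteq> U" "smooth_on (I \<inter> ball t d) (\<lambda>s. \<phi> (c s))"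
    using smooth_curve_in_chart[OF c t(1,2)] .
  obtain D where "((\<lambda>s. \<phi> (c s)) has_derivative D) (at t within I \<inter> ball t d)"
    using smooth_on_has_derivative[OF d(3), of t] t d by auto
  then have D: "((\<lambda>s. \<phi> (c s)) has_derivative D) (at t within I)"
    using at_within_nhd[of t "ball t d" "I \<inter> ball t d" I] d(1) by auto
  then have "((\<lambda>s. \<phi> (c s)) has_vector_derivative D 1) (at t within I)"
    unfolding has_vector_derivative_def
    by (rule has_derivative_eq_rhs)
      (auto simp: fun_eq_iff simp flip: linear_cmul[OF has_derivative_linear[OF D]])
  then show ?thesis using that velocity_eq_tvec[OF t(1,3) d(1,2)] by blast
qed

text \<open>Every coordinate vector is the velocity of a straight line in the chart, restricted to
  times at which it stays in the open image. The converse is the chain rule.\<close>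

lemma tangent_space_eq:
  assumes p: "p \<in> U"
  shows "tangent_space A p = range (tvec A U \<phi> p)"
proof (intro equalityI subsetI)
  fix v assume "v \<in> tangent_space A p"
  then obtain \<epsilon> \<alpha> where a: "v = velocity A {-\<epsilon><..<\<epsilon>} \<alpha> 0" "\<epsilon> > 0" "smooth_curve A {-\<epsilon><..<\<epsilon>} \<alpha>" "\<alpha> 0 = p"
    unfolding tangent_space_def by blast
  have "at 0 within {-\<epsilon><..<\<epsilon>} = at 0"
    by (rule at_within_open) (use a(2) in auto)
  then have "at 0 within {-\<epsilon><..<\<epsilon>} \<noteq> bot" by simp
  then show "v \<in> range (tvec A U \<phi> p)"
    using velocity_smooth_curve[OF a(3), of 0] a p by (metis greaterThanLessThan_iff neg_less_0_iff_less rangeI)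
next
  fix v assume "v \<in> range (tvec A U \<phi> p)"
  then obtain w where v: "v = tvec A U \<phi> p w" by blast
  define x where "x s = \<phi> p + s *\<^sub>R w" for s :: real
  have "open (x -` (\<phi> ` U))"
    unfolding x_def by (intro open_vimage open_image continuous_intros)
  moreover have "0 \<in> x -` (\<phi> ` U)" using p by (simp add: x_def)
  ultimately obtain \<epsilon> where e: "\<epsilon> > 0" "ball 0 \<epsilon> \<subseteq> x -` (\<phi> ` U)" using open_contains_ball by blast
  define I where "I = {-\<epsilon><..<\<epsilon>}"
  have I: "x s \<in> \<phi> ` U" if "s \<in> I" for s
  proof -
    have "s \<in> ball 0 \<epsilon>" using that by (auto simp: I_def dist_real_def)
    then show ?thesis using e(2) by blast
  qed
  have I0: "0 \<in> I" "open I" using e by (auto simp: I_def)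
  have nb: "at 0 within I \<noteq> bot" using at_within_open[OF I0] by simp
  have x: "smooth_on I x" unfolding x_def by (intro smooth_intros)
  have sm: "smooth_on (I \<inter> ball t 1) (\<phi> \<circ> (\<lambda>s. \<iota> (x s)))" for t
    by (rule smooth_on_cong[OF smooth_on_subset[OF x]]) (auto simp: I)
  have curve: "smooth_curve A I (\<lambda>s. \<iota> (x s))"
    unfolding smooth_curve_def
  proof
    fix t assume "t \<in> I"
    show "\<exists>(U, \<phi>)\<in>A. \<exists>d>0. (\<lambda>s. \<iota> (x s)) ` (I \<inter> ball t d) \<subseteq> U \<and> smooth_on (I \<inter> ball t d) (\<phi> \<circ> (\<lambda>s. \<iota> (x s)))"
      by (rule bexI[OF _ chart]) (use sm[of t] I in \<open>auto intro!: exI[of _ 1]\<close>)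
  qed
  have "velocity A I (\<lambda>s. \<iota> (x s)) 0 = tvec A U \<phi> (\<iota> (x 0)) w"
  proof (rule velocity_eq_tvec[OF I0(1), of 1])
    have "(x has_vector_derivative w) (at 0 within I)"
      unfolding x_def by (auto intro!: derivative_eq_intros)
    then show "((\<lambda>s. \<phi> (\<iota> (x s))) has_vector_derivative w) (at 0 within I)"
      by (rule has_vector_derivative_transform_within[OF _ zero_less_one I0(1)]) (simp add: I)
  qed (use I nb in auto)
  moreover have "\<iota> (x 0) = p" using p by (simp add: x_def)
  ultimately show "v \<in> tangent_space A p"
    using curve e unfolding tangent_space_def I_def v by (auto intro!: exI[of _ \<epsilon>] exI[of _ "\<lambda>s. \<iota> (x s)"])
qed

lemma tvec_in [simp]: "p \<in> U \<Longrightarrow> tvec A U \<phi> p w \<in> tangent_space A p"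
  by (simp add: tangent_space_eq)

lemma tvec_comps [simp]: "p \<in> U \<Longrightarrow> v \<in> tangent_space A p \<Longrightarrow> tvec A U \<phi> p (comps \<phi> v) = v"
  by (auto simp: tangent_space_eq)

lemma tangent_eqI:
  "p \<in> U \<Longrightarrow> v \<in> tangent_space A p \<Longrightarrow> w \<in> tangent_space A p \<Longrightarrow> comps \<phi> v = comps \<phi> w \<Longrightarrow> v = w"
  by (metis tvec_comps)

lemma comps_eq_zero_iff: "p \<in> U \<Longrightarrow> v \<in> tangent_space A p \<Longrightarrow> comps \<phi> v = 0 \<longleftrightarrow> v = 0"
  by (metis comps_zero tvec_comps tvec_zero)

lemma comps_change:
  assumes p: "p \<in> U" "p \<in> V" and V: "(V, \<psi>) \<in> A"
  shows "comps \<psi> (tvec A U \<phi> p w) = fder (\<lambda>x. \<psi> (\<iota> x)) (\<phi> p) w"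
proof (rule euclidean_eqI)
  fix b :: 'e assume b: "b \<in> Basis"
  have S: "open (\<phi> ` (U \<inter> V))" "\<phi> p \<in> \<phi> ` (U \<inter> V)" using open_overlap V p by auto
  note sm = transition_smooth[OF V]
  have "comps \<psi> (tvec A U \<phi> p w) \<bullet> b = fder (\<lambda>x. \<psi> (\<iota> x) \<bullet> b) (\<phi> p) w"
    unfolding comps_inner[OF b]
    by (rule tvec_apply[OF p(1) S]) (auto intro: smooth_on_inner sm smooth_on_const)
  also have "\<dots> = fder (\<lambda>x. \<psi> (\<iota> x)) (\<phi> p) w \<bullet> b"
    by (rule fder_inner_right[OF sm S])
  finally show "comps \<psi> (tvec A U \<phi> p w) \<bullet> b = fder (\<lambda>x. \<psi> (\<iota> x)) (\<phi> p) w \<bullet> b" .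
qed

end

lemma obtain_chart:
  assumes "smooth_atlas A" "p \<in> points A"
  obtains U \<phi> where "chart A U \<phi>" "p \<in> U"
proof -
  obtain U \<phi> where "(U, \<phi>) \<in> A" "p \<in> U" using assms(2) by (auto simp: points_def)
  then show ?thesis using that assms(1) by (auto simp: chart_def)
qed

lemma
  assumes "smooth_atlas A" "p \<in> points A"
  shows tangent_space_zero: "0 \<in> tangent_space A p"
    and tangent_space_add: "v \<in> tangent_space A p \<Longrightarrow> w \<in> tangent_space A p \<Longrightarrow> v + w \<in> tangent_space A p"
    and tangent_space_scale: "v \<in> tangent_space A p \<Longrightarrow> r \<cdot> v \<in> tangent_space A p"
    and tangent_space_diff: "v \<in> tangent_space A p \<Longrightarrow> w \<in> tangent_space A p \<Longrightarrow> v - w \<in> tangent_space A p"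
proof -
  obtain U \<phi> where "chart A U \<phi>" and p: "p \<in> U" using obtain_chart[OF assms] .
  then interpret chart A U \<phi> by simp
  show "0 \<in> tangent_space A p" using p tvec_in[of p 0] by (simp add: tvec_zero)
  show add: "v + w \<in> tangent_space A p" if "v \<in> tangent_space A p" "w \<in> tangent_space A p" for v w
    using that p by (auto simp: tangent_space_eq simp flip: tvec_add)
  show sc: "r \<cdot> v \<in> tangent_space A p" if "v \<in> tangent_space A p" for r v
    using that p by (auto simp: tangent_space_eq simp flip: tvec_scaleR)
  show "v - w \<in> tangent_space A p" if "v \<in> tangent_space A p" "w \<in> tangent_space A p" for v w
  proof -
    have "v + (-1) \<cdot> w = v - w" by (auto simp: tscale_def)
    then show ?thesis using add[OF that(1) sc[OF that(2), of "-1"]] by simp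
  qed
qed

lemma smooth_near_cong:
  assumes "smooth_atlas A" "mfd_open A W" "p \<in> W" "\<And>q. q \<in> W \<Longrightarrow> f q = g q" "smooth_near A p f"
  shows "smooth_near A p g"
proof -
  have "p \<in> points A" using assms(2,3) by (auto simp: mfd_open_def)
  then obtain U \<phi> where "chart A U \<phi>" and p: "p \<in> U" using obtain_chart[OF assms(1)] by blast
  then interpret chart A U \<phi> by simp
  obtain S where S: "open S" "\<phi> p \<in> S" "S \<subseteq> \<phi> ` U" "smooth_on S (\<lambda>x. f (\<iota> x))"
    using assms(5) smooth_near_iff[OF p] by blast
  have "smooth_on (S \<inter> \<phi> ` (U \<inter> W)) (\<lambda>x. g (\<iota> x))"
    by (rule smooth_on_cong[OF smooth_on_subset[OF S(4)]]) (use assms(4) in auto)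
  then show ?thesis using S p assms(3) mfd_openD[OF assms(2) chart]
    by (subst smooth_near_iff[OF p]) (auto intro!: exI[of _ "S \<inter> \<phi> ` (U \<inter> W)"])
qed

text \<open>A tangent vector sees only the germ of a function. This permits rewriting under a
  derivative with identities that hold over the slit bundle only.\<close>

lemma tangent_apply_cong:
  assumes "smooth_atlas A" "mfd_open A W" "p \<in> W" "\<And>q. q \<in> W \<Longrightarrow> f q = g q"
    and v: "v \<in> tangent_space A p"
  shows "v f = v g"
proof -
  have "p \<in> points A" using assms(2,3) by (auto simp: mfd_open_def)
  then obtain U \<phi> where "chart A U \<phi>" and p: "p \<in> U" using obtain_chart[OF assms(1)] by blast
  then interpret chart A U \<phi> by simp
  have iff: "smooth_near A p f \<longleftrightarrow> smooth_near A p g"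
    using smooth_near_cong[OF assms(1-3)] assms(4) by metis
  have "fder (\<lambda>x. f (\<iota> x)) (\<phi> p) = fder (\<lambda>x. g (\<iota> x)) (\<phi> p)"
    by (rule fder_cong[of "\<phi> ` (U \<inter> W)"]) (use assms mfd_openD[OF assms(2) chart] p in auto)
  then have "tvec A U \<phi> p w f = tvec A U \<phi> p w g" for w
    by (simp add: tvec_def iff)
  then show ?thesis using v p by (auto simp: tangent_space_eq)
qed

text \<open>Smooth maps come with charts of unknown choice around each point; composing with
  transition maps on both sides gives smoothness in prescribed charts, locally and hence on all of
  \<open>W\<close>.\<close>

lemma smooth_mapD:
  assumes F: "smooth_map A B F" and A: "chart A U \<phi>" and B: "chart B V \<psi>"
    and W: "mfd_open A W" "W \<subseteq> U" "F ` W \<subseteq> V"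
  shows "smooth_on (\<phi> ` W) (\<lambda>x. \<psi> (F (inv_into U \<phi> x)))"
proof (rule smooth_on_open_local)
  interpret A: chart A U \<phi> by (rule A)
  interpret B: chart B V \<psi> by (rule B)
  show "open (\<phi> ` W)" by (rule A.open_image_mfd_open[OF W(1,2)])
  fix x assume "x \<in> \<phi> ` W"
  then obtain p where p: "p \<in> W" "x = \<phi> p" by blast
  then have "p \<in> points A" using A.U_subset_points W by blast
  then obtain U1 \<phi>1 V1 \<psi>1 W1 where 1: "(U1, \<phi>1) \<in> A" "(V1, \<psi>1) \<in> B" "mfd_open A W1" "p \<in> W1" "W1 \<subseteq> U1"
    "F ` W1 \<subseteq> V1" "smooth_on (\<phi>1 ` W1) (\<psi>1 \<circ> F \<circ> inv_into U1 \<phi>1)"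
    using F unfolding smooth_map_def by blast
  interpret A1: chart A U1 \<phi>1 using A.atlas 1 by unfold_locales auto
  interpret B1: chart B V1 \<psi>1 using B.atlas 1 by unfold_locales auto
  define W2 where "W2 = W \<inter> W1"
  have W2: "mfd_open A W2" unfolding W2_def by (rule mfd_open_Int[OF A.atlas W(1) 1(3)])
  have "smooth_on (\<phi> ` W2) (\<lambda>x. \<psi> (B1.\<iota> ((\<psi>1 \<circ> F \<circ> A1.\<iota>) (\<phi>1 (A.\<iota> x)))))"
  proof (rule smooth_on_compose[OF B1.transition_smooth[OF B.chart]])
    show "smooth_on (\<phi> ` W2) (\<lambda>x. (\<psi>1 \<circ> F \<circ> A1.\<iota>) (\<phi>1 (A.\<iota> x)))"
    proof (rule smooth_on_compose[OF 1(7)])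
      show "smooth_on (\<phi> ` W2) (\<lambda>x. \<phi>1 (A.\<iota> x))"
        by (rule smooth_on_subset[OF A.transition_smooth[OF 1(1)]]) (use W 1 in \<open>auto simp: W2_def\<close>)
    qed (use W 1 in \<open>auto simp: W2_def subset_iff\<close>)
  qed (use W 1 in \<open>auto simp: W2_def subset_iff image_subset_iff\<close>)
  then have "smooth_on (\<phi> ` W2) (\<lambda>x. \<psi> (F (A.\<iota> x)))"
    by (rule smooth_on_cong) (use W 1 in \<open>auto simp: W2_def subset_iff image_subset_iff\<close>)
  moreover have "open (\<phi> ` W2)" by (rule A.open_image_mfd_open[OF W2]) (use W in \<open>auto simp: W2_def\<close>)
  ultimately show "\<exists>T. open T \<and> x \<in> T \<and> T \<subseteq> \<phi> ` W \<and> smooth_on T (\<lambda>x. \<psi> (F (A.\<iota> x)))"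
    using p 1(4) by (intro exI[of _ "\<phi> ` W2"] conjI) (auto simp: W2_def)
qed

section \<open>The tangent bundle and the slit tangent bundle\<close>

lemma points_image_chart: "points ((\<lambda>(U, \<phi>). (F U, G \<phi>)) ` A) = (\<Union>(U, \<phi>)\<in>A. F U)"
  by (auto simp: points_def)

lemma smooth_atlasI:
  assumes "\<And>U \<phi>. (U, \<phi>) \<in> A \<Longrightarrow> inj_on \<phi> U \<and> open (\<phi> ` U)"
    and "\<And>U \<phi> V \<psi>. (U, \<phi>) \<in> A \<Longrightarrow> (V, \<psi>) \<in> A \<Longrightarrow>
      open (\<phi> ` (U \<inter> V)) \<and> smooth_on (\<phi> ` (U \<inter> V)) (\<psi> \<circ> inv_into U \<phi>)"
  shows "smooth_atlas A"
  using assms unfolding smooth_atlas_def by blast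

definition bundle_atlas ::
  "('a, 'e::euclidean_space) chart set \<Rightarrow> ('a \<times> 'a tvec) set \<Rightarrow> ('a \<times> 'a tvec, 'e \<times> 'e) chart set" where
  "bundle_atlas A D = (\<lambda>(U, \<phi>). ({u\<in>D. fst u \<in> U}, tangent_coords \<phi>)) ` A"

lemma bundle_atlasE:
  assumes "(V, \<psi>) \<in> bundle_atlas A D"
  obtains U \<phi> where "(U, \<phi>) \<in> A" "V = {u\<in>D. fst u \<in> U}" "\<psi> = tangent_coords \<phi>"
  using assms by (auto simp: bundle_atlas_def)

lemma tangent_atlas_eq: "tangent_atlas A = bundle_atlas A (tangent_bundle A)"
  by (simp add: tangent_atlas_def bundle_atlas_def)

lemma slit_atlas_eq: "slit_atlas A = bundle_atlas A (slit_bundle A)"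
  by (simp add: slit_atlas_def bundle_atlas_def)

text \<open>
  The tangent bundle and the slit tangent bundle are treated together: in every chart, the part
  \<open>D\<close> of the tangent bundle is given by the condition that the components lie in the open set \<open>Y\<close>.
\<close>

locale bundle_part =
  fixes A :: "('a, 'e::euclidean_space) chart set" and D :: "('a \<times> 'a tvec) set" and Y :: "'e set"
  assumes atlas: "smooth_atlas A" and D: "D \<subseteq> tangent_bundle A" and Y: "open Y"
    and D_iff: "\<And>U \<phi> p w. (U, \<phi>) \<in> A \<Longrightarrow> p \<in> U \<Longrightarrow> (p, tvec A U \<phi> p w) \<in> D \<longleftrightarrow> w \<in> Y"
begin

lemma in_D:
  assumes "chart A U \<phi>" "u \<in> D" "fst u \<in> U"
  shows "snd u = tvec A U \<phi> (fst u) (comps \<phi> (snd u))" "comps \<phi> (snd u) \<in> Y"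
proof -
  interpret chart A U \<phi> by fact
  show *: "snd u = tvec A U \<phi> (fst u) (comps \<phi> (snd u))"
    using assms D by (auto simp: tangent_bundle_def)
  show "comps \<phi> (snd u) \<in> Y"
    using D_iff[OF chart assms(3)] assms(2) * by (metis prod.collapse)
qed

lemma image:
  assumes "chart A U \<phi>" "W \<subseteq> U"
  shows "tangent_coords \<phi> ` {u\<in>D. fst u \<in> W} = \<phi> ` W \<times> Y"
proof (intro equalityI subsetI)
  fix z assume "z \<in> tangent_coords \<phi> ` {u\<in>D. fst u \<in> W}"
  then show "z \<in> \<phi> ` W \<times> Y" using in_D[OF assms(1)] assms(2) by (auto simp: tangent_coords_eq)
next
  interpret chart A U \<phi> by fact
  fix z assume "z \<in> \<phi> ` W \<times> Y"
  then obtain p y where z: "z = (\<phi> p, y)" "p \<in> W" "y \<in> Y" by auto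
  then have "z = tangent_coords \<phi> (p, tvec A U \<phi> p y)" "(p, tvec A U \<phi> p y) \<in> D"
    using D_iff[OF chart] assms(2) by (auto simp: tangent_coords_eq)
  then show "z \<in> tangent_coords \<phi> ` {u\<in>D. fst u \<in> W}" using z by auto
qed

lemma inj_coords: "chart A U \<phi> \<Longrightarrow> inj_on (tangent_coords \<phi>) {u\<in>D. fst u \<in> U}"
proof (rule inj_onI)
  assume c: "chart A U \<phi>"
  interpret chart A U \<phi> by fact
  fix u v assume u: "u \<in> {u\<in>D. fst u \<in> U}" "v \<in> {u\<in>D. fst u \<in> U}" "tangent_coords \<phi> u = tangent_coords \<phi> v"
  then have "fst u = fst v" "comps \<phi> (snd u) = comps \<phi> (snd v)"
    using inj by (auto simp: tangent_coords_eq dest: inj_onD)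
  then show "u = v" using in_D(1)[OF c, of u] in_D(1)[OF c, of v] u by (auto simp: prod_eq_iff)
qed

lemma inv_coords:
  assumes c: "chart A U \<phi>" and z: "x \<in> \<phi> ` U" "y \<in> Y"
  shows "inv_into {u\<in>D. fst u \<in> U} (tangent_coords \<phi>) (x, y)
    = (inv_into U \<phi> x, tvec A U \<phi> (inv_into U \<phi> x) y)"
proof -
  interpret chart A U \<phi> by fact
  have "(\<iota> x, tvec A U \<phi> (\<iota> x) y) \<in> {u\<in>D. fst u \<in> U}"
    using D_iff[OF chart] z by auto
  moreover have "tangent_coords \<phi> (\<iota> x, tvec A U \<phi> (\<iota> x) y) = (x, y)"
    using z by (simp add: tangent_coords_eq)
  ultimately show ?thesis by (rule inv_into_f_eq[OF inj_coords[OF c]])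
qed

lemma points_bundle: "points (bundle_atlas A D) = D"
  unfolding bundle_atlas_def points_image_chart
  using D by (fastforce simp: tangent_bundle_def points_def)

text \<open>The induced transition maps send (x, y) to the pair of \<open>\<tau> x\<close> and the
  derivative of \<open>\<tau>\<close> at x applied to y. They are smooth because the second part is
  linear in y with smooth coefficients.\<close>

lemma smooth_bundle_atlas: "smooth_atlas (bundle_atlas A D)"
proof -
  have c: "chart A U \<phi>" if "(U, \<phi>) \<in> A" for U \<phi> using that atlas by unfold_locales
  have 1: "inj_on (tangent_coords \<phi>) {u\<in>D. fst u \<in> U}" "open (tangent_coords \<phi> ` {u\<in>D. fst u \<in> U})"
    if "(U, \<phi>) \<in> A" for U \<phi>
    using inj_coords[OF c[OF that]] image[OF c[OF that] subset_refl]
      chart.open_image[OF c[OF that]] Y by (auto intro: open_Times)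
  have 2: "open (tangent_coords \<phi> ` ({u\<in>D. fst u \<in> U} \<inter> {u\<in>D. fst u \<in> V})) \<and>
    smooth_on (tangent_coords \<phi> ` ({u\<in>D. fst u \<in> U} \<inter> {u\<in>D. fst u \<in> V}))
      (tangent_coords \<psi> \<circ> inv_into {u\<in>D. fst u \<in> U} (tangent_coords \<phi>))"
    if A: "(U, \<phi>) \<in> A" "(V, \<psi>) \<in> A" for U \<phi> V \<psi>
  proof -
    interpret U: chart A U \<phi> by (rule c[OF A(1)])
    define \<tau> where "\<tau> = (\<lambda>x. \<psi> (U.\<iota> x))"
    have eq: "{u\<in>D. fst u \<in> U} \<inter> {u\<in>D. fst u \<in> V} = {u\<in>D. fst u \<in> U \<inter> V}" by blast
    have im: "tangent_coords \<phi> ` {u\<in>D. fst u \<in> U \<inter> V} = \<phi> ` (U \<inter> V) \<times> Y"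
      by (rule image[OF c[OF A(1)]]) blast
    have \<tau>: "smooth_on (\<phi> ` (U \<inter> V)) \<tau>" unfolding \<tau>_def by (rule U.transition_smooth[OF A(2)])
    have o: "open (\<phi> ` (U \<inter> V))" by (rule U.open_overlap[OF A(2)])
    have "smooth_on (\<phi> ` (U \<inter> V) \<times> Y) (\<lambda>z. fder \<tau> (fst z) (snd z))"
    proof (rule smooth_on_family[OF _ _ smooth_on_snd])
      fix z assume "z \<in> \<phi> ` (U \<inter> V) \<times> Y"
      then show "linear (fder \<tau> (fst z))" by (intro linear_fder[OF \<tau> o]) auto
    next
      fix b :: 'e
      show "smooth_on (\<phi> ` (U \<inter> V) \<times> Y) (\<lambda>z. fder \<tau> (fst z) b)"
        by (rule smooth_on_compose[OF smooth_on_fder_const[OF \<tau> o] smooth_on_fst]) auto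
    qed
    moreover have "smooth_on (\<phi> ` (U \<inter> V) \<times> Y) (\<lambda>z. \<tau> (fst z))"
      by (rule smooth_on_compose[OF \<tau> smooth_on_fst]) auto
    ultimately have "smooth_on (\<phi> ` (U \<inter> V) \<times> Y) (\<lambda>z. (\<tau> (fst z), fder \<tau> (fst z) (snd z)))"
      by (intro smooth_on_Pair)
    then have "smooth_on (\<phi> ` (U \<inter> V) \<times> Y)
      (tangent_coords \<psi> \<circ> inv_into {u\<in>D. fst u \<in> U} (tangent_coords \<phi>))"
    proof (rule smooth_on_cong)
      fix z assume z: "z \<in> \<phi> ` (U \<inter> V) \<times> Y"
      then obtain p y where p: "z = (\<phi> p, y)" "p \<in> U" "p \<in> V" "y \<in> Y" by auto
      show "(\<tau> (fst z), fder \<tau> (fst z) (snd z))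
          = (tangent_coords \<psi> \<circ> inv_into {u\<in>D. fst u \<in> U} (tangent_coords \<phi>)) z"
        using p U.comps_change[OF p(2,3) A(2)] inv_coords[OF c[OF A(1)], of "\<phi> p" y]
        by (simp add: \<tau>_def tangent_coords_eq)
    qed
    then show ?thesis unfolding eq im using o Y by (auto intro: open_Times)
  qed
  show ?thesis
  proof (rule smooth_atlasI)
    fix U \<phi> assume "(U, \<phi>) \<in> bundle_atlas A D"
    then obtain U' \<phi>' where "(U', \<phi>') \<in> A" "U = {u\<in>D. fst u \<in> U'}" "\<phi> = tangent_coords \<phi>'"
      by (rule bundle_atlasE)
    then show "inj_on \<phi> U \<and> open (\<phi> ` U)" using 1 by simp
  next
    fix U \<phi> V \<psi> assume "(U, \<phi>) \<in> bundle_atlas A D" "(V, \<psi>) \<in> bundle_atlas A D"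
    then obtain U' \<phi>' V' \<psi>' where "(U', \<phi>') \<in> A" "(V', \<psi>') \<in> A"
      "U = {u\<in>D. fst u \<in> U'}" "\<phi> = tangent_coords \<phi>'" "V = {u\<in>D. fst u \<in> V'}" "\<psi> = tangent_coords \<psi>'"
      by (elim bundle_atlasE) blast
    then show "open (\<phi> ` (U \<inter> V)) \<and> smooth_on (\<phi> ` (U \<inter> V)) (\<psi> \<circ> inv_into U \<phi>)"
      using 2 by simp
  qed
qed

lemma bundle_chart:
  assumes "chart A U \<phi>"
  shows "chart (bundle_atlas A D) {u\<in>D. fst u \<in> U} (tangent_coords \<phi>)"
proof -
  interpret chart A U \<phi> by fact
  show ?thesis using smooth_bundle_atlas chart by unfold_locales (auto simp: bundle_atlas_def)
qed

lemma mfd_open_bundle: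
  assumes "mfd_open A W"
  shows "mfd_open (bundle_atlas A D) {u\<in>D. fst u \<in> W}"
  unfolding mfd_open_def
proof (intro conjI ballI, goal_cases)
  case 1
  then show ?case using points_bundle by auto
next
  case (2 x)
  then obtain U \<phi> where U: "(U, \<phi>) \<in> A" "x = ({u\<in>D. fst u \<in> U}, tangent_coords \<phi>)"
    by (auto simp: bundle_atlas_def)
  then have c: "chart A U \<phi>" using atlas by unfold_locales
  have "{u\<in>D. fst u \<in> U} \<inter> {u\<in>D. fst u \<in> W} = {u\<in>D. fst u \<in> U \<inter> W}" by blast
  then show ?case
    using image[OF c, of "U \<inter> W"] mfd_openD[OF assms U(1)] Y by (simp add: U(2) open_Times)
qed

end

lemma bundle_part_tangent: "smooth_atlas A \<Longrightarrow> bundle_part A (tangent_bundle A) UNIV"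
proof unfold_locales
  fix U \<phi> p w assume a: "smooth_atlas A" "(U, \<phi>) \<in> A" "p \<in> U"
  then interpret chart A U \<phi> by unfold_locales
  show "(p, tvec A U \<phi> p w) \<in> tangent_bundle A \<longleftrightarrow> w \<in> UNIV"
    using a U_subset_points by (auto simp: tangent_bundle_def)
qed auto

lemma bundle_part_slit: "smooth_atlas A \<Longrightarrow> bundle_part A (slit_bundle A) (- {0})"
proof unfold_locales
  fix U \<phi> p w assume a: "smooth_atlas A" "(U, \<phi>) \<in> A" "p \<in> U"
  then interpret chart A U \<phi> by unfold_locales
  have "tvec A U \<phi> p w = 0 \<longleftrightarrow> w = 0"
    using comps_eq_zero_iff[OF a(3) tvec_in[OF a(3)], of w] a(3) by simp
  then show "(p, tvec A U \<phi> p w) \<in> slit_bundle A \<longleftrightarrow> w \<in> - {0}"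
    using a U_subset_points by (auto simp: tangent_bundle_def slit_bundle_def)
qed (auto simp: slit_bundle_def)

lemma smooth_slit_atlas: "smooth_atlas A \<Longrightarrow> smooth_atlas (slit_atlas A)"
  by (simp add: slit_atlas_eq bundle_part.smooth_bundle_atlas[OF bundle_part_slit])

lemma points_slit_atlas [simp]: "smooth_atlas A \<Longrightarrow> points (slit_atlas A) = slit_bundle A"
  by (simp add: slit_atlas_eq bundle_part.points_bundle[OF bundle_part_slit])

lemma tangent_chart:
  "chart A U \<phi> \<Longrightarrow> chart (tangent_atlas A) {u\<in>tangent_bundle A. fst u \<in> U} (tangent_coords \<phi>)"
  unfolding tangent_atlas_eq by (rule bundle_part.bundle_chart[OF bundle_part_tangent[OF chart.atlas]])

lemma slit_bundleD:
  "u \<in> slit_bundle A \<Longrightarrow> fst u \<in> points A" "u \<in> slit_bundle A \<Longrightarrow> snd u \<in> tangent_space A (fst u)"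
  "u \<in> slit_bundle A \<Longrightarrow> snd u \<noteq> 0"
  by (auto simp: slit_bundle_def tangent_bundle_def)

text \<open>Used with \<open>q\<close> the identity for vector fields and with
  \<open>q = fst\<close> for sections of the pullback bundle.\<close>

lemma smooth_map_bundleI:
  assumes C: "smooth_atlas C"
    and loc: "\<And>u. u \<in> points B \<Longrightarrow> \<exists>U \<phi> V \<psi> W. chart B U \<phi> \<and> chart C V \<psi> \<and> mfd_open B W \<and> u \<in> W \<and>
      W \<subseteq> U \<and> q ` W \<subseteq> V \<and> (\<forall>w\<in>W. Y w \<in> tangent_space C (q w)) \<and>
      smooth_on (\<phi> ` W) (\<lambda>x. \<psi> (q (inv_into U \<phi> x))) \<and>
      smooth_on (\<phi> ` W) (\<lambda>x. comps \<psi> (Y (inv_into U \<phi> x)))"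
  shows "smooth_map B (tangent_atlas C) (\<lambda>u. (q u, Y u))"
  unfolding smooth_map_def
proof
  fix u assume "u \<in> points B"
  then obtain U \<phi> V \<psi> W where *: "chart B U \<phi>" "chart C V \<psi>" "mfd_open B W" "u \<in> W"
      "W \<subseteq> U" "q ` W \<subseteq> V" "\<forall>w\<in>W. Y w \<in> tangent_space C (q w)"
      "smooth_on (\<phi> ` W) (\<lambda>x. \<psi> (q (inv_into U \<phi> x)))"
      "smooth_on (\<phi> ` W) (\<lambda>x. comps \<psi> (Y (inv_into U \<phi> x)))" using loc by meson
  interpret B: chart B U \<phi> by fact
  interpret C: chart C V \<psi> by fact
  interpret T: chart "tangent_atlas C" "{u\<in>tangent_bundle C. fst u \<in> V}" "tangent_coords \<psi>"
    by (rule tangent_chart) fact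
  have "(\<lambda>u. (q u, Y u)) ` W \<subseteq> {u\<in>tangent_bundle C. fst u \<in> V}"
    using * C.U_subset_points by (auto simp: tangent_bundle_def)
  moreover have "smooth_on (\<phi> ` W) (tangent_coords \<psi> \<circ> (\<lambda>u. (q u, Y u)) \<circ> B.\<iota>)"
    using smooth_on_Pair[OF *(8,9)] by (simp add: o_def tangent_coords_eq)
  ultimately show "\<exists>(U, \<phi>)\<in>B. \<exists>(V, \<psi>)\<in>tangent_atlas C. \<exists>W. mfd_open B W \<and> u \<in> W \<and> W \<subseteq> U \<and>
      (\<lambda>u. (q u, Y u)) ` W \<subseteq> V \<and> smooth_on (\<phi> ` W) (\<psi> \<circ> (\<lambda>u. (q u, Y u)) \<circ> inv_into U \<phi>)"
    by (intro bexI[OF _ B.chart] case_prodI bexI[OF _ T.chart] exI[of _ W] conjI *)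
qed

text \<open>The open set \<open>Z\<close> is the complement of a closed set inside \<open>U\<close> that contains the support.\<close>

lemma smooth_map_extend_zero:
  assumes C: "smooth_atlas C" and U: "chart B U \<phi>" and V: "chart C V \<psi>" and q: "q ` U \<subseteq> V"
    "smooth_on (\<phi> ` U) (\<lambda>x. \<psi> (q (inv_into U \<phi> x)))" and h: "smooth_on (\<phi> ` U) h"
    and Z: "mfd_open B Z" "points B \<subseteq> U \<union> Z" "\<And>u. u \<in> U \<inter> Z \<Longrightarrow> h (\<phi> u) = 0"
    and q': "\<And>u. u \<in> points B \<Longrightarrow> \<exists>U1 \<phi>1 V1 \<psi>1. chart B U1 \<phi>1 \<and> chart C V1 \<psi>1 \<and> u \<in> U1 \<and> q ` U1 \<subseteq> V1 \<and>
      smooth_on (\<phi>1 ` U1) (\<lambda>x. \<psi>1 (q (inv_into U1 \<phi>1 x)))"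
  shows "smooth_map B (tangent_atlas C) (\<lambda>u. (q u, if u \<in> U then tvec C V \<psi> (q u) (h (\<phi> u)) else 0))"
proof (rule smooth_map_bundleI[OF C])
  interpret B: chart B U \<phi> by fact
  interpret C: chart C V \<psi> by fact
  define Y where "Y u = (if u \<in> U then tvec C V \<psi> (q u) (h (\<phi> u)) else 0)" for u
  fix u assume u: "u \<in> points B"
  consider "u \<in> U" | "u \<notin> U" "u \<in> Z" using Z(2) u by blast
  then show "\<exists>U' \<phi>' V' \<psi>' W. chart B U' \<phi>' \<and> chart C V' \<psi>' \<and> mfd_open B W \<and> u \<in> W \<and>
      W \<subseteq> U' \<and> q ` W \<subseteq> V' \<and>
      (\<forall>w\<in>W. (if w \<in> U then tvec C V \<psi> (q w) (h (\<phi> w)) else 0) \<in> tangent_space C (q w)) \<and>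
      smooth_on (\<phi>' ` W) (\<lambda>x. \<psi>' (q (inv_into U' \<phi>' x))) \<and>
      smooth_on (\<phi>' ` W) (\<lambda>x. comps \<psi>' (if inv_into U' \<phi>' x \<in> U
        then tvec C V \<psi> (q (inv_into U' \<phi>' x)) (h (\<phi> (inv_into U' \<phi>' x))) else 0))"
    unfolding Y_def[symmetric]
  proof cases
    case 1
    have "smooth_on (\<phi> ` U) (\<lambda>x. comps \<psi> (Y (B.\<iota> x)))"
      by (rule smooth_on_cong[OF h]) (use q(1) in \<open>auto simp: Y_def image_subset_iff\<close>)
    moreover have "\<forall>w\<in>U. Y w \<in> tangent_space C (q w)" using q(1) by (auto simp: Y_def image_subset_iff)
    ultimately show "\<exists>U' \<phi>' V' \<psi>' W. chart B U' \<phi>' \<and> chart C V' \<psi>' \<and> mfd_open B W \<and> u \<in> W \<and>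
      W \<subseteq> U' \<and> q ` W \<subseteq> V' \<and> (\<forall>w\<in>W. Y w \<in> tangent_space C (q w)) \<and>
      smooth_on (\<phi>' ` W) (\<lambda>x. \<psi>' (q (inv_into U' \<phi>' x))) \<and>
      smooth_on (\<phi>' ` W) (\<lambda>x. comps \<psi>' (Y (inv_into U' \<phi>' x)))"
      by (intro exI[of _ U] exI[of _ \<phi>] exI[of _ V] exI[of _ \<psi>] conjI U V B.mfd_open_U 1 q subset_refl)
  next
    case 2
    obtain U1 \<phi>1 V1 \<psi>1 where 1: "chart B U1 \<phi>1" "chart C V1 \<psi>1" "u \<in> U1" "q ` U1 \<subseteq> V1"
      "smooth_on (\<phi>1 ` U1) (\<lambda>x. \<psi>1 (q (inv_into U1 \<phi>1 x)))" using q'[OF u] by meson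
    interpret B1: chart B U1 \<phi>1 by fact
    interpret C1: chart C V1 \<psi>1 by fact
    have Y0: "Y w = 0" if "w \<in> Z" for w
      using that Z(3) q(1) C.tvec_zero by (auto simp: Y_def)
    have W: "mfd_open B (U1 \<inter> Z)" by (intro mfd_open_Int B.atlas B1.mfd_open_U Z)
    have c: "smooth_on (\<phi>1 ` (U1 \<inter> Z)) (\<lambda>x. comps \<psi>1 (Y (B1.\<iota> x)))"
      by (rule smooth_on_cong[OF smooth_on_const[of _ 0]]) (auto simp: Y0)
    have s: "smooth_on (\<phi>1 ` (U1 \<inter> Z)) (\<lambda>x. \<psi>1 (q (B1.\<iota> x)))"
      by (rule smooth_on_subset[OF 1(5)]) blast
    have t: "\<forall>w\<in>U1 \<inter> Z. Y w \<in> tangent_space C (q w)"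
      using 1(4) C1.U_subset_points by (auto simp: Y0 intro!: tangent_space_zero C)
    have m: "u \<in> U1 \<inter> Z" "U1 \<inter> Z \<subseteq> U1" "q ` (U1 \<inter> Z) \<subseteq> V1" using 1(3,4) 2(2) by blast+
    show "\<exists>U' \<phi>' V' \<psi>' W. chart B U' \<phi>' \<and> chart C V' \<psi>' \<and> mfd_open B W \<and> u \<in> W \<and>
      W \<subseteq> U' \<and> q ` W \<subseteq> V' \<and> (\<forall>w\<in>W. Y w \<in> tangent_space C (q w)) \<and>
      smooth_on (\<phi>' ` W) (\<lambda>x. \<psi>' (q (inv_into U' \<phi>' x))) \<and>
      smooth_on (\<phi>' ` W) (\<lambda>x. comps \<psi>' (Y (inv_into U' \<phi>' x)))"
      by (rule exI[of _ U1], rule exI[of _ \<phi>1], rule exI[of _ V1], rule exI[of _ \<psi>1], rule exI[of _ "U1 \<inter> Z"])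
        (intro conjI 1(1,2) W m t s c)
  qed
qed

lemma vector_fieldI:
  assumes B: "smooth_atlas B" and T: "\<And>p. p \<in> points B \<Longrightarrow> X p \<in> tangent_space B p"
    and sm: "\<And>p. p \<in> points B \<Longrightarrow> \<exists>U \<phi>. chart B U \<phi> \<and> p \<in> U \<and> smooth_on (\<phi> ` U) (\<lambda>x. comps \<phi> (X (inv_into U \<phi> x)))"
  shows "X \<in> vector_fields B"
proof -
  have "smooth_map B (tangent_atlas B) (\<lambda>p. (p, X p))"
  proof (rule smooth_map_bundleI[OF B])
    fix u assume "u \<in> points B"
    then obtain U \<phi> where *: "chart B U \<phi>" "u \<in> U" "smooth_on (\<phi> ` U) (\<lambda>x. comps \<phi> (X (inv_into U \<phi> x)))"
      using sm by blast
    interpret chart B U \<phi> by fact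
    have "smooth_on (\<phi> ` U) (\<lambda>x. \<phi> (\<iota> x))"
      by (rule smooth_on_cong[OF smooth_on_id]) simp
    then show "\<exists>U \<phi> V \<psi> W. chart B U \<phi> \<and> chart B V \<psi> \<and> mfd_open B W \<and> u \<in> W \<and> W \<subseteq> U \<and> (\<lambda>p. p) ` W \<subseteq> V \<and>
      (\<forall>w\<in>W. X w \<in> tangent_space B w) \<and> smooth_on (\<phi> ` W) (\<lambda>x. \<psi> (inv_into U \<phi> x)) \<and>
      smooth_on (\<phi> ` W) (\<lambda>x. comps \<psi> (X (inv_into U \<phi> x)))"
      using * mfd_open_U U_subset_points T
      by (intro exI[of _ U] exI[of _ \<phi>] exI[of _ U] exI[of _ \<phi>] exI[of _ U] conjI) auto
  qed
  then show ?thesis using T by (auto simp: vector_fields_def)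
qed

lemma vector_fieldD: "X \<in> vector_fields B \<Longrightarrow> p \<in> points B \<Longrightarrow> X p \<in> tangent_space B p"
  by (auto simp: vector_fields_def)

lemma pi_vector_fieldD: "Y \<in> pi_vector_fields A \<Longrightarrow> u \<in> slit_bundle A \<Longrightarrow> Y u \<in> tangent_space A (fst u)"
  by (auto simp: pi_vector_fields_def)

lemma (in chart) vector_field_smooth:
  assumes "X \<in> vector_fields A"
  shows "smooth_on (\<phi> ` U) (\<lambda>x. comps \<phi> (X (\<iota> x)))"
proof -
  have "smooth_on (\<phi> ` U) (\<lambda>x. tangent_coords \<phi> (\<iota> x, X (\<iota> x)))"
    by (rule smooth_mapD[OF _ chart_axioms tangent_chart[OF chart_axioms] mfd_open_U subset_refl])
      (use assms vector_fieldD[OF assms] U_subset_points in \<open>auto simp: vector_fields_def tangent_bundle_def\<close>)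
  from smooth_on_snd_comp[OF this] show ?thesis by (simp add: tangent_coords_eq)
qed

section \<open>Sections in local coordinates\<close>

locale slit_chart = chart A U \<phi> for A :: "('a, 'e::euclidean_space) chart set" and U \<phi>
begin

abbreviation "SU \<equiv> {u\<in>slit_bundle A. fst u \<in> U}"
abbreviation "\<Phi> \<equiv> tangent_coords \<phi>"
abbreviation "\<Omega> \<equiv> \<phi> ` U \<times> - {0::'e}"

lemma slit_chart: "chart (slit_atlas A) SU \<Phi>"
  unfolding slit_atlas_eq by (rule bundle_part.bundle_chart[OF bundle_part_slit[OF atlas] chart_axioms])

end

sublocale slit_chart \<subseteq> S: chart "slit_atlas A" SU \<Phi>
  by (rule slit_chart)

lemma slit_chartI: "chart A U \<phi> \<Longrightarrow> slit_chart A U \<phi>"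
  by (simp add: slit_chart_def)

context slit_chart
begin

lemma slit_image: "\<Phi> ` SU = \<Omega>"
  by (rule bundle_part.image[OF bundle_part_slit[OF atlas] chart_axioms subset_refl])

lemma open_Omega: "open \<Omega>"
  using S.open_image by (simp add: slit_image)

lemma slit_iota: "z \<in> \<Omega> \<Longrightarrow> S.\<iota> z = (\<iota> (fst z), tvec A U \<phi> (\<iota> (fst z)) (snd z))"
proof -
  assume "z \<in> \<Omega>"
  then have "fst z \<in> \<phi> ` U" "snd z \<in> - {0}" by auto
  then show ?thesis
    using bundle_part.inv_coords[OF bundle_part_slit[OF atlas] chart_axioms, of "fst z" "snd z"]
    by (simp only: prod.collapse)
qed

lemma slit_iota_in: "z \<in> \<Omega> \<Longrightarrow> S.\<iota> z \<in> slit_bundle A" "z \<in> \<Omega> \<Longrightarrow> fst (S.\<iota> z) \<in> U"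
  "z \<in> \<Omega> \<Longrightarrow> \<Phi> (S.\<iota> z) = z"
  using S.iota_in S.phi_iota unfolding slit_image by blast+

lemma Phi_in: "u \<in> SU \<Longrightarrow> \<Phi> u \<in> \<Omega>"
  using slit_image by blast

lemma fst_Phi: "fst (\<Phi> u) = \<phi> (fst u)" and snd_Phi: "snd (\<Phi> u) = comps \<phi> (snd u)"
  by (simp_all add: tangent_coords_eq)

lemma snd_nonzero: "u \<in> SU \<Longrightarrow> comps \<phi> (snd u) \<noteq> 0"
  using Phi_in[of u] by (auto simp: tangent_coords_eq)

lemma snd_eq_tvec: "u \<in> SU \<Longrightarrow> snd u = tvec A U \<phi> (fst u) (comps \<phi> (snd u))"
  by (simp add: slit_bundleD)

lemma tvec_in_slit: "p \<in> U \<Longrightarrow> y \<noteq> 0 \<Longrightarrow> (p, tvec A U \<phi> p y) \<in> SU"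
  using slit_iota_in(1)[of "(\<phi> p, y)"] slit_iota[of "(\<phi> p, y)"] by auto

abbreviation "stvec \<equiv> tvec (slit_atlas A) SU \<Phi>"

lemma stvec_apply:
  assumes "u \<in> SU" "open T" "\<Phi> u \<in> T" "T \<subseteq> \<Omega>" "smooth_on T g" "\<And>z. z \<in> T \<Longrightarrow> f (S.\<iota> z) = g z"
  shows "stvec u c f = fder g (\<Phi> u) c"
  by (rule S.tvec_apply_cong) (use assms in \<open>auto simp: slit_image\<close>)

lemma smooth_near_slit:
  assumes "u \<in> SU" "open T" "\<Phi> u \<in> T" "T \<subseteq> \<Omega>" "smooth_on T g" "\<And>z. z \<in> T \<Longrightarrow> f (S.\<iota> z) = g z"
  shows "smooth_near (slit_atlas A) u f"
proof -
  have "smooth_on T (\<lambda>z. f (S.\<iota> z))" by (rule smooth_on_cong[OF assms(5)]) (simp add: assms(6))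
  then show ?thesis using S.smooth_near_iff[OF assms(1)] assms(2-4) unfolding slit_image by blast
qed

lemma rho_stvec:
  assumes u: "u \<in> SU"
  shows "rho A u (stvec u c) = tvec A U \<phi> (fst u) (fst c)"
proof
  fix f
  have p: "fst u \<in> U" using u by simp
  show "rho A u (stvec u c) f = tvec A U \<phi> (fst u) (fst c) f"
  proof (cases "smooth_near A (fst u) f")
    case True
    then obtain T where T: "open T" "\<phi> (fst u) \<in> T" "T \<subseteq> \<phi> ` U" "smooth_on T (\<lambda>x. f (\<iota> x))"
      using smooth_near_iff[OF p] by blast
    define k where "k = (\<lambda>x. f (\<iota> x))"
    have k: "smooth_on T k" using T(4) by (simp add: k_def)
    have "stvec u c (f \<circ> fst) = fder (\<lambda>z. k (fst z)) (\<Phi> u) c"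
    proof (rule stvec_apply[OF u, of "T \<times> - {0}"])
      show "smooth_on (T \<times> - {0}) (\<lambda>z::'e \<times> 'e. k (fst z))"
        by (rule smooth_on_compose[OF k smooth_on_fst]) auto
      show "open (T \<times> - {0::'e})" by (intro open_Times T(1)) auto
      show "T \<times> - {0} \<subseteq> \<Omega>" using T(3) by blast
      show "\<Phi> u \<in> T \<times> - {0}" using T(2) Phi_in[OF u] by (auto simp: tangent_coords_eq)
      fix z :: "'e \<times> 'e" assume "z \<in> T \<times> - {0}"
      then have "z \<in> \<Omega>" using T(3) by auto
      then show "(f \<circ> fst) (S.\<iota> z) = k (fst z)" by (simp add: slit_iota k_def)
    qed
    also have "((\<lambda>z. k (fst z)) has_derivative (\<lambda>c. fder k (fst (\<Phi> u)) (fst c))) (at (\<Phi> u))"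
      by (rule has_derivative_compose[where f = fst and f' = fst and g = k])
        (use smooth_on_fder[OF k T(1)] T(2) in \<open>auto intro: has_derivative_fst has_derivative_ident simp: fst_Phi\<close>)
    then have "fder (\<lambda>z. k (fst z)) (\<Phi> u) c = fder k (\<phi> (fst u)) (fst c)"
      by (simp add: fder_eqI fst_Phi)
    finally show ?thesis using True by (simp add: rho_def differential_def tvec_def k_def)
  qed (simp add: rho_def differential_def tvec_def)
qed

text \<open>The ray that defines \<open>gamma\<close> may pass through the zero vector, which lies
  outside the slit chart. The velocity at 0 involves small \<open>s\<close> only, and for these the
  components stay nonzero.\<close>

lemma gamma_eq_stvec:
  assumes u: "u \<in> SU" and v: "v \<in> tangent_space A (fst u)"
  shows "gamma A u v = stvec u (0, comps \<phi> v)"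
proof -
  have p: "fst u \<in> U" using u by simp
  define y b where "y = comps \<phi> (snd u)" and "b = comps \<phi> v"
  have in_SU: "(fst u, snd u + s \<cdot> v) \<in> SU" if "y + s *\<^sub>R b \<noteq> 0" for s
  proof -
    have "tvec A U \<phi> (fst u) (y + s *\<^sub>R b) = snd u + s \<cdot> v"
      using p v u by (simp add: y_def b_def tvec_add tvec_scaleR snd_eq_tvec[symmetric])
    then show ?thesis using tvec_in_slit[OF p that] by simp
  qed
  have "open {s. y + s *\<^sub>R b \<noteq> 0}"
    by (intro open_Collect_neq continuous_intros)
  moreover have "0 \<in> {s. y + s *\<^sub>R b \<noteq> 0}" using snd_nonzero[OF u] by (simp add: y_def)
  ultimately obtain d where d: "d > 0" "ball 0 d \<subseteq> {s. y + s *\<^sub>R b \<noteq> 0}" using open_contains_ball by blast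
  have "velocity (slit_atlas A) UNIV (\<lambda>s. (fst u, snd u + s \<cdot> v)) 0 = stvec (fst u, snd u + 0 \<cdot> v) (0, b)"
  proof (rule S.velocity_eq_tvec)
    show "d > 0" by (rule d)
    show "(\<lambda>s. (fst u, snd u + s \<cdot> v)) ` (UNIV \<inter> ball 0 d) \<subseteq> SU"
      using in_SU d(2) by blast
    have "((\<lambda>s. (\<phi> (fst u), y + s *\<^sub>R b)) has_vector_derivative (0, b)) (at 0)"
      by (rule has_vector_derivative_Pair) (auto intro!: derivative_eq_intros)
    then show "((\<lambda>s. \<Phi> (fst u, snd u + s \<cdot> v)) has_vector_derivative (0, b)) (at 0)"
      by (simp add: tangent_coords_eq comps_add comps_tscale y_def b_def)
  qed auto
  moreover have "(fst u, snd u + 0 \<cdot> v) = u" by (simp add: tscale_def prod_eq_iff fun_eq_iff)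
  ultimately show ?thesis by (simp add: gamma_def b_def)
qed

lemma pi_field_in: "Y \<in> pi_vector_fields A \<Longrightarrow> z \<in> \<Omega> \<Longrightarrow> Y (S.\<iota> z) \<in> tangent_space A (fst (S.\<iota> z))"
  by (simp add: pi_vector_fieldD slit_iota_in)

lemma pi_field_smooth:
  assumes "Y \<in> pi_vector_fields A"
  shows "smooth_on \<Omega> (\<lambda>z. comps \<phi> (Y (S.\<iota> z)))"
proof -
  have "smooth_on (\<Phi> ` SU) (\<lambda>z. \<Phi> (fst (S.\<iota> z), Y (S.\<iota> z)))"
    by (rule smooth_mapD[OF _ slit_chart tangent_chart[OF chart_axioms] S.mfd_open_U subset_refl])
      (use assms U_subset_points in \<open>auto simp: pi_vector_fields_def tangent_bundle_def\<close>)
  from smooth_on_snd_comp[OF this, unfolded slit_image] show ?thesis by (simp add: tangent_coords_eq)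
qed

lemma smooth_foot: "smooth_on \<Omega> (\<lambda>z. \<phi> (fst (S.\<iota> z)))"
  by (rule smooth_on_cong[OF smooth_on_fst]) (auto simp: slit_iota)

end

lemma slit_chart_at:
  assumes "smooth_atlas A" "u \<in> slit_bundle A"
  obtains U \<phi> where "slit_chart A U \<phi>" "u \<in> {u\<in>slit_bundle A. fst u \<in> U}"
proof -
  obtain U \<phi> where "chart A U \<phi>" "fst u \<in> U" using obtain_chart[OF assms(1) slit_bundleD(1)[OF assms(2)]] .
  then show ?thesis using that[of U \<phi>] assms(2) by (simp add: slit_chartI)
qed

lemma pi_vector_fieldI:
  assumes A: "smooth_atlas A" and T: "\<And>u. u \<in> slit_bundle A \<Longrightarrow> Y u \<in> tangent_space A (fst u)"
    and sm: "\<And>U \<phi>. slit_chart A U \<phi> \<Longrightarrow> smooth_on (\<phi> ` U \<times> - {0})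
      (\<lambda>z. comps \<phi> (Y (inv_into {u\<in>slit_bundle A. fst u \<in> U} (tangent_coords \<phi>) z)))"
  shows "Y \<in> pi_vector_fields A"
proof -
  have "smooth_map (slit_atlas A) (tangent_atlas A) (\<lambda>u. (fst u, Y u))"
  proof (rule smooth_map_bundleI[OF A])
    fix u assume "u \<in> points (slit_atlas A)"
    then have "u \<in> slit_bundle A" using A by simp
    then obtain U \<phi> where c: "slit_chart A U \<phi>" and u: "u \<in> {u\<in>slit_bundle A. fst u \<in> U}"
      by (rule slit_chart_at[OF A])
    interpret slit_chart A U \<phi> by (rule c)
    have T': "\<forall>w\<in>SU. Y w \<in> tangent_space A (fst w)" using T by simp
    have f: "fst ` SU \<subseteq> U" by blast
    show "\<exists>U \<phi> V \<psi> W. chart (slit_atlas A) U \<phi> \<and> chart A V \<psi> \<and> mfd_open (slit_atlas A) W \<and> u \<in> W \<and>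
      W \<subseteq> U \<and> fst ` W \<subseteq> V \<and> (\<forall>w\<in>W. Y w \<in> tangent_space A (fst w)) \<and>
      smooth_on (\<phi> ` W) (\<lambda>x. \<psi> (fst (inv_into U \<phi> x))) \<and>
      smooth_on (\<phi> ` W) (\<lambda>x. comps \<psi> (Y (inv_into U \<phi> x)))"
      by (rule exI[of _ SU], rule exI[of _ \<Phi>], rule exI[of _ U], rule exI[of _ \<phi>], rule exI[of _ SU])
        (intro conjI slit_chart chart_axioms S.mfd_open_U u f T' subset_refl
          smooth_foot[folded slit_image] sm[OF c, folded slit_image])
  qed
  then show ?thesis using T by (simp add: pi_vector_fields_def)
qed

lemma fundamental_field_in: "smooth_atlas A \<Longrightarrow> fundamental_field \<in> pi_vector_fields A"
proof (rule pi_vector_fieldI)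
  fix U \<phi> assume "slit_chart A U \<phi>"
  then interpret slit_chart A U \<phi> .
  show "smooth_on \<Omega> (\<lambda>z. comps \<phi> (fundamental_field (S.\<iota> z)))"
    by (rule smooth_on_cong[OF smooth_on_snd]) (auto simp: fundamental_field_def slit_iota)
qed (auto simp: fundamental_field_def slit_bundleD)

section \<open>Global sections and vector fields with prescribed local form\<close>

lemma topspace_mfd: "smooth_atlas A \<Longrightarrow> topspace (mfd_topology A) = points A"
proof -
  assume A: "smooth_atlas A"
  have "mfd_open A (points A)"
    unfolding mfd_open_def
  proof (intro conjI subset_refl ballI, clarify)
    fix U \<phi> assume "(U, \<phi>) \<in> A"
    then interpret chart A U \<phi> using A by unfold_locales
    show "open (\<phi> ` (U \<inter> points A))" using open_image U_subset_points by (simp add: Int_absorb2)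
  qed
  then have "points A \<subseteq> topspace (mfd_topology A)"
    by (intro openin_subset) (simp add: openin_mfd_topology[OF A])
  moreover have "topspace (mfd_topology A) \<subseteq> points A"
    using openin_topspace[of "mfd_topology A"] unfolding openin_mfd_topology[OF A] mfd_open_def by blast
  ultimately show ?thesis by blast
qed

text \<open>This is where Hausdorff separation enters: compact sets are closed, so a section
  supported over a compact part of the chart extends smoothly by 0.\<close>

lemma (in chart) compact_complement_open:
  assumes H: "Hausdorff_space (mfd_topology A)" and K: "compact K" "K \<subseteq> \<phi> ` U"
  shows "mfd_open A (points A - \<iota> ` K)"
proof -
  have "continuous_map (top_of_set (\<phi> ` U)) (mfd_topology A) \<iota>"
    unfolding continuous_map topspace_mfd[OF atlas] openin_mfd_topology[OF atlas]
  proof (intro conjI allI impI)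
    show "\<iota> ` topspace (top_of_set (\<phi> ` U)) \<subseteq> points A" using U_subset_points by auto
    fix W assume "mfd_open A W"
    then have "open (\<phi> ` (U \<inter> W))" using mfd_openD[OF _ chart] by blast
    moreover have "{x \<in> topspace (top_of_set (\<phi> ` U)). \<iota> x \<in> W} = \<phi> ` U \<inter> \<phi> ` (U \<inter> W)"
      by (auto simp: image_iff)
    ultimately show "openin (top_of_set (\<phi> ` U)) {x \<in> topspace (top_of_set (\<phi> ` U)). \<iota> x \<in> W}"
      by (simp add: openin_open_Int)
  qed
  moreover have "compactin (top_of_set (\<phi> ` U)) K"
    using K by (simp add: compactin_subtopology)
  ultimately have "compactin (mfd_topology A) (\<iota> ` K)" by (rule image_compactin[rotated])
  then have "closedin (mfd_topology A) (\<iota> ` K)" by (rule compactin_imp_closedin[OF H])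
  then show ?thesis
    unfolding closedin_def topspace_mfd[OF atlas] openin_mfd_topology[OF atlas] by blast
qed

context slit_chart
begin

text \<open>Connections act on global objects, so coordinate frames have to be extended; a bump
  function of the foot point does this. As the cut-off ignores the fibre coordinate, the components
  are constant over all nonzero vectors above \<open>W\<close>, not just near a single one.\<close>

lemma frame_exists:
  assumes H: "Hausdorff_space (mfd_topology A)" and p: "p \<in> U"
  obtains W E X where "open W" "\<phi> p \<in> W" "W \<subseteq> \<phi> ` U"
    "\<forall>w. E w \<in> pi_vector_fields A"
    "\<forall>u\<in>SU. \<phi> (fst u) \<in> W \<longrightarrow> (\<forall>w. E w u = tvec A U \<phi> (fst u) w)"
    "\<forall>c. X c \<in> vector_fields (slit_atlas A)"
    "\<forall>u\<in>SU. \<phi> (fst u) \<in> W \<longrightarrow> (\<forall>c. X c u = stvec u c)"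
proof -
  obtain e where e: "e > 0" "cball (\<phi> p) e \<subseteq> \<phi> ` U"
    using open_contains_cball open_image p by blast
  \<comment> \<open>The support of the bump function lies in the ball of radius
    \<open>2 * r\<close>, which has to stay inside the chart.\<close>
  define r where "r = e / 2"
  have r: "r > 0" "cball (\<phi> p) (2 * r) \<subseteq> \<phi> ` U" using e by (auto simp: r_def)
  obtain f where f: "smooth_on UNIV f" "\<And>x. x \<in> cball (\<phi> p) r \<Longrightarrow> f x = 1"
    "\<And>x. x \<notin> cball (\<phi> p) (2 * r) \<Longrightarrow> f x = (0::real)"
    using bump_function_exists[OF r(1), of "\<phi> p"] by blast
  define K where "K = cball (\<phi> p) (2 * r)"
  define Z where "Z = {u\<in>slit_bundle A. fst u \<in> points A - \<iota> ` K}"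
  have "mfd_open A (points A - \<iota> ` K)"
    unfolding K_def by (rule compact_complement_open[OF H compact_cball r(2)])
  then have Z: "mfd_open (slit_atlas A) Z"
    unfolding Z_def slit_atlas_eq by (rule bundle_part.mfd_open_bundle[OF bundle_part_slit[OF atlas]])
  have cover: "points (slit_atlas A) \<subseteq> SU \<union> Z"
    using r(2) iota_in atlas by (auto simp: Z_def K_def dest: slit_bundleD(1))
  have f0: "f (fst (\<Phi> u)) = 0" if "u \<in> SU \<inter> Z" for u
  proof -
    have "\<phi> (fst u) \<notin> K"
    proof
      assume "\<phi> (fst u) \<in> K"
      then have "\<iota> (\<phi> (fst u)) \<in> \<iota> ` K" by blast
      then show False using that by (simp add: Z_def)
    qed
    then show ?thesis using f(3) by (simp add: K_def fst_Phi)
  qed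
  have ff: "smooth_on S (\<lambda>z. f (fst z))" for S :: "('e \<times> 'e) set"
    by (rule smooth_on_compose[OF f(1) smooth_on_fst]) auto
  define E where "E w u = (if u \<in> SU then tvec A U \<phi> (fst u) (f (fst (\<Phi> u)) *\<^sub>R w) else 0)" for w u
  define X where "X c u = (if u \<in> SU then stvec u (f (fst (\<Phi> u)) *\<^sub>R c) else 0)" for c u
  have E: "E w \<in> pi_vector_fields A" for w
  proof -
    have "smooth_map (slit_atlas A) (tangent_atlas A) (\<lambda>u. (fst u, E w u))"
      unfolding E_def
    proof (rule smooth_map_extend_zero[OF atlas slit_chart chart_axioms _ _ _ Z cover,
          where h = "\<lambda>z. f (fst z) *\<^sub>R w"])
      fix u assume "u \<in> points (slit_atlas A)"
      then have "u \<in> slit_bundle A" using atlas by simp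
      then obtain U1 \<phi>1 where c: "slit_chart A U1 \<phi>1" and u: "u \<in> {u\<in>slit_bundle A. fst u \<in> U1}"
        by (rule slit_chart_at[OF atlas])
      interpret c1: slit_chart A U1 \<phi>1 by (rule c)
      show "\<exists>U1 \<phi>1 V1 \<psi>1. chart (slit_atlas A) U1 \<phi>1 \<and> chart A V1 \<psi>1 \<and> u \<in> U1 \<and> fst ` U1 \<subseteq> V1 \<and>
        smooth_on (\<phi>1 ` U1) (\<lambda>x. \<psi>1 (fst (inv_into U1 \<phi>1 x)))"
        by (rule exI[of _ c1.SU], rule exI[of _ c1.\<Phi>], rule exI[of _ U1], rule exI[of _ \<phi>1])
          (intro conjI c1.slit_chart c1.chart_axioms u c1.smooth_foot[folded c1.slit_image], blast)
    qed (use smooth_foot f0 in \<open>auto simp: slit_image intro!: smooth_on_scaleR ff smooth_on_const\<close>)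
    then show ?thesis
      using slit_bundleD(1) by (auto simp: pi_vector_fields_def E_def intro!: tangent_space_zero atlas)
  qed
  have X: "X c \<in> vector_fields (slit_atlas A)" for c
  proof -
    have "smooth_map (slit_atlas A) (tangent_atlas (slit_atlas A)) (\<lambda>u. (u, X c u))"
      unfolding X_def
    proof (rule smooth_map_extend_zero[OF S.atlas slit_chart slit_chart _ _ _ Z cover,
          where h = "\<lambda>z. f (fst z) *\<^sub>R c" and q = "\<lambda>u. u"])
      fix u assume "u \<in> points (slit_atlas A)"
      then have "u \<in> slit_bundle A" using atlas by simp
      then obtain U1 \<phi>1 where c: "slit_chart A U1 \<phi>1" and u: "u \<in> {u\<in>slit_bundle A. fst u \<in> U1}"
        by (rule slit_chart_at[OF atlas])
      interpret c1: slit_chart A U1 \<phi>1 by (rule c)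
      have "smooth_on c1.\<Omega> (\<lambda>z. c1.\<Phi> (c1.S.\<iota> z))"
        by (rule smooth_on_cong[OF smooth_on_id]) (simp add: c1.slit_iota_in)
      then show "\<exists>U1 \<phi>1 V1 \<psi>1. chart (slit_atlas A) U1 \<phi>1 \<and> chart (slit_atlas A) V1 \<psi>1 \<and> u \<in> U1 \<and>
        (\<lambda>u. u) ` U1 \<subseteq> V1 \<and> smooth_on (\<phi>1 ` U1) (\<lambda>x. \<psi>1 (inv_into U1 \<phi>1 x))"
        unfolding c1.slit_image[symmetric]
        by - (rule exI[of _ c1.SU], rule exI[of _ c1.\<Phi>], rule exI[of _ c1.SU], rule exI[of _ c1.\<Phi>],
          intro conjI c1.slit_chart u, auto)
    next
      have "smooth_on \<Omega> (\<lambda>z. \<Phi> (S.\<iota> z))"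
        by (rule smooth_on_cong[OF smooth_on_id]) (simp add: slit_iota_in)
      then show "smooth_on (\<Phi> ` SU) (\<lambda>x. \<Phi> (S.\<iota> x))" by (simp add: slit_image)
    qed (use f0 in \<open>auto intro!: smooth_on_scaleR ff smooth_on_const\<close>)
    then show ?thesis
      using atlas by (auto simp: vector_fields_def X_def intro!: tangent_space_zero S.atlas)
  qed
  show ?thesis
  proof (rule that[of "ball (\<phi> p) r" E X])
    show "ball (\<phi> p) r \<subseteq> \<phi> ` U" using r by auto
  qed (use r E X f(2) in \<open>auto simp: E_def X_def fst_Phi\<close>)
qed

end

section \<open>The spray determines the nonlinear connection\<close>

text \<open>The product rule for fibrewise linear expressions: one term with the argument frozen,
  one with the argument differentiated. It is what allows differentiating along directions that
  depend on the point, such as the spray.\<close>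

lemma fder_family:
  fixes F :: "'a::euclidean_space \<Rightarrow> 'b::euclidean_space \<Rightarrow> 'c::euclidean_space"
  assumes S: "open S" "x \<in> S" and lin: "\<And>y. y \<in> S \<Longrightarrow> linear (F y)"
    and F: "\<And>b. smooth_on S (\<lambda>y. F y b)" and g: "smooth_on S g"
  shows "fder (\<lambda>y. F y (g y)) x h = fder (\<lambda>y. F y (g x)) x h + F x (fder g x h)"
proof -
  have dF: "((\<lambda>y. F y b) has_derivative fder (\<lambda>y. F y b) x) (at x)" for b
    by (rule smooth_on_fder[OF F S])
  have "((\<lambda>y. \<Sum>b\<in>Basis. (g y \<bullet> b) *\<^sub>R F y b) has_derivative
      (\<lambda>h. \<Sum>b\<in>Basis. (g x \<bullet> b) *\<^sub>R fder (\<lambda>y. F y b) x h + (fder g x h \<bullet> b) *\<^sub>R F x b)) (at x)"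
    by (intro has_derivative_sum has_derivative_scaleR has_derivative_inner_left dF smooth_on_fder[OF g S])
  then have 1: "((\<lambda>y. F y (g y)) has_derivative
      (\<lambda>h. \<Sum>b\<in>Basis. (g x \<bullet> b) *\<^sub>R fder (\<lambda>y. F y b) x h + (fder g x h \<bullet> b) *\<^sub>R F x b)) (at x)"
    by (rule has_derivative_transform_within_open[OF _ S]) (simp add: linear_eq_sum_Basis[OF lin, symmetric])
  have "((\<lambda>y. \<Sum>b\<in>Basis. (g x \<bullet> b) *\<^sub>R F y b) has_derivative
      (\<lambda>h. \<Sum>b\<in>Basis. (g x \<bullet> b) *\<^sub>R fder (\<lambda>y. F y b) x h)) (at x)"
    by (intro has_derivative_sum has_derivative_scaleR_right dF)
  then have 2: "((\<lambda>y. F y (g x)) has_derivative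
      (\<lambda>h. \<Sum>b\<in>Basis. (g x \<bullet> b) *\<^sub>R fder (\<lambda>y. F y b) x h)) (at x)"
    by (rule has_derivative_transform_within_open[OF _ S]) (simp add: linear_eq_sum_Basis[OF lin, symmetric])
  show ?thesis
    unfolding fder_eqI[OF 1] fder_eqI[OF 2]
    by (simp add: sum.distrib linear_eq_sum_Basis[OF lin[OF S(2)], of "fder g x h"])
qed

lemma fder_snd: "fder snd z = snd"
  by (intro fder_bounded_linear bounded_linear_snd)

lemma fder_Pair:
  assumes "smooth_on S f" "smooth_on S g" "open S" "x \<in> S"
  shows "fder (\<lambda>y. (f y, g y)) x h = (fder f x h, fder g x h)"
proof -
  have "((\<lambda>y. (f y, g y)) has_derivative (\<lambda>h. (fder f x h, fder g x h))) (at x)"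
    by (intro has_derivative_Pair smooth_on_fder[OF assms(1,3,4)] smooth_on_fder[OF assms(2,3,4)])
  then show ?thesis by (simp add: fder_eqI)
qed

lemma fder_minus:
  assumes "smooth_on S f" "open S" "x \<in> S"
  shows "fder (\<lambda>y. - f y) x h = - fder f x h"
proof -
  have "((\<lambda>y. - f y) has_derivative (\<lambda>h. - fder f x h)) (at x)"
    by (intro has_derivative_minus smooth_on_fder[OF assms])
  then show ?thesis by (simp add: fder_eqI)
qed

lemma fder_cmult:
  fixes f :: "'a::euclidean_space \<Rightarrow> real"
  assumes "smooth_on S f" "open S" "x \<in> S"
  shows "fder (\<lambda>y. r * f y) x h = r * fder f x h"
proof -
  have "((\<lambda>y. r * f y) has_derivative (\<lambda>h. r * fder f x h)) (at x)"
    by (intro has_derivative_mult_right smooth_on_fder[OF assms])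
  then show ?thesis by (simp add: fder_eqI)
qed

text \<open>For the energy of a Finsler structure this is the fundamental tensor in a chart: the
  Hessian in fibre directions.\<close>

definition vhess :: "('e::euclidean_space \<times> 'e \<Rightarrow> real) \<Rightarrow> 'e \<times> 'e \<Rightarrow> 'e \<Rightarrow> 'e \<Rightarrow> real" where
  "vhess e z a b = fder (\<lambda>z. fder e z (0, b)) z (0, a)"

text \<open>A Finsler structure reduced to its energy on the image of a slit chart. Homogeneity
  survives as Euler's relation of degree 2, convexity as positivity of the vertical Hessian.\<close>

locale energy =
  fixes e :: "'e::euclidean_space \<times> 'e \<Rightarrow> real" and \<Omega> :: "('e \<times> 'e) set"
  assumes e: "smooth_on \<Omega> e" and \<Omega>: "open \<Omega>"
    and euler: "\<And>z. z \<in> \<Omega> \<Longrightarrow> fder e z (0, snd z) = 2 * e z"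
    and pos: "\<And>z b. z \<in> \<Omega> \<Longrightarrow> b \<noteq> 0 \<Longrightarrow> vhess e z b b > 0"
begin

lemma D1: "smooth_on \<Omega> (\<lambda>z. fder e z h)"
  by (rule smooth_on_fder_const[OF e \<Omega>])

lemma D2: "smooth_on \<Omega> (\<lambda>z. fder (\<lambda>z. fder e z h) z k)"
  by (rule smooth_on_fder_const[OF D1 \<Omega>])

lemma lin1: "z \<in> \<Omega> \<Longrightarrow> linear (fder e z)"
  by (rule linear_fder[OF e \<Omega>])

lemma lin2: "z \<in> \<Omega> \<Longrightarrow> linear (fder (\<lambda>z. fder e z h) z)"
  by (rule linear_fder[OF D1 \<Omega>])

lemma linear_Pair0: "linear (\<lambda>b. (0, b))"
  by (intro linearI) auto

lemma lin1': "z \<in> \<Omega> \<Longrightarrow> linear (\<lambda>b. fder e z (0, b))"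
  using linear_compose[OF linear_Pair0 lin1] by (simp add: o_def)

lemma vhess_sym: "z \<in> \<Omega> \<Longrightarrow> vhess e z a b = vhess e z b a"
  unfolding vhess_def by (rule fder_commute[OF e \<Omega>])

lemma linear_vhess_left: "z \<in> \<Omega> \<Longrightarrow> linear (\<lambda>a. vhess e z a b)"
  unfolding vhess_def using linear_compose[OF linear_Pair0 lin2] by (simp add: o_def)

lemma linear_vhess_right: "z \<in> \<Omega> \<Longrightarrow> linear (\<lambda>b. vhess e z a b)"
  using linear_vhess_left[of z a] vhess_sym[of z a] by simp

lemma smooth_vhess_const: "smooth_on \<Omega> (\<lambda>z. vhess e z a b)"
  unfolding vhess_def by (rule D2)

lemma smooth_vhess:
  assumes "smooth_on \<Omega> f" "smooth_on \<Omega> g"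
  shows "smooth_on \<Omega> (\<lambda>z. vhess e z (f z) (g z))"
  by (intro smooth_on_family[OF linear_vhess_right _ assms(2)]
      smooth_on_family[OF linear_vhess_left smooth_vhess_const assms(1)])

text \<open>Positive definiteness, tested on \<open>x - y\<close>. Vectors are identified below by
  their products with all \<open>b\<close>.\<close>

lemma vhess_eqI:
  assumes z: "z \<in> \<Omega>" and eq: "\<And>b. vhess e z x b = vhess e z y b"
  shows "x = y"
proof (rule ccontr)
  assume "x \<noteq> y"
  then have "vhess e z (x - y) (x - y) > 0" using pos[OF z] by simp
  then show False using eq[of "x - y"] linear_diff[OF linear_vhess_left[OF z]] by simp
qed

text \<open>Euler's relation differentiated in an arbitrary direction. Vertical \<open>h\<close>
  leads to \<open>vhess_radial\<close>, horizontal \<open>h\<close> to the Euler-Lagrange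
  equation.\<close>

lemma euler_deriv:
  assumes z: "z \<in> \<Omega>"
  shows "fder (\<lambda>y. fder e y (0, snd z)) z h + fder e z (0, snd h) = 2 * fder e z h"
proof -
  have "fder (\<lambda>y. fder e y (0, snd y)) z h = fder (\<lambda>y. 2 * e y) z h"
    using fder_cong[OF \<Omega> z, of "\<lambda>y. fder e y (0, snd y)" "\<lambda>y. 2 * e y"] euler by simp
  then show ?thesis
    using fder_family[OF \<Omega> z lin1' D1 smooth_on_snd, of h] fder_cmult[OF e \<Omega> z, of 2 h]
    by (simp add: fder_snd)
qed

text \<open>For vertical \<open>h\<close> the extra term on the left of \<open>euler_deriv\<close>
  cancels one of the two copies of the first derivative on the right.\<close>

lemma vhess_radial:
  assumes z: "z \<in> \<Omega>" shows "vhess e z (snd z) b = fder e z (0, b)"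
  using euler_deriv[OF z, of "(0, b)"] vhess_sym[OF z, of b "snd z"] by (simp add: vhess_def)

text \<open>The Cartan tensor vanishes on the position vector. Differentiating
  \<open>vhess_radial\<close> vertically gives the Hessian on one side; the product rule gives the
  same Hessian plus the Cartan term on the other.\<close>

lemma vhess_radial_deriv:
  assumes z: "z \<in> \<Omega>"
  shows "fder (\<lambda>y. vhess e y b (snd z)) z (0, x) = 0"
proof -
  have "fder (\<lambda>y. vhess e y b (snd y)) z (0, x) = fder (\<lambda>y. fder e y (0, b)) z (0, x)"
    using fder_cong[OF \<Omega> z, of "\<lambda>y. vhess e y b (snd y)" "\<lambda>y. fder e y (0, b)"] vhess_radial vhess_sym by simp
  then have "fder (\<lambda>y. vhess e y b (snd z)) z (0, x) + vhess e z b x = vhess e z x b"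
    using fder_family[OF \<Omega> z linear_vhess_right smooth_vhess_const smooth_on_snd, of b "(0, x)"]
    by (simp add: fder_snd vhess_def[of e z x b])
  then show ?thesis using vhess_sym[OF z, of b x] by simp
qed

text \<open>
  The first two hypotheses on \<open>P\<close> give the Euler-Lagrange equation, and its vertical derivative
  determines \<open>P\<close>.
\<close>

lemma spray_determines_connection:
  fixes P :: "'e \<times> 'e \<Rightarrow> 'e \<Rightarrow> 'e"
  assumes P: "\<And>a. smooth_on \<Omega> (\<lambda>z. P z a)" and linP: "\<And>z. z \<in> \<Omega> \<Longrightarrow> linear (P z)"
    and energy_const: "\<And>z a. z \<in> \<Omega> \<Longrightarrow> fder e z (a, - P z a) = 0"
    and torsion: "\<And>z a b. z \<in> \<Omega> \<Longrightarrow>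
      fder (\<lambda>y. fder e y (0, b)) z (a, - P z a) = fder (\<lambda>y. fder e y (0, a)) z (b, - P z b)"
    and metric: "\<And>z a b. z \<in> \<Omega> \<Longrightarrow> fder (\<lambda>y. vhess e y a b) z (snd z, - P z (snd z))
      = vhess e z (P z a) b + vhess e z a (P z b)"
    and z: "z \<in> \<Omega>"
  shows "fder (\<lambda>y. P y (snd y)) z (0, w) = 2 *\<^sub>R P z w"
proof -
  define H where "H = (\<lambda>y. P y (snd y))"
  have H: "smooth_on \<Omega> H" unfolding H_def by (rule smooth_on_family[OF linP P smooth_on_snd])
  \<comment> \<open>The Euler-Lagrange equation. The torsion condition trades the spray direction
    for the horizontal lift of \<open>b\<close>; there \<open>euler_deriv\<close> applies, and
    constancy of the energy along that lift converts the remaining vertical derivative into the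
    derivative along \<open>(b, 0)\<close>.\<close>
  have EL: "fder (\<lambda>y. fder e y (0, b)) z (snd z, - H z) = fder e z (b, 0)" if z: "z \<in> \<Omega>" for z b
  proof -
    have "fder (\<lambda>y. fder e y (0, b)) z (snd z, - H z) = - fder e z (0, - P z b)"
      using torsion[OF z, of b "snd z"] euler_deriv[OF z, of "(b, - P z b)"] energy_const[OF z, of b]
      by (simp add: H_def)
    moreover have "fder e z (b, 0) + fder e z (0, - P z b) = 0"
      using energy_const[OF z, of b] linear_add[OF lin1[OF z], of "(b, 0)" "(0, - P z b)"] by simp
    ultimately show ?thesis by simp
  qed
  define DH where "DH = fder H z (0, w)"
  \<comment> \<open>Differentiate the Euler-Lagrange equation along \<open>(0, w)\<close>. One copy
    of \<open>P z w\<close> comes from \<open>metric\<close>, the second from comparing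
    \<open>(w, - DH)\<close> with the horizontal direction \<open>(w, - P z w)\<close>. The torsion
    condition evaluates what is left, and the terms with \<open>P z b\<close> cancel.\<close>
  have "vhess e z DH b = vhess e z (2 *\<^sub>R P z w) b" for b
  proof -
    let ?k = "\<lambda>y. fder e y (0, b)"
    note lin = linear_add[OF lin2[OF z]]
    have "fder (\<lambda>y. fder ?k y (snd y, - H y)) z (0, w) = fder (\<lambda>y. fder e y (b, 0)) z (0, w)"
      using fder_cong[OF \<Omega> z, of "\<lambda>y. fder ?k y (snd y, - H y)" "\<lambda>y. fder e y (b, 0)"] EL by simp
    also have "\<dots> = fder (\<lambda>y. fder e y (0, w)) z (b, 0)" by (rule fder_commute[OF e \<Omega> z])
    finally have "fder (\<lambda>y. fder ?k y (snd z, - H z)) z (0, w) + fder ?k z (w, - DH)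
        = fder (\<lambda>y. fder e y (0, w)) z (b, 0)"
      using fder_family[OF \<Omega> z lin2 D2 smooth_on_Pair[OF smooth_on_snd smooth_on_minus[OF H]], of "(0, b)" "(0, w)"]
        fder_Pair[OF smooth_on_snd smooth_on_minus[OF H] \<Omega> z, of "(0, w)"] fder_minus[OF H \<Omega> z]
      by (simp add: fder_snd DH_def)
    moreover have "fder (\<lambda>y. fder ?k y (snd z, - H z)) z (0, w) = vhess e z (P z w) b + vhess e z w (P z b)"
      using fder_commute[OF D1 \<Omega> z, of "(0, b)" "(snd z, - H z)" "(0, w)"] metric[OF z, of w b]
      by (simp add: vhess_def H_def)
    moreover have "fder ?k z (w, - DH) = fder ?k z (w, - P z w) + vhess e z (P z w) b - vhess e z DH b"
      using lin[of "(0, b)" "(w, - P z w)" "(0, P z w - DH)"] linear_diff[OF linear_vhess_left[OF z, of b], of "P z w" DH]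
      by (simp add: vhess_def)
    moreover have "fder ?k z (w, - P z w) = fder (\<lambda>y. fder e y (0, w)) z (b, 0) - vhess e z (P z b) w"
      using torsion[OF z, of b w] lin[of "(0, w)" "(b, 0)" "(0, - P z b)"]
        linear_neg[OF linear_vhess_left[OF z, of w], of "P z b"] by (simp add: vhess_def)
    ultimately have "vhess e z DH b = 2 * vhess e z (P z w) b"
      using vhess_sym[OF z, of w "P z b"] by linarith
    then show ?thesis using linear_cmul[OF linear_vhess_left[OF z]] by simp
  qed
  then have "DH = 2 *\<^sub>R P z w" by (rule vhess_eqI[OF z])
  then show ?thesis by (simp add: DH_def H_def)
qed

end


section \<open>Finsler structures in local coordinates\<close>

locale finsler_chart = slit_chart A U \<phi> for A :: "('a, 'e::euclidean_space) chart set" and U \<phi> +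
  fixes L :: "'a \<times> 'a tvec \<Rightarrow> real"
  assumes finsler: "finsler_structure A L"
begin

definition "en z = (L (S.\<iota> z))\<^sup>2 / 2"

lemma en_smooth: "smooth_on \<Omega> en"
proof -
  have "smooth_on (\<Phi> ` (SU \<inter> slit_bundle A)) (\<lambda>z. L (S.\<iota> z))"
    using finsler by (intro S.smooth_fun_onD) (auto simp: finsler_structure_def)
  moreover have "SU \<inter> slit_bundle A = SU" by blast
  ultimately have "smooth_on \<Omega> (\<lambda>z. L (S.\<iota> z))" using slit_image by simp
  then show ?thesis unfolding en_def power2_eq_square divide_inverse
    by (intro smooth_on_mult smooth_on_const)
qed

lemma en_line:
  assumes "z + t *\<^sub>R v \<in> \<Omega>"
  shows "((\<lambda>t. en (z + t *\<^sub>R v)) has_real_derivative fder en (z + t *\<^sub>R v) v) (at t)"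
  by (rule smooth_on_line_deriv[OF en_smooth open_Omega assms])

lemma en_homogeneous:
  assumes "x \<in> \<phi> ` U" "y \<noteq> 0" "r > 0"
  shows "en (x, r *\<^sub>R y) = r\<^sup>2 * en (x, y)"
proof -
  have u: "S.\<iota> (x, y) = (\<iota> x, tvec A U \<phi> (\<iota> x) y)" "S.\<iota> (x, r *\<^sub>R y) = (\<iota> x, r \<cdot> tvec A U \<phi> (\<iota> x) y)"
    using assms slit_iota[of "(x, y)"] slit_iota[of "(x, r *\<^sub>R y)"] by (auto simp: tvec_scaleR)
  have "(\<iota> x, tvec A U \<phi> (\<iota> x) y) \<in> tangent_bundle A"
    using assms(1) U_subset_points by (auto simp: tangent_bundle_def)
  then have "L (S.\<iota> (x, r *\<^sub>R y)) = r * L (S.\<iota> (x, y))"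
    using finsler assms(3) unfolding finsler_structure_def u by blast
  then show ?thesis by (simp add: en_def power_mult_distrib)
qed

lemma en_euler:
  assumes z: "z \<in> \<Omega>"
  shows "fder en z (0, snd z) = 2 * en z"
proof -
  have z': "fst z \<in> \<phi> ` U" "snd z \<noteq> 0" using z by auto
  have "((\<lambda>t. en (z + t *\<^sub>R (0, snd z))) has_real_derivative fder en (z + 0 *\<^sub>R (0, snd z)) (0, snd z)) (at 0)"
    using z by (intro en_line) (simp flip: zero_prod_def)
  moreover have "((\<lambda>t. (1 + t)\<^sup>2 * en z) has_real_derivative 2 * en z) (at 0)"
    by (auto intro!: derivative_eq_intros)
  then have "((\<lambda>t. en (z + t *\<^sub>R (0, snd z))) has_real_derivative 2 * en z) (at 0)"
  proof (rule has_field_derivative_transform_within_open)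
    \<comment> \<open>Homogeneity is available for positive factors only; \<open>1 + t\<close> is
      positive on this neighbourhood of 0.\<close>
    show "open {-1::real<..}" "(0::real) \<in> {-1<..}" by auto
    fix t :: real assume "t \<in> {-1<..}"
    moreover have "z + t *\<^sub>R (0, snd z) = (fst z, (1 + t) *\<^sub>R snd z)"
      by (simp add: prod_eq_iff algebra_simps)
    ultimately show "(1 + t)\<^sup>2 * en z = en (z + t *\<^sub>R (0, snd z))"
      using en_homogeneous[OF z', of "1 + t"] by simp
  qed
  ultimately have "fder en (z + 0 *\<^sub>R (0, snd z)) (0, snd z) = 2 * en z" by (rule DERIV_unique)
  then show ?thesis by (simp flip: zero_prod_def)
qed

text \<open>The lines in the iterated derivatives may meet the zero vector, where \<open>en\<close>
  does not represent the energy. The points with nonzero components form an open set around the base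
  point, and derivatives at 0 depend on that set only.\<close>

lemma fundamental_tensor_eq:
  assumes u: "u \<in> SU" and x: "x \<in> tangent_space A (fst u)" and y: "y \<in> tangent_space A (fst u)"
  shows "fundamental_tensor L u x y = vhess en (\<Phi> u) (comps \<phi> x) (comps \<phi> y)"
proof -
  have p: "fst u \<in> U" using u by simp
  define v a b where "v = comps \<phi> (snd u)" and "a = comps \<phi> x" and "b = comps \<phi> y"
  have v: "v \<noteq> 0" using snd_nonzero[OF u] by (simp add: v_def)
  have \<Phi>u: "\<Phi> u = (\<phi> (fst u), v)" by (simp add: tangent_coords_eq v_def)
  have val: "(L (fst u, snd u + s \<cdot> x + t \<cdot> y))\<^sup>2 / 2 = en (\<Phi> u + s *\<^sub>R (0, a) + t *\<^sub>R (0, b))"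
    if "v + s *\<^sub>R a + t *\<^sub>R b \<noteq> 0" for s t
  proof -
    have "snd u + s \<cdot> x + t \<cdot> y = tvec A U \<phi> (fst u) (v + s *\<^sub>R a + t *\<^sub>R b)"
      using p x y u by (simp add: v_def a_def b_def tvec_add tvec_scaleR snd_eq_tvec[symmetric])
    moreover have "S.\<iota> (\<phi> (fst u), v + s *\<^sub>R a + t *\<^sub>R b) = (fst u, tvec A U \<phi> (fst u) (v + s *\<^sub>R a + t *\<^sub>R b))"
      using that p slit_iota[of "(\<phi> (fst u), v + s *\<^sub>R a + t *\<^sub>R b)"] by auto
    ultimately show ?thesis by (simp add: en_def \<Phi>u)
  qed
  have inner: "deriv (\<lambda>t. (L (fst u, snd u + s \<cdot> x + t \<cdot> y))\<^sup>2 / 2) 0 = fder en (\<Phi> u + s *\<^sub>R (0, a)) (0, b)"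
    if s: "v + s *\<^sub>R a \<noteq> 0" for s
  proof (rule DERIV_imp_deriv)
    have "((\<lambda>t. en (\<Phi> u + s *\<^sub>R (0, a) + t *\<^sub>R (0, b))) has_real_derivative
        fder en (\<Phi> u + s *\<^sub>R (0, a) + 0 *\<^sub>R (0, b)) (0, b)) (at 0)"
      using p s by (intro en_line) (auto simp: \<Phi>u)
    then have "((\<lambda>t. en (\<Phi> u + s *\<^sub>R (0, a) + t *\<^sub>R (0, b))) has_real_derivative
        fder en (\<Phi> u + s *\<^sub>R (0, a)) (0, b)) (at 0)" by (simp flip: zero_prod_def)
    then show "((\<lambda>t. (L (fst u, snd u + s \<cdot> x + t \<cdot> y))\<^sup>2 / 2) has_real_derivative
        fder en (\<Phi> u + s *\<^sub>R (0, a)) (0, b)) (at 0)"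
    proof (rule has_field_derivative_transform_within_open)
      show "open {t. v + s *\<^sub>R a + t *\<^sub>R b \<noteq> 0}" by (intro open_Collect_neq continuous_intros)
    qed (use s val in auto)
  qed
  have "deriv (\<lambda>s. deriv (\<lambda>t. (L (fst u, snd u + s \<cdot> x + t \<cdot> y))\<^sup>2 / 2) 0) 0
    = fder (\<lambda>z. fder en z (0, b)) (\<Phi> u) (0, a)"
  proof (rule DERIV_imp_deriv)
    have "((\<lambda>s. fder en (\<Phi> u + s *\<^sub>R (0, a)) (0, b)) has_real_derivative
        fder (\<lambda>z. fder en z (0, b)) (\<Phi> u + 0 *\<^sub>R (0, a)) (0, a)) (at 0)"
      using p v by (intro smooth_on_line_deriv[OF smooth_on_fder_const[OF en_smooth open_Omega] open_Omega])
        (auto simp: \<Phi>u)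
    then have "((\<lambda>s. fder en (\<Phi> u + s *\<^sub>R (0, a)) (0, b)) has_real_derivative
        fder (\<lambda>z. fder en z (0, b)) (\<Phi> u) (0, a)) (at 0)" by (simp flip: zero_prod_def)
    then show "((\<lambda>s. deriv (\<lambda>t. (L (fst u, snd u + s \<cdot> x + t \<cdot> y))\<^sup>2 / 2) 0) has_real_derivative
        fder (\<lambda>z. fder en z (0, b)) (\<Phi> u) (0, a)) (at 0)"
    proof (rule has_field_derivative_transform_within_open)
      show "open {s. v + s *\<^sub>R a \<noteq> 0}" by (intro open_Collect_neq continuous_intros)
    qed (use v inner in auto)
  qed
  then show ?thesis by (simp add: fundamental_tensor_def vhess_def a_def b_def)
qed

lemma energy: "energy en \<Omega>"
proof unfold_locales
  fix z b assume z: "z \<in> \<Omega>" and b: "b \<noteq> (0::'e)"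
  let ?u = "S.\<iota> z" and ?x = "tvec A U \<phi> (fst (S.\<iota> z)) b"
  have u: "?u \<in> SU" using slit_iota_in[OF z] by simp
  have x: "?x \<in> tangent_space A (fst ?u)" "comps \<phi> ?x = b" using u by auto
  then have "?x \<noteq> 0" using b by auto
  then have "fundamental_tensor L ?u ?x ?x > 0"
    using finsler u x(1) unfolding finsler_structure_def by blast
  then show "vhess en z b b > 0"
    using fundamental_tensor_eq[OF u x(1) x(1)] x(2) slit_iota_in(3)[OF z] by simp
qed (use en_smooth open_Omega en_euler in auto)

end

sublocale finsler_chart \<subseteq> energy en \<Omega>
  by (rule energy)

section \<open>The Cartan connection in local coordinates\<close>

lemma smooth_map_cong:
  assumes A: "smooth_atlas A" and F: "smooth_map A B F" and eq: "\<And>p. p \<in> points A \<Longrightarrow> F p = G p"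
  shows "smooth_map A B G"
  unfolding smooth_map_def
proof
  fix p assume "p \<in> points A"
  then obtain U \<phi> V \<psi> W where *: "(U, \<phi>) \<in> A" "(V, \<psi>) \<in> B" "mfd_open A W" "p \<in> W" "W \<subseteq> U"
    "F ` W \<subseteq> V" "smooth_on (\<phi> ` W) (\<psi> \<circ> F \<circ> inv_into U \<phi>)"
    using F unfolding smooth_map_def by blast
  interpret chart A U \<phi> using A * by unfold_locales
  have W: "F w = G w" if "w \<in> W" for w using eq that * U_subset_points by blast
  have "smooth_on (\<phi> ` W) (\<psi> \<circ> G \<circ> inv_into U \<phi>)"
    by (rule smooth_on_cong[OF *(7)]) (use W *(5) in \<open>auto simp: subset_iff\<close>)
  moreover have "G ` W \<subseteq> V" using *(6) W by auto
  ultimately show "\<exists>(U, \<phi>)\<in>A. \<exists>(V, \<psi>)\<in>B. \<exists>W. mfd_open A W \<and> p \<in> W \<and> W \<subseteq> U \<and> G ` W \<subseteq> V \<and>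
      smooth_on (\<phi> ` W) (\<psi> \<circ> G \<circ> inv_into U \<phi>)"
    using * by (intro bexI[OF _ *(1)] case_prodI bexI[OF _ *(2)] exI[of _ W] conjI)
qed

text \<open>Sections are total functions, but being a smooth section concerns their values over the
  slit bundle only.\<close>

lemma pi_field_cong:
  assumes A: "smooth_atlas A" and Y: "Y \<in> pi_vector_fields A" and eq: "\<And>u. u \<in> slit_bundle A \<Longrightarrow> Y u = Z u"
  shows "Z \<in> pi_vector_fields A"
proof -
  have "smooth_map (slit_atlas A) (tangent_atlas A) (\<lambda>u. (fst u, Z u))"
    by (rule smooth_map_cong[OF smooth_slit_atlas[OF A], of _ "\<lambda>u. (fst u, Y u)"])
      (use Y eq A in \<open>auto simp: pi_vector_fields_def\<close>)
  then show ?thesis using Y eq by (auto simp: pi_vector_fields_def)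
qed

lemma zero_pi_field: "smooth_atlas A \<Longrightarrow> (0 :: 'a pi_field) \<in> pi_vector_fields A"
  for A :: "('a, 'e::euclidean_space) chart set"
  by (rule pi_vector_fieldI) (auto intro: tangent_space_zero smooth_on_const dest: slit_bundleD)

lemma rho_diff: "rho A u (X - Y) = rho A u X - rho A u Y"
  by (auto simp: rho_def differential_def)

lemma gamma_in:
  assumes A: "smooth_atlas A" and u: "u \<in> slit_bundle A" and v: "v \<in> tangent_space A (fst u)"
  shows "gamma A u v \<in> tangent_space (slit_atlas A) u" "rho A u (gamma A u v) = 0"
proof -
  obtain U \<phi> where "slit_chart A U \<phi>" and u': "u \<in> {u\<in>slit_bundle A. fst u \<in> U}"
    by (rule slit_chart_at[OF A u])
  then interpret slit_chart A U \<phi> by simp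
  show "gamma A u v \<in> tangent_space (slit_atlas A) u"
    using S.tvec_in[OF u'] by (simp add: gamma_eq_stvec[OF u' v])
  show "rho A u (gamma A u v) = 0"
    using u' rho_stvec[OF u'] by (simp add: gamma_eq_stvec[OF u' v] tvec_zero)
qed

lemma rho_apply: "smooth_near A (fst u) f \<Longrightarrow> rho A u X f = X (f \<circ> fst)"
  by (simp add: rho_def differential_def)

section \<open>Horizontal lifts and torsion without coordinates\<close>

locale cartan =
  fixes A :: "('a, 'e::euclidean_space) chart set" and L :: "'a \<times> 'a tvec \<Rightarrow> real" and N :: "'a pi_conn"
  assumes manifold: "smooth_manifold A" and finsler: "finsler_structure A L" and cartan: "cartan_connection A L N"
begin

lemma atlas: "smooth_atlas A" and Hausdorff: "Hausdorff_space (mfd_topology A)"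
  using manifold by (auto simp: smooth_manifold_def)

lemma regular: "regular_connection A N" and metric: "metric_connection A L N"
  using cartan by (auto simp: cartan_connection_def)

lemma conn: "pi_connection A N"
  using regular by (simp add: regular_connection_def)

context
  fixes u X
  assumes u: "u \<in> slit_bundle A" and X: "X \<in> tangent_space (slit_atlas A) u"
begin

lemma conn_in: "Y \<in> pi_vector_fields A \<Longrightarrow> N u X Y \<in> tangent_space A (fst u)"
  using conn u X unfolding pi_connection_def by blast

lemma conn_linear: "X' \<in> tangent_space (slit_atlas A) u \<Longrightarrow> Y \<in> pi_vector_fields A \<Longrightarrow>
    N u (r \<cdot> X + s \<cdot> X') Y = r \<cdot> N u X Y + s \<cdot> N u X' Y"
  using conn u X unfolding pi_connection_def by blast

lemma conn_add: "Y \<in> pi_vector_fields A \<Longrightarrow> Z \<in> pi_vector_fields A \<Longrightarrow> N u X (Y + Z) = N u X Y + N u X Z"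
  using conn u X unfolding pi_connection_def by blast

lemma conn_leibniz: "Y \<in> pi_vector_fields A \<Longrightarrow> smooth_fun_on (slit_atlas A) (slit_bundle A) f \<Longrightarrow>
    N u X (\<lambda>w. f w \<cdot> Y w) = X f \<cdot> Y u + f u \<cdot> N u X Y"
  using conn u X unfolding pi_connection_def by blast

lemma conn_metric: "Y \<in> pi_vector_fields A \<Longrightarrow> Z \<in> pi_vector_fields A \<Longrightarrow>
    X (\<lambda>w. fundamental_tensor L w (Y w) (Z w))
      = fundamental_tensor L u (N u X Y) (Z u) + fundamental_tensor L u (Y u) (N u X Z)"
  using metric u X unfolding metric_connection_def by blast

lemma conn_zero: "N u X 0 = 0"
  using conn_add[OF zero_pi_field zero_pi_field] atlas by simp

text \<open>Apply the Leibniz rule to \<open>Z - Y\<close> and the indicator function of the complement of the slit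
  tangent bundle.\<close>

lemma conn_cong:
  assumes Y: "Y \<in> pi_vector_fields A" and eq: "\<And>w. w \<in> slit_bundle A \<Longrightarrow> Y w = Z w"
  shows "N u X Z = N u X Y"
proof -
  define f :: "'a \<times> 'a tvec \<Rightarrow> real" where "f w = (if w \<in> slit_bundle A then 0 else 1)" for w
  define Q where "Q = Z - Y"
  have Q0: "Q w = 0" if "w \<in> slit_bundle A" for w using eq[OF that] by (simp add: Q_def)
  have Q: "Q \<in> pi_vector_fields A"
    by (rule pi_field_cong[OF atlas zero_pi_field[OF atlas]]) (simp add: Q0)
  have "mfd_open (slit_atlas A) (slit_bundle A)"
    using topspace_mfd[OF smooth_slit_atlas[OF atlas]] openin_topspace
      openin_mfd_topology[OF smooth_slit_atlas[OF atlas]] points_slit_atlas[OF atlas] by metis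
  moreover have "smooth_on (\<psi> ` (V \<inter> slit_bundle A)) (f \<circ> inv_into V \<psi>)" if "(V, \<psi>) \<in> slit_atlas A" for V \<psi>
  proof -
    interpret S: chart "slit_atlas A" V \<psi> using smooth_slit_atlas[OF atlas] that by unfold_locales
    have "V \<subseteq> slit_bundle A" using S.U_subset_points atlas by simp
    then show ?thesis by (intro smooth_on_cong[OF smooth_on_const[of _ 0]]) (auto simp: f_def)
  qed
  ultimately have f: "smooth_fun_on (slit_atlas A) (slit_bundle A) f"
    unfolding smooth_fun_on_def by blast
  have "(\<lambda>w. f w \<cdot> Q w) = Q"
    using Q0 by (auto simp: f_def tscale_def fun_eq_iff)
  then have "N u X Q = X f \<cdot> Q u + f u \<cdot> N u X Q" using conn_leibniz[OF Q f] by simp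
  then have "N u X Q = 0" using u Q0[OF u] by (auto simp: f_def tscale_def fun_eq_iff)
  moreover have "Z = Y + Q" by (simp add: Q_def)
  ultimately show ?thesis using conn_add[OF Y Q] by simp
qed

end

lemma conn_field: "X \<in> vector_fields (slit_atlas A) \<Longrightarrow> Y \<in> pi_vector_fields A \<Longrightarrow>
    (\<lambda>u. N u (X u) Y) \<in> pi_vector_fields A"
  using conn unfolding pi_connection_def by blast

lemma fund_in: "fundamental_field \<in> pi_vector_fields A"
  by (rule fundamental_field_in[OF atlas])

lemma slit_tangent_diff:
  "u \<in> slit_bundle A \<Longrightarrow> X \<in> tangent_space (slit_atlas A) u \<Longrightarrow> Y \<in> tangent_space (slit_atlas A) u \<Longrightarrow>
    X - Y \<in> tangent_space (slit_atlas A) u"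
  using tangent_space_diff[OF smooth_slit_atlas[OF atlas]] atlas by simp

text \<open>Lift \<open>v\<close> in a chart with zero fibre part and subtract the vertical part
  that regularity provides; the projection does not notice the difference.\<close>

lemma beta_horizontal:
  assumes u: "u \<in> slit_bundle A" and v: "v \<in> tangent_space A (fst u)"
  shows "beta A N u v \<in> horizontal_space A N u" "rho A u (beta A N u v) = v"
proof -
  obtain U \<phi> where "slit_chart A U \<phi>" and u': "u \<in> {u\<in>slit_bundle A. fst u \<in> U}"
    by (rule slit_chart_at[OF atlas u])
  then interpret slit_chart A U \<phi> by simp
  define X where "X = stvec u (comps \<phi> v, 0)"
  have X: "X \<in> tangent_space (slit_atlas A) u" "rho A u X = v"
    using u' v by (simp_all add: X_def rho_stvec)
  then obtain Y Z where YZ: "X = Y + Z" "Y \<in> vertical_space A u" "Z \<in> horizontal_space A N u"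
    using regular u unfolding regular_connection_def by blast
  have "Z = X - Y" using YZ(1) by simp
  then have "rho A u Z = v" using X(2) YZ(2) by (simp add: rho_diff vertical_space_def)
  then have "v \<in> rho A u ` horizontal_space A N u" using YZ(3) by blast
  then show "beta A N u v \<in> horizontal_space A N u" "rho A u (beta A N u v) = v"
    unfolding beta_def by (rule inv_into_into, rule f_inv_into_f)
qed

lemma beta_in: "u \<in> slit_bundle A \<Longrightarrow> v \<in> tangent_space A (fst u) \<Longrightarrow>
    beta A N u v \<in> tangent_space (slit_atlas A) u"
  using beta_horizontal(1) by (simp add: horizontal_space_def)

lemma conn_beta_fundamental: "u \<in> slit_bundle A \<Longrightarrow> v \<in> tangent_space A (fst u) \<Longrightarrow>
    N u (beta A N u v) fundamental_field = 0"
  using beta_horizontal(1) by (simp add: horizontal_space_def connection_map_def)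

text \<open>Two horizontal lifts of the same vector differ by a vector that is both vertical and
  horizontal, hence 0 by regularity.\<close>

lemma beta_unique:
  assumes u: "u \<in> slit_bundle A" and X: "X \<in> horizontal_space A N u"
    and v: "rho A u X \<in> tangent_space A (fst u)"
  shows "beta A N u (rho A u X) = X"
proof -
  define Y where "Y = beta A N u (rho A u X)"
  have Y: "Y \<in> horizontal_space A N u" "rho A u Y = rho A u X"
    using beta_horizontal[OF u v] by (simp_all add: Y_def)
  have T: "X \<in> tangent_space (slit_atlas A) u" "Y \<in> tangent_space (slit_atlas A) u"
    using X Y by (auto simp: horizontal_space_def)
  have eq: "Y - X = 1 \<cdot> Y + (-1) \<cdot> X" by (auto simp: tscale_def)
  have "N u (Y - X) fundamental_field = 0"
    using conn_linear[OF u T(2,1) fund_in, of 1 "-1"] X Y(1) unfolding eq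
    by (simp add: horizontal_space_def connection_map_def tscale_def fun_eq_iff)
  moreover have "Y - X \<in> tangent_space (slit_atlas A) u"
    by (rule slit_tangent_diff[OF u T(2,1)])
  ultimately have "Y - X \<in> vertical_space A u \<inter> horizontal_space A N u"
    using Y(2) by (simp add: vertical_space_def horizontal_space_def connection_map_def rho_diff)
  then have "Y - X = 0" using regular u unfolding regular_connection_def by blast
  then show ?thesis by (simp add: Y_def)
qed

lemma rho_beta_field: "Y \<in> pi_vector_fields A \<Longrightarrow> w \<in> slit_bundle A \<Longrightarrow> Y w = rho A w (beta A N w (Y w))"
  by (simp add: beta_horizontal pi_vector_fieldD)

text \<open>The torsion form contains \<open>\<rho>(\<beta> Y)\<close> in place of \<open>Y\<close>.
  The two agree over the slit bundle, so \<open>conn_cong\<close> exchanges them.\<close>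

lemma torsion_free:
  assumes X: "X \<in> pi_vector_fields A" and Y: "Y \<in> pi_vector_fields A" and u: "u \<in> slit_bundle A"
  shows "N u (beta A N u (X u)) Y - N u (beta A N u (Y u)) X
    = rho A u (lie_bracket (slit_atlas A) (\<lambda>u. beta A N u (X u)) (\<lambda>u. beta A N u (Y u)) u)"
proof -
  have "horizontal_torsion A N X Y u = 0"
    using cartan X Y u unfolding cartan_connection_def by blast
  moreover have "N u (beta A N u (X u)) (\<lambda>w. rho A w (beta A N w (Y w))) = N u (beta A N u (X u)) Y"
    by (rule conn_cong[OF u beta_in[OF u pi_vector_fieldD[OF X u]] Y]) (rule rho_beta_field[OF Y])
  moreover have "N u (beta A N u (Y u)) (\<lambda>w. rho A w (beta A N w (X w))) = N u (beta A N u (Y u)) X"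
    by (rule conn_cong[OF u beta_in[OF u pi_vector_fieldD[OF Y u]] X]) (rule rho_beta_field[OF X])
  ultimately show ?thesis by (simp add: horizontal_torsion_def torsion_form_def)
qed

end

section \<open>Brackets and the connection map in a chart\<close>

lemma fder_fst_comp:
  assumes "smooth_on S h" "open S" "fst z \<in> S"
  shows "fder (\<lambda>z. h (fst z)) z c = fder h (fst z) (fst c)"
proof -
  have "((\<lambda>z. h (fst z)) has_derivative (\<lambda>c. fder h (fst z) (fst c))) (at z)"
    by (rule has_derivative_compose[where f = fst and f' = fst and g = h])
      (use smooth_on_fder[OF assms] in \<open>auto intro: has_derivative_fst has_derivative_ident\<close>)
  then show ?thesis by (simp add: fder_eqI)
qed

context slit_chart
begin

text \<open>After projection the bracket acts on coordinate functions of the foot point, on which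
  \<open>X\<close> and \<open>Y\<close> act through their projections. Hence local expressions of
  these projections are all that has to be known.\<close>

lemma comps_rho_lie:
  assumes u: "u \<in> SU" and X: "X u \<in> tangent_space (slit_atlas A) u" and Y: "Y u \<in> tangent_space (slit_atlas A) u"
    and T: "open T" "\<Phi> u \<in> T" "T \<subseteq> \<Omega>" and F: "smooth_on T F" and G: "smooth_on T G"
    and XF: "\<And>z. z \<in> T \<Longrightarrow> comps \<phi> (rho A (S.\<iota> z) (X (S.\<iota> z))) = F z"
    and YG: "\<And>z. z \<in> T \<Longrightarrow> comps \<phi> (rho A (S.\<iota> z) (Y (S.\<iota> z))) = G z"
  shows "comps \<phi> (rho A u (lie_bracket (slit_atlas A) X Y u))
    = fder G (\<Phi> u) (comps \<Phi> (X u)) - fder F (\<Phi> u) (comps \<Phi> (Y u))"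
proof (rule euclidean_eqI)
  fix b :: 'e assume b: "b \<in> Basis"
  let ?f = "\<lambda>q. \<phi> q \<bullet> b"
  have p: "fst u \<in> U" using u by simp
  have near: "smooth_near A (fst (S.\<iota> z)) ?f" if "z \<in> T" for z
    using that T(3) slit_iota_in(2)[of z] by (intro smooth_near_coord) auto
  have base: "smooth_near (slit_atlas A) u (?f \<circ> fst)"
    by (rule smooth_near_slit[OF u T, of "\<lambda>z. fst z \<bullet> b"])
      (use T(3) in \<open>auto intro!: smooth_on_inner smooth_on_fst smooth_on_const simp: slit_iota subset_iff\<close>)
  have ap: "Z u (\<lambda>q. Z' q (?f \<circ> fst)) = fder H (\<Phi> u) (comps \<Phi> (Z u)) \<bullet> b"
    if Z: "Z u \<in> tangent_space (slit_atlas A) u" and H: "smooth_on T H"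
      and Z': "\<And>z. z \<in> T \<Longrightarrow> comps \<phi> (rho A (S.\<iota> z) (Z' (S.\<iota> z))) = H z" for Z Z' H
  proof -
    have "stvec u (comps \<Phi> (Z u)) (\<lambda>q. Z' q (?f \<circ> fst)) = fder (\<lambda>z. H z \<bullet> b) (\<Phi> u) (comps \<Phi> (Z u))"
    proof (rule stvec_apply[OF u T])
      show "smooth_on T (\<lambda>z. H z \<bullet> b)" by (intro smooth_on_inner H smooth_on_const)
      fix z assume z: "z \<in> T"
      show "Z' (S.\<iota> z) (?f \<circ> fst) = H z \<bullet> b"
        using rho_apply[OF near[OF z]] comps_inner[OF b, of \<phi> "rho A (S.\<iota> z) (Z' (S.\<iota> z))"] Z'[OF z] by simp
    qed
    then show ?thesis using Z u fder_inner_right[OF H T(1,2)] by simp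
  qed
  have "comps \<phi> (rho A u (lie_bracket (slit_atlas A) X Y u)) \<bullet> b
    = X u (\<lambda>q. Y q (?f \<circ> fst)) - Y u (\<lambda>q. X q (?f \<circ> fst))"
    using base by (simp add: comps_inner[OF b] rho_apply[OF smooth_near_coord[OF p]] lie_bracket_def)
  also have "\<dots> = (fder G (\<Phi> u) (comps \<Phi> (X u)) - fder F (\<Phi> u) (comps \<Phi> (Y u))) \<bullet> b"
    using ap[of X G Y, OF X G YG] ap[of Y F X, OF Y F XF] by (simp add: inner_diff_left)
  finally show "comps \<phi> (rho A u (lie_bracket (slit_atlas A) X Y u)) \<bullet> b
    = (fder G (\<Phi> u) (comps \<Phi> (X u)) - fder F (\<Phi> u) (comps \<Phi> (Y u))) \<bullet> b" .
qed

end

locale cartan_chart = finsler_chart A U \<phi> L + cartan A L N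
  for A :: "('a, 'e::euclidean_space) chart set" and U \<phi> L and N :: "'a pi_conn"
begin

text \<open>The connection map \<open>K\<close>, with argument and value in chart
  components.\<close>

definition "kap u c = comps \<phi> (N u (stvec u c) fundamental_field)"

lemma in_slit: "u \<in> SU \<Longrightarrow> u \<in> slit_bundle A" by simp

lemma kap_linear: "u \<in> SU \<Longrightarrow> linear (kap u)"
proof (rule linearI)
  assume u: "u \<in> SU"
  have lin: "kap u (r *\<^sub>R c + s *\<^sub>R d) = r *\<^sub>R kap u c + s *\<^sub>R kap u d" for r s c d
    using conn_linear[OF in_slit[OF u] S.tvec_in[OF u] S.tvec_in[OF u] fund_in]
    unfolding kap_def S.tvec_linear[OF u] by (simp add: comps_add comps_tscale)
  show "kap u (c + d) = kap u c + kap u d" for c d using lin[of 1 c 1 d] by simp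
  show "kap u (r *\<^sub>R c) = r *\<^sub>R kap u c" for r c using lin[of r c 0 0] by simp
qed

text \<open>\<open>F\<close> and \<open>G\<close> represent the sections on \<open>T\<close> only,
  so cut-off frames may enter as constants.\<close>

lemma metric_coords:
  assumes u: "u \<in> SU" and Y: "Y \<in> pi_vector_fields A" and Z: "Z \<in> pi_vector_fields A"
    and T: "open T" "\<Phi> u \<in> T" "T \<subseteq> \<Omega>"
    and F: "\<And>z. z \<in> T \<Longrightarrow> comps \<phi> (Y (S.\<iota> z)) = F z" and G: "\<And>z. z \<in> T \<Longrightarrow> comps \<phi> (Z (S.\<iota> z)) = G z"
  shows "fder (\<lambda>z. vhess en z (F z) (G z)) (\<Phi> u) c
    = vhess en (\<Phi> u) (comps \<phi> (N u (stvec u c) Y)) (G (\<Phi> u))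
      + vhess en (\<Phi> u) (F (\<Phi> u)) (comps \<phi> (N u (stvec u c) Z))"
proof -
  note us = in_slit[OF u]
  define g where "g z = vhess en z (comps \<phi> (Y (S.\<iota> z))) (comps \<phi> (Z (S.\<iota> z)))" for z
  have g: "smooth_on \<Omega> g"
    unfolding g_def by (intro smooth_vhess pi_field_smooth Y Z)
  have "stvec u c (\<lambda>w. fundamental_tensor L w (Y w) (Z w)) = fder g (\<Phi> u) c"
  proof (rule stvec_apply[OF u open_Omega Phi_in[OF u] subset_refl g])
    fix z assume z: "z \<in> \<Omega>"
    show "fundamental_tensor L (S.\<iota> z) (Y (S.\<iota> z)) (Z (S.\<iota> z)) = g z"
      using fundamental_tensor_eq[of "S.\<iota> z"] slit_iota_in[OF z] pi_field_in[OF Y z] pi_field_in[OF Z z]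
      by (simp add: g_def)
  qed
  moreover have "fder g (\<Phi> u) = fder (\<lambda>z. vhess en z (F z) (G z)) (\<Phi> u)"
    by (rule fder_cong[OF T(1,2)]) (simp add: g_def F G)
  moreover have "S.\<iota> (\<Phi> u) = u" using u by simp
  then have "comps \<phi> (Y u) = F (\<Phi> u)" "comps \<phi> (Z u) = G (\<Phi> u)" using F[OF T(2)] G[OF T(2)] by simp_all
  ultimately show ?thesis
    using conn_metric[OF us S.tvec_in[OF u] Y Z, of c]
      fundamental_tensor_eq[OF u conn_in[OF us S.tvec_in[OF u] Y] pi_vector_fieldD[OF Z us], of c]
      fundamental_tensor_eq[OF u pi_vector_fieldD[OF Y us] conn_in[OF us S.tvec_in[OF u] Z], of c] by simp
qed

lemma fund_coords: "z \<in> \<Omega> \<Longrightarrow> comps \<phi> (fundamental_field (S.\<iota> z)) = snd z"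
  by (auto simp: fundamental_field_def slit_iota)

text \<open>By \<open>vhess_radial\<close> the product of \<open>\<eta>\<close> with
  \<open>Z\<close> is a first vertical derivative of the energy. Metricity thus relates
  \<open>K\<close> to second derivatives of \<open>en\<close>.\<close>

lemma metric_fund:
  assumes u: "u \<in> SU" and Z: "Z \<in> pi_vector_fields A"
    and T: "open T" "\<Phi> u \<in> T" "T \<subseteq> \<Omega>" and G: "\<And>z. z \<in> T \<Longrightarrow> comps \<phi> (Z (S.\<iota> z)) = b"
  shows "fder (\<lambda>z. fder en z (0, b)) (\<Phi> u) c
    = vhess en (\<Phi> u) (kap u c) b + vhess en (\<Phi> u) (snd (\<Phi> u)) (comps \<phi> (N u (stvec u c) Z))"
proof -
  have "fder (\<lambda>z. vhess en z (snd z) b) (\<Phi> u) c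
    = vhess en (\<Phi> u) (kap u c) b + vhess en (\<Phi> u) (snd (\<Phi> u)) (comps \<phi> (N u (stvec u c) Z))"
    unfolding kap_def
    by (rule metric_coords[OF u fund_in Z T fund_coords G]) (use T(3) in blast)
  moreover have "fder (\<lambda>z. vhess en z (snd z) b) (\<Phi> u) = fder (\<lambda>z. fder en z (0, b)) (\<Phi> u)"
    by (rule fder_cong[OF open_Omega Phi_in[OF u]]) (rule vhess_radial)
  ultimately show ?thesis by simp
qed

lemma local_frame:
  assumes u: "u \<in> SU"
  obtains W T E where "open W" "T = W \<times> - {0}" "open T" "\<Phi> u \<in> T" "T \<subseteq> \<Omega>" "\<forall>w. E w \<in> pi_vector_fields A"
    "\<forall>z\<in>T. \<forall>w. E w (S.\<iota> z) = tvec A U \<phi> (fst (S.\<iota> z)) w"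
    "\<forall>z\<in>T. \<forall>w. comps \<phi> (E w (S.\<iota> z)) = w" "\<forall>w. E w u = tvec A U \<phi> (fst u) w"
proof -
  have p: "fst u \<in> U" using u by simp
  obtain W E X where W: "open W" "\<phi> (fst u) \<in> W" "W \<subseteq> \<phi> ` U" "\<forall>w. E w \<in> pi_vector_fields A"
    "\<forall>u\<in>SU. \<phi> (fst u) \<in> W \<longrightarrow> (\<forall>w. E w u = tvec A U \<phi> (fst u) w)"
    "\<forall>c. X c \<in> vector_fields (slit_atlas A)"
    "\<forall>u\<in>SU. \<phi> (fst u) \<in> W \<longrightarrow> (\<forall>c. X c u = stvec u c)"
    by (rule frame_exists[OF Hausdorff p])
  have E: "E w (S.\<iota> z) = tvec A U \<phi> (fst (S.\<iota> z)) w" "fst (S.\<iota> z) \<in> U" if "z \<in> W \<times> - {0}" for z w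
  proof -
    have z: "z \<in> \<Omega>" using that W(3) by auto
    then show "fst (S.\<iota> z) \<in> U" by (rule slit_iota_in)
    have "\<phi> (fst (S.\<iota> z)) = fst z" using slit_iota_in(3)[OF z] by (metis fst_Phi)
    then show "E w (S.\<iota> z) = tvec A U \<phi> (fst (S.\<iota> z)) w"
      using that slit_iota_in[OF z] by (intro W(5)[rule_format]) auto
  qed
  show ?thesis
  proof (rule that[of W "W \<times> - {0}" E])
    show "open (W \<times> - {0::'e})" by (intro open_Times W) auto
    show "\<Phi> u \<in> W \<times> - {0}" using W(2) snd_nonzero[OF u] by (auto simp: tangent_coords_eq)
    show "\<forall>z\<in>W \<times> - {0}. \<forall>w. comps \<phi> (E w (S.\<iota> z)) = w" using E by simp
    show "\<forall>w. E w u = tvec A U \<phi> (fst u) w" using W(2,5) u by blast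
  qed (use W E in auto)
qed

text \<open>The projection of a vertical lift is 0, and the projected bracket vanishes because the
  foot components of \<open>\<beta> (E w)\<close> are constant on \<open>T\<close>. The bracket is
  not yet known to be a tangent vector here, so it is evaluated on every smooth function and not
  only on coordinates.\<close>

lemma mixed_torsion_frame:
  assumes u: "u \<in> SU" and W: "open W" "T = W \<times> - {0}" "open T" "\<Phi> u \<in> T" "T \<subseteq> \<Omega>" and Ein: "\<And>w. E w \<in> pi_vector_fields A"
    and E: "\<And>z w. z \<in> T \<Longrightarrow> E w (S.\<iota> z) = tvec A U \<phi> (fst (S.\<iota> z)) w" "\<And>w. E w u = tvec A U \<phi> (fst u) w"
  shows "mixed_torsion A N (E x) (E w) u = N u (stvec u (0, x)) (E w)"
proof -
  note us = in_slit[OF u]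
  have p: "fst u \<in> U" using u by simp
  have inT: "E w q \<in> tangent_space A (fst q)" if "q \<in> slit_bundle A" for w q
    by (rule pi_vector_fieldD[OF Ein that])
  have g: "gamma A u (E x u) = stvec u (0, x)"
    using gamma_eq_stvec[OF u inT[OF us]] p by (simp add: E(2))
  have 1: "N u (gamma A u (E x u)) (\<lambda>q. rho A q (beta A N q (E w q))) = N u (stvec u (0, x)) (E w)"
    unfolding g by (rule conn_cong[OF us S.tvec_in[OF u] Ein]) (rule rho_beta_field[OF Ein])
  have b: "beta A N u (E w u) \<in> tangent_space (slit_atlas A) u" by (rule beta_in[OF us inT[OF us]])
  have "N u (beta A N u (E w u)) (\<lambda>q. rho A q (gamma A q (E x q))) = N u (beta A N u (E w u)) 0"
    by (rule conn_cong[OF us b zero_pi_field[OF atlas]]) (simp add: gamma_in[OF atlas _ inT])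
  then have 2: "N u (beta A N u (E w u)) (\<lambda>q. rho A q (gamma A q (E x q))) = 0"
    by (simp add: conn_zero[OF us b])
  have 3: "rho A u (lie_bracket (slit_atlas A) (\<lambda>q. gamma A q (E x q)) (\<lambda>q. beta A N q (E w q)) u) = 0"
  proof
    fix f
    show "rho A u (lie_bracket (slit_atlas A) (\<lambda>q. gamma A q (E x q)) (\<lambda>q. beta A N q (E w q)) u) f = 0 f"
    proof (cases "smooth_near A (fst u) f")
      case True
      then obtain V where V: "open V" "\<phi> (fst u) \<in> V" "V \<subseteq> \<phi> ` U" "smooth_on V (\<lambda>x. f (\<iota> x))"
        using smooth_near_iff[OF p] by blast
      define k where "k = (\<lambda>x. f (\<iota> x))"
      have k: "smooth_on V k" using V(4) by (simp add: k_def)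
      define T' where "T' = (V \<inter> W) \<times> - {0::'e}"
      have T': "open T'" "T' \<subseteq> T" "\<Phi> u \<in> T'" "T' \<subseteq> \<Omega>"
        using W V(1,2) unfolding T'_def by (auto intro!: open_Times simp: tangent_coords_eq)
      have foot: "fst (S.\<iota> z) \<in> U" "S.\<iota> z \<in> slit_bundle A" "\<phi> (fst (S.\<iota> z)) \<in> V" "\<phi> (fst (S.\<iota> z)) = fst z"
        if "z \<in> T'" for z
      proof -
        have z: "z \<in> \<Omega>" using that T' by blast
        show "fst (S.\<iota> z) \<in> U" "S.\<iota> z \<in> slit_bundle A" using slit_iota_in[OF z] by auto
        show "\<phi> (fst (S.\<iota> z)) = fst z" using slit_iota_in(3)[OF z] by (metis fst_Phi)
        then show "\<phi> (fst (S.\<iota> z)) \<in> V" using that by (auto simp: T'_def)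
      qed
      have near: "smooth_near A (fst (S.\<iota> z)) f" if "z \<in> T'" for z
        using foot[OF that] V smooth_near_iff by blast
      have "gamma A u (E x u) (\<lambda>q. beta A N q (E w q) (f \<circ> fst)) = fder (\<lambda>z. fder k (fst z) w) (\<Phi> u) (0, x)"
        unfolding g
      proof (rule stvec_apply[OF u T'(1,3,4)])
        show "smooth_on T' (\<lambda>z. fder k (fst z) w)"
          by (rule smooth_on_compose[OF smooth_on_fder_const[OF k V(1)] smooth_on_fst]) (auto simp: T'_def)
        fix z assume z: "z \<in> T'"
        have "beta A N (S.\<iota> z) (E w (S.\<iota> z)) (f \<circ> fst) = rho A (S.\<iota> z) (beta A N (S.\<iota> z) (E w (S.\<iota> z))) f"
          by (rule rho_apply[OF near[OF z], symmetric])
        also have "\<dots> = tvec A U \<phi> (fst (S.\<iota> z)) w f"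
          using z T'(2) E(1)[of z w] rho_beta_field[OF Ein foot(2)[OF z]] by auto
        also have "\<dots> = fder k (fst z) w" using near[OF z] foot(4)[OF z] by (simp add: tvec_def k_def)
        finally show "beta A N (S.\<iota> z) (E w (S.\<iota> z)) (f \<circ> fst) = fder k (fst z) w" .
      qed
      \<comment> \<open>A function of the foot point alone has zero derivative in the vertical
        direction \<open>(0, x)\<close>.\<close>
      also have "\<dots> = fder (\<lambda>x. fder k x w) (fst (\<Phi> u)) 0"
        using fder_fst_comp[OF smooth_on_fder_const[OF k V(1)] V(1), of "\<Phi> u" w "(0, x)"] V(2) by (simp add: fst_Phi)
      also have "\<dots> = 0"
        by (rule linear_0[OF linear_fder[OF smooth_on_fder_const[OF k V(1)] V(1)]]) (use V(2) in \<open>simp add: fst_Phi\<close>)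
      finally have a: "gamma A u (E x u) (\<lambda>q. beta A N q (E w q) (f \<circ> fst)) = 0" .
      have "stvec u (comps \<Phi> (beta A N u (E w u))) (\<lambda>q. gamma A q (E x q) (f \<circ> fst))
          = fder (\<lambda>z. 0) (\<Phi> u) (comps \<Phi> (beta A N u (E w u)))"
      proof (rule stvec_apply[OF u T'(1,3,4) smooth_on_const])
        fix z assume z: "z \<in> T'"
        have "gamma A (S.\<iota> z) (E x (S.\<iota> z)) (f \<circ> fst) = rho A (S.\<iota> z) (gamma A (S.\<iota> z) (E x (S.\<iota> z))) f"
          by (rule rho_apply[OF near[OF z], symmetric])
        then show "gamma A (S.\<iota> z) (E x (S.\<iota> z)) (f \<circ> fst) = 0"
          using gamma_in(2)[OF atlas foot(2)[OF z] inT[OF foot(2)[OF z]]] by simp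
      qed
      then have b': "beta A N u (E w u) (\<lambda>q. gamma A q (E x q) (f \<circ> fst)) = 0"
        using u b by (simp add: frechet_derivative_const)
      show ?thesis by (simp add: rho_apply[OF True] lie_bracket_def a b')
    qed (simp add: rho_def differential_def)
  qed
  show ?thesis by (simp add: mixed_torsion_def torsion_form_def 1 2 3)
qed

text \<open>This is K o \<gamma> = id. \<open>G\<close> holds the vertical connection coefficients.
  Metricity for a frame field and the position vector \<open>y\<close> gives g(G v, y) + g(v, G y) =
  0, since the Cartan tensor vanishes on \<open>y\<close>. Symmetry of the mixed torsion makes both
  summands equal, so both are 0, and \<open>metric_fund\<close> reduces to g(K(0, x), v) = g(x,
  v).\<close>

lemma kap_vertical:
  assumes u: "u \<in> SU" shows "kap u (0, x) = x"
proof -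
  note us = in_slit[OF u]
  obtain W T E where W: "open W" "T = W \<times> - {0}" "open T" "\<Phi> u \<in> T" "T \<subseteq> \<Omega>"
    and E: "\<forall>w. E w \<in> pi_vector_fields A"
      "\<forall>z\<in>T. \<forall>w. E w (S.\<iota> z) = tvec A U \<phi> (fst (S.\<iota> z)) w"
      "\<forall>z\<in>T. \<forall>w. comps \<phi> (E w (S.\<iota> z)) = w" "\<forall>w. E w u = tvec A U \<phi> (fst u) w"
    by (rule local_frame[OF u])
  note Ein = E(1)[rule_format] and E1 = E(2)[rule_format] and E2 = E(3)[rule_format] and E3 = E(4)[rule_format]
  have p: "fst u \<in> U" using u by simp
  define G where "G w = comps \<phi> (N u (stvec u (0, x)) (E w))" for w
  have z: "\<Phi> u \<in> \<Omega>" by (rule Phi_in[OF u])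
  have mtf: "mixed_torsion A N (E x) (E w) u = N u (stvec u (0, x)) (E w)" for w
    by (rule mixed_torsion_frame[OF u W Ein E1 E3])
  have mt: "fundamental_tensor L u (mixed_torsion A N (E x) (E w) u) (E v u) = vhess en (\<Phi> u) (G w) v" for w v
    unfolding mtf G_def
    using fundamental_tensor_eq[OF u conn_in[OF us S.tvec_in[OF u] Ein] pi_vector_fieldD[OF Ein us]] p
    by (simp add: E3)
  have sym: "vhess en (\<Phi> u) (G w) v = vhess en (\<Phi> u) (G v) w" for w v
  proof -
    have "fundamental_tensor L u (mixed_torsion A N (E x) (E w) u) (E v u)
        = fundamental_tensor L u (mixed_torsion A N (E x) (E v) u) (E w u)"
      using cartan Ein us unfolding cartan_connection_def by blast
    then show ?thesis by (simp add: mt)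
  qed
  show ?thesis
  proof (rule vhess_eqI[OF z])
    fix v
    let ?y = "snd (\<Phi> u)"
    have "vhess en (\<Phi> u) (G v) ?y + vhess en (\<Phi> u) v (G ?y) = 0"
      using metric_coords[OF u Ein Ein W(3-5) E2 E2, of v ?y "(0, x)"] vhess_radial_deriv[OF z, of v x]
      by (simp add: G_def)
    then have "vhess en (\<Phi> u) (G v) ?y = 0"
      using sym[of ?y v] vhess_sym[OF z, of v "G ?y"] by simp
    then show "vhess en (\<Phi> u) (kap u (0, x)) v = vhess en (\<Phi> u) x v"
      using metric_fund[OF u Ein W(3-5) E2, of v "(0, x)"] vhess_sym[OF z, of ?y "G v"]
      by (simp add: G_def vhess_def[of en "\<Phi> u" x v])
  qed
qed

lemma kap_eq: "u \<in> SU \<Longrightarrow> kap u (a, b) = kap u (a, 0) + b"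
  using linear_add[OF kap_linear, of u "(a, 0)" "(0, b)"] kap_vertical by simp

text \<open>The vector on the right is horizontal by \<open>kap_eq\<close> and projects to
  \<open>v\<close>; uniqueness of horizontal lifts does the rest.\<close>

lemma beta_eq:
  assumes u: "u \<in> SU" and v: "v \<in> tangent_space A (fst u)"
  shows "beta A N u v = stvec u (comps \<phi> v, - kap u (comps \<phi> v, 0))"
proof -
  let ?X = "stvec u (comps \<phi> v, - kap u (comps \<phi> v, 0))"
  note us = in_slit[OF u]
  have p: "fst u \<in> U" using u by simp
  have "comps \<phi> (N u ?X fundamental_field) = 0"
    using kap_eq[OF u, of "comps \<phi> v" "- kap u (comps \<phi> v, 0)"] by (simp add: kap_def)
  then have "N u ?X fundamental_field = 0"
    using comps_eq_zero_iff[OF p conn_in[OF us S.tvec_in[OF u] fund_in]] by blast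
  then have "?X \<in> horizontal_space A N u"
    using S.tvec_in[OF u] by (simp add: horizontal_space_def connection_map_def)
  moreover have rho: "rho A u ?X = v" using rho_stvec[OF u] p v by simp
  ultimately have "beta A N u (rho A u ?X) = ?X" using v by (intro beta_unique[OF us]) simp_all
  then show ?thesis by (simp only: rho)
qed

text \<open>The coefficients of the nonlinear connection, called \<open>P\<close> in the overview,
  as functions on the chart image.\<close>

definition "Pc z a = kap (S.\<iota> z) (a, 0)"

lemma Pc_Phi: "u \<in> SU \<Longrightarrow> Pc (\<Phi> u) a = kap u (a, 0)"
  by (simp add: Pc_def)

lemma iota_SU: "z \<in> \<Omega> \<Longrightarrow> S.\<iota> z \<in> SU"
  using slit_iota_in by simp

lemma Pc_linear: "z \<in> \<Omega> \<Longrightarrow> linear (Pc z)"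
proof -
  assume z: "z \<in> \<Omega>"
  have "linear (\<lambda>a::'e. (a, 0::'e))" by (intro linearI) auto
  from linear_compose[OF this kap_linear[OF iota_SU[OF z]]] show ?thesis by (simp add: o_def Pc_def[abs_def])
qed

text \<open>Smoothness of a connection is postulated for derivatives along global vector fields; the
  frame field \<open>X (a, 0)\<close> is one with the required constant components near the given
  point.\<close>

lemma Pc_smooth: "smooth_on \<Omega> (\<lambda>z. Pc z a)"
proof (rule smooth_on_open_local[OF open_Omega])
  fix z assume z: "z \<in> \<Omega>"
  obtain W E X where W: "open W" "\<phi> (fst (S.\<iota> z)) \<in> W" "W \<subseteq> \<phi> ` U" "\<forall>w. E w \<in> pi_vector_fields A"
    "\<forall>u\<in>SU. \<phi> (fst u) \<in> W \<longrightarrow> (\<forall>w. E w u = tvec A U \<phi> (fst u) w)"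
    "\<forall>c. X c \<in> vector_fields (slit_atlas A)"
    "\<forall>u\<in>SU. \<phi> (fst u) \<in> W \<longrightarrow> (\<forall>c. X c u = stvec u c)"
    by (rule frame_exists[OF Hausdorff slit_iota_in(2)[OF z]])
  define T where "T = W \<times> - {0::'e}"
  have T: "open T" "T \<subseteq> \<Omega>" using W(1,3) by (auto simp: T_def intro!: open_Times)
  have foot: "\<phi> (fst (S.\<iota> y)) = fst y" if "y \<in> \<Omega>" for y
    using slit_iota_in(3)[OF that] by (metis fst_Phi)
  have zT: "z \<in> T" using W(2) foot[OF z] z by (auto simp: T_def)
  have "smooth_on T (\<lambda>y. comps \<phi> (N (S.\<iota> y) (X (a, 0) (S.\<iota> y)) fundamental_field))"
    by (rule smooth_on_subset[OF pi_field_smooth[OF conn_field[OF W(6)[rule_format] fund_in]] T(2)])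
  then have "smooth_on T (\<lambda>y. Pc y a)"
  proof (rule smooth_on_cong)
    fix y assume y: "y \<in> T"
    then have y': "y \<in> \<Omega>" using T by blast
    have "\<phi> (fst (S.\<iota> y)) \<in> W" using foot[OF y'] y by (auto simp: T_def)
    then show "comps \<phi> (N (S.\<iota> y) (X (a, 0) (S.\<iota> y)) fundamental_field) = Pc y a"
      using W(7)[rule_format, OF iota_SU[OF y']] by (simp add: Pc_def kap_def)
  qed
  then show "\<exists>T. open T \<and> z \<in> T \<and> T \<subseteq> \<Omega> \<and> smooth_on T (\<lambda>y. Pc y a)" using T zT by blast
qed

lemma beta_coords:
  assumes z: "z \<in> \<Omega>" and v: "v \<in> tangent_space A (fst (S.\<iota> z))"
  shows "comps \<Phi> (beta A N (S.\<iota> z) v) = (comps \<phi> v, - Pc z (comps \<phi> v))"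
  using beta_eq[OF iota_SU[OF z] v] iota_SU[OF z] by (simp add: Pc_def)

lemma beta_field:
  assumes Y: "Y \<in> pi_vector_fields A"
  shows "smooth_on \<Omega> (\<lambda>z. comps \<Phi> (beta A N (S.\<iota> z) (Y (S.\<iota> z))))"
proof (rule smooth_on_cong)
  show "smooth_on \<Omega> (\<lambda>z. (comps \<phi> (Y (S.\<iota> z)), - Pc z (comps \<phi> (Y (S.\<iota> z)))))"
    by (intro smooth_on_Pair smooth_on_minus smooth_on_family[OF Pc_linear Pc_smooth] pi_field_smooth Y)
qed (simp add: beta_coords pi_field_in[OF Y])

text \<open>\<open>\<eta>\<close> is parallel in horizontal directions and its square is twice the
  energy, so metricity gives a vanishing derivative.\<close>

lemma Pc_energy_const:
  assumes z: "z \<in> \<Omega>" shows "fder en z (a, - Pc z a) = 0"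
proof -
  define u where "u = S.\<iota> z"
  have u: "u \<in> SU" "\<Phi> u = z" using iota_SU[OF z] slit_iota_in(3)[OF z] by (simp_all add: u_def)
  have k0: "kap u (a, - Pc z a) = 0" using kap_eq[OF u(1), of a "- Pc z a"] by (simp add: Pc_def u_def)
  have "fder (\<lambda>z. vhess en z (snd z) (snd z)) z (a, - Pc z a) = 0"
    using metric_coords[OF u(1) fund_in fund_in open_Omega Phi_in[OF u(1)] subset_refl fund_coords fund_coords,
        of "(a, - Pc z a)"] k0 linear_0[OF linear_vhess_left[OF z]] linear_0[OF linear_vhess_right[OF z]]
    by (simp add: kap_def u(2))
  moreover have "fder (\<lambda>z. vhess en z (snd z) (snd z)) z = fder (\<lambda>z. 2 * en z) z"
    by (rule fder_cong[OF open_Omega z]) (simp add: vhess_radial euler)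
  ultimately show ?thesis using fder_cmult[OF en_smooth open_Omega z, of 2 "(a, - Pc z a)"] by simp
qed

lemma Pc_torsion_metric:
  assumes z: "z \<in> \<Omega>"
  shows "fder (\<lambda>y. fder en y (0, b)) z (a, - Pc z a) = fder (\<lambda>y. fder en y (0, a)) z (b, - Pc z b)"
    and "fder (\<lambda>y. vhess en y a b) z (snd z, - Pc z (snd z)) = vhess en z (Pc z a) b + vhess en z a (Pc z b)"
proof -
  define u where "u = S.\<iota> z"
  have u: "u \<in> SU" "\<Phi> u = z" using iota_SU[OF z] slit_iota_in(3)[OF z] by (simp_all add: u_def)
  note us = in_slit[OF u(1)]
  have p: "fst u \<in> U" using u by simp
  obtain W T E where W: "open W" "T = W \<times> - {0}" "open T" "\<Phi> u \<in> T" "T \<subseteq> \<Omega>"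
    and E: "\<forall>w. E w \<in> pi_vector_fields A"
      "\<forall>z\<in>T. \<forall>w. E w (S.\<iota> z) = tvec A U \<phi> (fst (S.\<iota> z)) w"
      "\<forall>z\<in>T. \<forall>w. comps \<phi> (E w (S.\<iota> z)) = w" "\<forall>w. E w u = tvec A U \<phi> (fst u) w"
    by (rule local_frame[OF u(1)])
  note Ein = E(1)[rule_format] and E1 = E(2)[rule_format] and E2 = E(3)[rule_format] and E3 = E(4)[rule_format]
  have Pu: "Pc z a = kap u (a, 0)" for a by (simp add: Pc_def u_def)
  have fu: "comps \<phi> (fundamental_field u) = snd z" using fund_coords[OF z] by (simp add: u_def)
  have b: "beta A N u (E a u) = stvec u (a, - Pc z a)" for a
    using beta_eq[OF u(1), of "E a u"] p by (simp add: E3 Pu)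
  have bf: "beta A N u (fundamental_field u) = stvec u (snd z, - Pc z (snd z))"
    using beta_eq[OF u(1) pi_vector_fieldD[OF fund_in us]] by (simp add: Pu fu)
  have k0: "kap u (a, - Pc z a) = 0" for a
    using kap_eq[OF u(1), of a "- Pc z a"] by (simp add: Pu)
  have rho: "comps \<phi> (rho A (S.\<iota> y) (beta A N (S.\<iota> y) (Y (S.\<iota> y)))) = comps \<phi> (Y (S.\<iota> y))"
    if "Y \<in> pi_vector_fields A" "y \<in> T" for Y y
  proof -
    have "y \<in> \<Omega>" using that(2) W(5) by blast
    from rho_beta_field[OF that(1) in_slit[OF iota_SU[OF this]]] show ?thesis by (rule arg_cong[OF sym])
  qed
  have rho_fund: "comps \<phi> (rho A (S.\<iota> y) (beta A N (S.\<iota> y) (fundamental_field (S.\<iota> y)))) = snd y"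
    if "y \<in> T" for y
    using rho[OF fund_in that] fund_coords[of y] that W(5) by (simp only: subsetD)
  \<comment> \<open>For frame fields the foot components of the horizontal lifts are constant, so
    the bracket projects to 0 and S = 0 becomes symmetry of the horizontal coefficients.\<close>
  have tf: "comps \<phi> (N u (stvec u (a, - Pc z a)) (E b)) = comps \<phi> (N u (stvec u (b, - Pc z b)) (E a))" for a b
  proof -
    have "comps \<phi> (rho A u (lie_bracket (slit_atlas A) (\<lambda>u. beta A N u (E a u)) (\<lambda>u. beta A N u (E b u)) u))
        = fder (\<lambda>y. b) (\<Phi> u) (comps \<Phi> (beta A N u (E a u))) - fder (\<lambda>y. a) (\<Phi> u) (comps \<Phi> (beta A N u (E b u)))"
      by (rule comps_rho_lie[OF u(1) _ _ W(3-5) smooth_on_const smooth_on_const])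
        (use rho[OF Ein] E2 in \<open>auto intro!: beta_in[OF us] pi_vector_fieldD[OF Ein us]\<close>)
    then show ?thesis
      using arg_cong[OF torsion_free[OF Ein Ein us, of a b, unfolded b], of "comps \<phi>"]
      by (simp add: comps_diff frechet_derivative_const)
  qed
  show "fder (\<lambda>y. fder en y (0, b)) z (a, - Pc z a) = fder (\<lambda>y. fder en y (0, a)) z (b, - Pc z b)"
    using metric_fund[OF u(1) Ein W(3-5) E2, of b "(a, - Pc z a)"] metric_fund[OF u(1) Ein W(3-5) E2, of a "(b, - Pc z b)"]
      tf[of a b] linear_0[OF linear_vhess_left[OF z]] by (simp add: k0 u(2))
  \<comment> \<open>Here the bracket contributes: the foot components \<open>y\<close> of the spray
    are differentiated along \<open>(a, - P a)\<close>. The derivative of \<open>\<eta>\<close> in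
    the horizontal direction vanishes, so the frame has derivative \<open>P\<close> along the
    spray.\<close>
  have tP: "comps \<phi> (N u (stvec u (snd z, - Pc z (snd z))) (E a)) = Pc z a" for a
  proof -
    have "comps \<phi> (rho A u (lie_bracket (slit_atlas A) (\<lambda>u. beta A N u (fundamental_field u)) (\<lambda>u. beta A N u (E a u)) u))
        = fder (\<lambda>y. a) (\<Phi> u) (comps \<Phi> (beta A N u (fundamental_field u))) - fder snd (\<Phi> u) (comps \<Phi> (beta A N u (E a u)))"
      by (rule comps_rho_lie[OF u(1) _ _ W(3-5) smooth_on_snd smooth_on_const])
        (simp_all add: rho[OF Ein] E2 rho_fund beta_in[OF us] pi_vector_fieldD[OF Ein us] pi_vector_fieldD[OF fund_in us])
    then show ?thesis
      using arg_cong[OF torsion_free[OF fund_in Ein us, of a, unfolded bf b], of "comps \<phi>"] u(1)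
        conn_beta_fundamental[OF us pi_vector_fieldD[OF Ein us], of a, unfolded b]
      by (simp add: comps_diff frechet_derivative_const fder_snd b)
  qed
  show "fder (\<lambda>y. vhess en y a b) z (snd z, - Pc z (snd z)) = vhess en z (Pc z a) b + vhess en z a (Pc z b)"
    using metric_coords[OF u(1) Ein Ein W(3-5) E2 E2, of a b "(snd z, - Pc z (snd z))"] by (simp add: tP u(2))
qed

lemma Pc_determined:
  "z \<in> \<Omega> \<Longrightarrow> fder (\<lambda>y. Pc y (snd y)) z (0, w) = 2 *\<^sub>R Pc z w"
  by (rule spray_determines_connection[OF Pc_smooth Pc_linear Pc_energy_const Pc_torsion_metric])

end

section \<open>Derivations along vector fields and curves\<close>

context chart
begin

lemma tangent_apply_add:
  assumes p: "p \<in> U" and v: "v \<in> tangent_space A p" and f: "smooth_near A p f" and g: "smooth_near A p g"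
  shows "v (\<lambda>q. f q + g q) = v f + v g"
proof -
  obtain S1 where S1: "open S1" "\<phi> p \<in> S1" "S1 \<subseteq> \<phi> ` U" "smooth_on S1 (\<lambda>x. f (\<iota> x))"
    using f smooth_near_iff[OF p] by blast
  obtain S2 where S2: "open S2" "\<phi> p \<in> S2" "S2 \<subseteq> \<phi> ` U" "smooth_on S2 (\<lambda>x. g (\<iota> x))"
    using g smooth_near_iff[OF p] by blast
  define S where "S = S1 \<inter> S2"
  have S: "open S" "\<phi> p \<in> S" "S \<subseteq> \<phi> ` U" using S1 S2 by (auto simp: S_def)
  have sm: "smooth_on S (\<lambda>x. f (\<iota> x))" "smooth_on S (\<lambda>x. g (\<iota> x))"
    using smooth_on_subset[OF S1(4)] smooth_on_subset[OF S2(4)] by (auto simp: S_def)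
  have "((\<lambda>x. f (\<iota> x) + g (\<iota> x)) has_derivative
      (\<lambda>h. fder (\<lambda>x. f (\<iota> x)) (\<phi> p) h + fder (\<lambda>x. g (\<iota> x)) (\<phi> p) h)) (at (\<phi> p))"
    by (intro has_derivative_add smooth_on_fder[OF sm(1) S(1,2)] smooth_on_fder[OF sm(2) S(1,2)])
  then have "tvec A U \<phi> p w (\<lambda>q. f q + g q) = tvec A U \<phi> p w f + tvec A U \<phi> p w g" for w
    unfolding tvec_apply[OF p S sm(1)] tvec_apply[OF p S sm(2)] tvec_apply[OF p S smooth_on_add[OF sm]]
    by (simp add: fder_eqI)
  then show ?thesis using v p by (auto simp: tangent_space_eq)
qed

text \<open>The definition of \<open>velocity\<close> merely names a derivative; the chain rule
  shows that it exists.\<close>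

lemma velocity_has_vector_derivative:
  assumes c: "smooth_curve A I c" and t: "t \<in> I" "c t \<in> U" "at t within I \<noteq> bot" and f: "smooth_near A (c t) f"
  shows "((\<lambda>s. f (c s)) has_vector_derivative velocity A I c t f) (at t within I)"
proof -
  obtain d where d: "d > 0" "c ` (I \<inter> ball t d) \<subseteq> U" "smooth_on (I \<inter> ball t d) (\<lambda>s. \<phi> (c s))"
    using smooth_curve_in_chart[OF c t(1,2)] .
  obtain w where w: "((\<lambda>s. \<phi> (c s)) has_vector_derivative w) (at t within I)"
    using velocity_smooth_curve[OF c t] .
  obtain S where S: "open S" "\<phi> (c t) \<in> S" "smooth_on S (\<lambda>x. f (\<iota> x))"
    using smooth_near_iff[OF t(2)] f by blast
  have "((\<lambda>x. f (\<iota> x)) has_derivative fder (\<lambda>x. f (\<iota> x)) (\<phi> (c t))) (at (\<phi> (c t)))"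
    by (rule smooth_on_fder[OF S(3,1,2)])
  then have "(((\<lambda>x. f (\<iota> x)) \<circ> (\<lambda>s. \<phi> (c s))) has_vector_derivative fder (\<lambda>x. f (\<iota> x)) (\<phi> (c t)) w)
      (at t within I)"
    using w by (rule vector_derivative_diff_chain_within[rotated, OF has_derivative_at_withinI])
  then have *: "((\<lambda>s. f (c s)) has_vector_derivative fder (\<lambda>x. f (\<iota> x)) (\<phi> (c t)) w) (at t within I)"
    by (rule has_vector_derivative_transform_within[OF _ d(1) t(1)])
      (use d in \<open>force simp: dist_commute\<close>)
  then have "velocity A I c t f = fder (\<lambda>x. f (\<iota> x)) (\<phi> (c t)) w"
    using f t(3) by (simp add: velocity_def o_def vector_derivative_within)
  then show ?thesis using * by simp
qed

text \<open>By Schwarz's theorem the second derivatives cancel in the bracket.\<close>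

lemma lie_bracket_eq_tvec:
  assumes X: "X \<in> vector_fields A" and Y: "Y \<in> vector_fields A" and p: "p \<in> U"
  shows "lie_bracket A X Y p = tvec A U \<phi> p
    (fder (\<lambda>x. comps \<phi> (Y (\<iota> x))) (\<phi> p) (comps \<phi> (X p)) - fder (\<lambda>x. comps \<phi> (X (\<iota> x))) (\<phi> p) (comps \<phi> (Y p)))"
proof
  define F G where "F = (\<lambda>x. comps \<phi> (X (\<iota> x)))" and "G = (\<lambda>x. comps \<phi> (Y (\<iota> x)))"
  have F: "smooth_on (\<phi> ` U) F" and G: "smooth_on (\<phi> ` U) G"
    unfolding F_def G_def by (intro vector_field_smooth X Y)+
  fix f
  show "lie_bracket A X Y p f = tvec A U \<phi> p
    (fder (\<lambda>x. comps \<phi> (Y (\<iota> x))) (\<phi> p) (comps \<phi> (X p)) - fder (\<lambda>x. comps \<phi> (X (\<iota> x))) (\<phi> p) (comps \<phi> (Y p))) f"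
    unfolding F_def[symmetric] G_def[symmetric]
  proof (cases "smooth_near A p f")
    case True
    then obtain S where S: "open S" "\<phi> p \<in> S" "S \<subseteq> \<phi> ` U" "smooth_on S (\<lambda>x. f (\<iota> x))"
      using smooth_near_iff[OF p] by blast
    define h where "h = (\<lambda>x. f (\<iota> x))"
    have h: "smooth_on S h" using S(4) by (simp add: h_def)
    have ap: "Z p (\<lambda>q. Z' q f) = fder (\<lambda>x. fder h x (K (\<phi> p))) (\<phi> p) (comps \<phi> (Z p))
        + fder h (\<phi> p) (fder K (\<phi> p) (comps \<phi> (Z p)))"
      if Z: "Z \<in> vector_fields A" "Z' \<in> vector_fields A" and K: "K = (\<lambda>x. comps \<phi> (Z' (\<iota> x)))" for Z Z' K
    proof -
      have T: "Z q \<in> tangent_space A q" "Z' q \<in> tangent_space A q" if "q \<in> U" for q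
        using vector_fieldD[OF Z(1)] vector_fieldD[OF Z(2)] that U_subset_points by auto
      have KS: "smooth_on S K" unfolding K by (rule smooth_on_subset[OF vector_field_smooth[OF Z(2)] S(3)])
      have "Z' (\<iota> x) f = fder h x (K x)" if "x \<in> S" for x
      proof -
        have q: "\<iota> x \<in> U" "\<phi> (\<iota> x) = x" using that S(3) by auto
        have "tvec A U \<phi> (\<iota> x) (K x) f = fder h x (K x)"
          using tvec_apply[OF q(1) S(1) _ S(3,4)] q(2) that by (simp add: h_def)
        then show ?thesis using T(2)[OF q(1)] q(1) by (simp add: K)
      qed
      then have "tvec A U \<phi> p (comps \<phi> (Z p)) (\<lambda>q. Z' q f) = fder (\<lambda>x. fder h x (K x)) (\<phi> p) (comps \<phi> (Z p))"
        by (intro tvec_apply_cong[OF p S(1-3)] smooth_on_fder_app[OF h S(1) KS])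
      also have "\<dots> = fder (\<lambda>x. fder h x (K (\<phi> p))) (\<phi> p) (comps \<phi> (Z p)) + fder h (\<phi> p) (fder K (\<phi> p) (comps \<phi> (Z p)))"
        by (rule fder_family[OF S(1,2) linear_fder[OF h S(1)] smooth_on_fder_const[OF h S(1)] KS])
      finally show ?thesis using T(1)[OF p] p by simp
    qed
    have FG: "F (\<phi> p) = comps \<phi> (X p)" "G (\<phi> p) = comps \<phi> (Y p)" using p by (simp_all add: F_def G_def)
    have "lie_bracket A X Y p f = fder h (\<phi> p) (fder G (\<phi> p) (comps \<phi> (X p))) - fder h (\<phi> p) (fder F (\<phi> p) (comps \<phi> (Y p)))"
      using True ap[OF X Y G_def] ap[OF Y X F_def]
        fder_commute[OF h S(1,2), of "comps \<phi> (X p)" "comps \<phi> (Y p)"]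
      by (simp add: lie_bracket_def FG)
    also have "\<dots> = fder h (\<phi> p) (fder G (\<phi> p) (comps \<phi> (X p)) - fder F (\<phi> p) (comps \<phi> (Y p)))"
      using linear_diff[OF linear_fder[OF h S(1,2)]] by simp
    finally show "lie_bracket A X Y p f
        = tvec A U \<phi> p (fder G (\<phi> p) (comps \<phi> (X p)) - fder F (\<phi> p) (comps \<phi> (Y p))) f"
      using tvec_apply[OF p S] by (simp add: h_def)
  qed (simp add: lie_bracket_def tvec_def)
qed

end

lemma lie_bracket_in:
  assumes "smooth_atlas A" "X \<in> vector_fields A" "Y \<in> vector_fields A" "p \<in> points A"
  shows "lie_bracket A X Y p \<in> tangent_space A p"
proof -
  obtain U \<phi> where "chart A U \<phi>" and p: "p \<in> U" using obtain_chart[OF assms(1,4)] .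
  then interpret chart A U \<phi> by simp
  show ?thesis by (simp add: lie_bracket_eq_tvec[OF assms(2,3) p] p)
qed

lemma tangent_space_sum:
  "smooth_atlas A \<Longrightarrow> p \<in> points A \<Longrightarrow> (\<And>i. i < (n::nat) \<Longrightarrow> f i \<in> tangent_space A p) \<Longrightarrow>
    (\<Sum>i<n. f i) \<in> tangent_space A p"
  by (induction n) (auto intro: tangent_space_zero tangent_space_add)

lemma tangent_space_points: "v \<in> tangent_space A p \<Longrightarrow> p \<in> points A"
proof -
  assume "v \<in> tangent_space A p"
  then obtain \<epsilon> \<alpha> where a: "\<epsilon> > 0" "smooth_curve A {-\<epsilon><..<\<epsilon>} \<alpha>" "\<alpha> 0 = p"
    unfolding tangent_space_def by blast
  have "0 \<in> {-\<epsilon><..<\<epsilon>}" using a(1) by simp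
  then obtain U \<phi> d where "(U, \<phi>) \<in> A" "d > 0" "\<alpha> ` ({-\<epsilon><..<\<epsilon>} \<inter> ball 0 d) \<subseteq> U"
    using a(2) unfolding smooth_curve_def by blast
  then have "p \<in> U" using \<open>0 \<in> _\<close> a(3) by (metis IntI centre_in_ball image_subset_iff)
  then show ?thesis using \<open>(U, \<phi>) \<in> A\<close> by (auto simp: points_def)
qed


section \<open>Curvature and covariant derivatives of the Cartan connection\<close>

context cartan
begin

lemma slit_atlas: "smooth_atlas (slit_atlas A)"
  by (rule smooth_slit_atlas[OF atlas])

lemma cartan_chart_at:
  assumes "u \<in> slit_bundle A"
  obtains U \<phi> where "cartan_chart A U \<phi> L N" "u \<in> {u\<in>slit_bundle A. fst u \<in> U}"
proof -
  obtain U \<phi> where "slit_chart A U \<phi>" and u: "u \<in> {u\<in>slit_bundle A. fst u \<in> U}"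
    by (rule slit_chart_at[OF atlas assms])
  then have "cartan_chart A U \<phi> L N"
    using cartan_axioms finsler by (simp add: cartan_chart_def finsler_chart_def finsler_chart_axioms_def)
  then show ?thesis using that u by blast
qed

section \<open>The metric as a test for equality, and the curvature\<close>

abbreviation "ft \<equiv> fundamental_tensor L"

lemma ft_linear:
  assumes u: "u \<in> slit_bundle A" and "x \<in> tangent_space A (fst u)" "y \<in> tangent_space A (fst u)" "z \<in> tangent_space A (fst u)"
  shows "ft u (r \<cdot> x + s \<cdot> y) z = r * ft u x z + s * ft u y z"
proof -
  obtain U \<phi> where "cartan_chart A U \<phi> L N" and u': "u \<in> {u\<in>slit_bundle A. fst u \<in> U}"
    by (rule cartan_chart_at[OF u])
  then interpret cartan_chart A U \<phi> L N by simp
  have "r \<cdot> x + s \<cdot> y \<in> tangent_space A (fst u)"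
    by (intro tangent_space_add tangent_space_scale atlas slit_bundleD u assms)
  then show ?thesis
    using assms u' linear_vhess_left[OF Phi_in[OF u'], of "comps \<phi> z", THEN linear_add]
      linear_vhess_left[OF Phi_in[OF u'], of "comps \<phi> z", THEN linear_cmul]
    by (simp add: fundamental_tensor_eq comps_add comps_tscale)
qed

lemma ft_add: "u \<in> slit_bundle A \<Longrightarrow> x \<in> tangent_space A (fst u) \<Longrightarrow> y \<in> tangent_space A (fst u) \<Longrightarrow>
    z \<in> tangent_space A (fst u) \<Longrightarrow> ft u (x + y) z = ft u x z + ft u y z"
  using ft_linear[of u x y z 1 1] by (simp add: tscale_def)

lemma ft_diff: "u \<in> slit_bundle A \<Longrightarrow> x \<in> tangent_space A (fst u) \<Longrightarrow> y \<in> tangent_space A (fst u) \<Longrightarrow>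
    z \<in> tangent_space A (fst u) \<Longrightarrow> ft u (x - y) z = ft u x z - ft u y z"
  using ft_linear[of u x y z 1 "-1"] by (simp add: tscale_def plus_fun_def fun_diff_def)

lemma ft_scale: "u \<in> slit_bundle A \<Longrightarrow> x \<in> tangent_space A (fst u) \<Longrightarrow>
    z \<in> tangent_space A (fst u) \<Longrightarrow> ft u (r \<cdot> x) z = r * ft u x z"
  using ft_linear[of u x x z r 0] by (simp add: tscale_def plus_fun_def)

lemma ft_sym:
  assumes u: "u \<in> slit_bundle A" and "x \<in> tangent_space A (fst u)" "y \<in> tangent_space A (fst u)"
  shows "ft u x y = ft u y x"
proof -
  obtain U \<phi> where "cartan_chart A U \<phi> L N" and u': "u \<in> {u\<in>slit_bundle A. fst u \<in> U}"
    by (rule cartan_chart_at[OF u])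
  then interpret cartan_chart A U \<phi> L N by simp
  show ?thesis using assms u' vhess_sym[OF Phi_in[OF u']] by (simp add: fundamental_tensor_eq)
qed

lemma ft_sum:
  assumes u: "u \<in> slit_bundle A" and z: "z \<in> tangent_space A (fst u)"
  shows "(\<And>i. i < (n::nat) \<Longrightarrow> f i \<in> tangent_space A (fst u)) \<Longrightarrow> ft u (\<Sum>i<n. f i) z = (\<Sum>i<n. ft u (f i) z)"
proof (induction n)
  case 0
  have "ft u (0 \<cdot> 0 + 0 \<cdot> 0) z = 0"
    using ft_linear[OF u _ _ z, of 0 0 0 0] tangent_space_zero[OF atlas slit_bundleD(1)[OF u]] by simp
  then show ?case by (simp add: tscale_def plus_fun_def zero_fun_def)
next
  case (Suc n)
  have "(\<Sum>i<n. f i) \<in> tangent_space A (fst u)"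
    by (intro tangent_space_sum atlas slit_bundleD u Suc.prems) simp
  then have "ft u ((\<Sum>i<n. f i) + f n) z = ft u (\<Sum>i<n. f i) z + ft u (f n) z"
    by (rule ft_add[OF u _ Suc.prems z]) simp
  then show ?case using Suc by (simp only: sum.lessThan_Suc less_SucI)
qed

text \<open>Frames attain every vector of the fibre, so nondegeneracy may be tested on values of
  global sections. Testing with sections, not mere vectors, is what makes metricity applicable
  afterwards.\<close>

lemma ft_eqI:
  assumes u: "u \<in> slit_bundle A" and xy: "x \<in> tangent_space A (fst u)" "y \<in> tangent_space A (fst u)"
    and eq: "\<And>Z. Z \<in> pi_vector_fields A \<Longrightarrow> ft u x (Z u) = ft u y (Z u)"
  shows "x = y"
proof -
  obtain U \<phi> where "cartan_chart A U \<phi> L N" and u': "u \<in> {u\<in>slit_bundle A. fst u \<in> U}"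
    by (rule cartan_chart_at[OF u])
  then interpret cartan_chart A U \<phi> L N by simp
  have p: "fst u \<in> U" using u' by simp
  obtain W T E where "open W" "T = W \<times> - {0}" "open T" "\<Phi> u \<in> T" "T \<subseteq> \<Omega>"
    and E: "\<forall>w. E w \<in> pi_vector_fields A"
      "\<forall>z\<in>T. \<forall>w. E w (S.\<iota> z) = tvec A U \<phi> (fst (S.\<iota> z)) w"
      "\<forall>z\<in>T. \<forall>w. comps \<phi> (E w (S.\<iota> z)) = w" "\<forall>w. E w u = tvec A U \<phi> (fst u) w"
    by (rule local_frame[OF u'])
  have "comps \<phi> x = comps \<phi> y"
  proof (rule vhess_eqI[OF Phi_in[OF u']])
    fix b
    show "vhess en (\<Phi> u) (comps \<phi> x) b = vhess en (\<Phi> u) (comps \<phi> y) b"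
      using eq[of "E b"] E(1,4) xy p by (simp add: fundamental_tensor_eq[OF u'])
  qed
  then show ?thesis by (rule tangent_eqI[OF p xy])
qed

lemma ft_smooth_near:
  assumes u: "u \<in> slit_bundle A" and Y: "Y \<in> pi_vector_fields A" and Z: "Z \<in> pi_vector_fields A"
  shows "smooth_near (slit_atlas A) u (\<lambda>w. ft w (Y w) (Z w))"
proof -
  obtain U \<phi> where "cartan_chart A U \<phi> L N" and u': "u \<in> {u\<in>slit_bundle A. fst u \<in> U}"
    by (rule cartan_chart_at[OF u])
  then interpret cartan_chart A U \<phi> L N by simp
  show ?thesis
  proof (rule smooth_near_slit[OF u' open_Omega Phi_in[OF u'] subset_refl])
    show "smooth_on \<Omega> (\<lambda>z. vhess en z (comps \<phi> (Y (S.\<iota> z))) (comps \<phi> (Z (S.\<iota> z))))"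
      by (intro smooth_vhess pi_field_smooth Y Z)
    fix z assume z: "z \<in> \<Omega>"
    show "ft (S.\<iota> z) (Y (S.\<iota> z)) (Z (S.\<iota> z)) = vhess en z (comps \<phi> (Y (S.\<iota> z))) (comps \<phi> (Z (S.\<iota> z)))"
      using fundamental_tensor_eq[OF iota_SU[OF z] pi_field_in[OF Y z] pi_field_in[OF Z z]] slit_iota_in(3)[OF z] by simp
  qed
qed

lemma beta_vector_field:
  assumes Y: "Y \<in> pi_vector_fields A"
  shows "(\<lambda>u. beta A N u (Y u)) \<in> vector_fields (slit_atlas A)"
proof (rule vector_fieldI[OF slit_atlas])
  fix u assume "u \<in> points (slit_atlas A)"
  then have u: "u \<in> slit_bundle A" using atlas by simp
  show "beta A N u (Y u) \<in> tangent_space (slit_atlas A) u" by (rule beta_in[OF u pi_vector_fieldD[OF Y u]])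
  obtain U \<phi> where "cartan_chart A U \<phi> L N" and u': "u \<in> {u\<in>slit_bundle A. fst u \<in> U}"
    by (rule cartan_chart_at[OF u])
  then interpret cartan_chart A U \<phi> L N by simp
  show "\<exists>U \<phi>. chart (slit_atlas A) U \<phi> \<and> u \<in> U \<and> smooth_on (\<phi> ` U) (\<lambda>x. comps \<phi> (beta A N (inv_into U \<phi> x) (Y (inv_into U \<phi> x))))"
    by (rule exI[of _ SU], rule exI[of _ \<Phi>]) (intro conjI slit_chart u' beta_field[OF Y, folded slit_image])
qed

lemma slit_field_in: "X \<in> vector_fields (slit_atlas A) \<Longrightarrow> u \<in> slit_bundle A \<Longrightarrow> X u \<in> tangent_space (slit_atlas A) u"
  using vector_fieldD[of X "slit_atlas A"] atlas by simp

lemma slit_bundle_open: "mfd_open (slit_atlas A) (slit_bundle A)"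
  using topspace_mfd[OF slit_atlas] openin_topspace[of "mfd_topology (slit_atlas A)"]
  unfolding openin_mfd_topology[OF slit_atlas] by (simp add: atlas)

lemma slit_apply_add:
  assumes "u \<in> slit_bundle A" "v \<in> tangent_space (slit_atlas A) u" "smooth_near (slit_atlas A) u f" "smooth_near (slit_atlas A) u g"
  shows "v (\<lambda>q. f q + g q) = v f + v g"
proof -
  have "u \<in> points (slit_atlas A)" using assms(1) atlas by simp
  then obtain U \<phi> where "chart (slit_atlas A) U \<phi>" "u \<in> U" by (rule obtain_chart[OF slit_atlas])
  then interpret chart "slit_atlas A" U \<phi> by simp
  show ?thesis by (rule tangent_apply_add[OF \<open>u \<in> U\<close> assms(2-4)])
qed

text \<open>Metricity used twice. Its first use is an identity over the slit bundle, which
  \<open>tangent_apply_cong\<close> allows under \<open>v\<close>.\<close>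

lemma metric_second_derivative:
  assumes X: "X \<in> vector_fields (slit_atlas A)" and u: "u \<in> slit_bundle A" and v: "v \<in> tangent_space (slit_atlas A) u"
    and Z: "Z \<in> pi_vector_fields A" and W: "W \<in> pi_vector_fields A"
  shows "v (\<lambda>w. X w (\<lambda>q. ft q (Z q) (W q)))
    = ft u (N u v (\<lambda>w. N w (X w) Z)) (W u) + ft u (N u (X u) Z) (N u v W)
      + (ft u (N u v Z) (N u (X u) W) + ft u (Z u) (N u v (\<lambda>w. N w (X w) W)))"
proof -
  note NZ = conn_field[OF X Z] and NW = conn_field[OF X W]
  have "v (\<lambda>w. X w (\<lambda>q. ft q (Z q) (W q))) = v (\<lambda>w. ft w (N w (X w) Z) (W w) + ft w (Z w) (N w (X w) W))"
    by (rule tangent_apply_cong[OF slit_atlas slit_bundle_open u _ v])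
      (rule conn_metric[OF _ slit_field_in[OF X] Z W])
  also have "\<dots> = v (\<lambda>w. ft w (N w (X w) Z) (W w)) + v (\<lambda>w. ft w (Z w) (N w (X w) W))"
    by (rule slit_apply_add[OF u v ft_smooth_near[OF u NZ W] ft_smooth_near[OF u Z NW]])
  also have "\<dots> = ft u (N u v (\<lambda>w. N w (X w) Z)) (W u) + ft u (N u (X u) Z) (N u v W)
      + (ft u (N u v Z) (N u (X u) W) + ft u (Z u) (N u v (\<lambda>w. N w (X w) W)))"
    by (simp only: conn_metric[OF u v NZ W] conn_metric[OF u v Z NW])
  finally show ?thesis .
qed

lemma curvature_in:
  assumes X: "X \<in> vector_fields (slit_atlas A)" and Y: "Y \<in> vector_fields (slit_atlas A)"
    and u: "u \<in> slit_bundle A" and Z: "Z \<in> pi_vector_fields A"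
  shows "curvature_form A N X Y Z u \<in> tangent_space A (fst u)"
  unfolding curvature_form_def
  by (intro tangent_space_add tangent_space_diff conn_in slit_field_in conn_field lie_bracket_in slit_atlas
      atlas slit_bundleD X Y Z u) (simp add: atlas u)

text \<open>The derivative of g(Z, W) along the bracket is computed once by metricity and once as a
  commutator of iterated derivatives; the products of two first derivatives cancel in the
  commutator.\<close>

lemma curvature_antisym:
  assumes X: "X \<in> vector_fields (slit_atlas A)" and Y: "Y \<in> vector_fields (slit_atlas A)"
    and u: "u \<in> slit_bundle A" and Z: "Z \<in> pi_vector_fields A" and W: "W \<in> pi_vector_fields A"
  shows "ft u (curvature_form A N X Y Z u) (W u) = - ft u (Z u) (curvature_form A N X Y W u)"
proof -
  let ?l = "lie_bracket (slit_atlas A) X Y u"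
  have l: "?l \<in> tangent_space (slit_atlas A) u"
    by (rule lie_bracket_in[OF slit_atlas X Y]) (simp add: atlas u)
  note Xu = slit_field_in[OF X u] and Yu = slit_field_in[OF Y u]
  note T = conn_in[OF u Yu conn_field[OF X Z]] conn_in[OF u Xu conn_field[OF Y Z]] conn_in[OF u l Z]
    conn_in[OF u Yu conn_field[OF X W]] conn_in[OF u Xu conn_field[OF Y W]] conn_in[OF u l W]
    pi_vector_fieldD[OF Z u] pi_vector_fieldD[OF W u]
  have D: "a - b \<in> tangent_space A (fst u)" if "a \<in> tangent_space A (fst u)" "b \<in> tangent_space A (fst u)" for a b
    by (intro tangent_space_diff atlas slit_bundleD u that)
  have C: "a - b + c \<in> tangent_space A (fst u)"
    if "a \<in> tangent_space A (fst u)" "b \<in> tangent_space A (fst u)" "c \<in> tangent_space A (fst u)" for a b c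
    by (intro tangent_space_add D atlas slit_bundleD u that)
  have exp: "ft u (a - b + c) d = ft u a d - ft u b d + ft u c d"
    if "a \<in> tangent_space A (fst u)" "b \<in> tangent_space A (fst u)" "c \<in> tangent_space A (fst u)"
      "d \<in> tangent_space A (fst u)" for a b c d
    using that by (simp add: ft_add[OF u D] ft_diff[OF u])
  have exp': "ft u d (a - b + c) = ft u d a - ft u d b + ft u d c"
    if "a \<in> tangent_space A (fst u)" "b \<in> tangent_space A (fst u)" "c \<in> tangent_space A (fst u)"
      "d \<in> tangent_space A (fst u)" for a b c d
    using exp[OF that] ft_sym[OF u that(4) C[OF that(1-3)]] ft_sym[OF u that(4,1)] ft_sym[OF u that(4,2)]
      ft_sym[OF u that(4,3)] by simp
  have "?l (\<lambda>q. ft q (Z q) (W q)) = X u (\<lambda>w. Y w (\<lambda>q. ft q (Z q) (W q))) - Y u (\<lambda>w. X w (\<lambda>q. ft q (Z q) (W q)))"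
    using ft_smooth_near[OF u Z W] by (simp add: lie_bracket_def)
  then have "ft u (N u ?l Z) (W u) + ft u (Z u) (N u ?l W)
      = X u (\<lambda>w. Y w (\<lambda>q. ft q (Z q) (W q))) - Y u (\<lambda>w. X w (\<lambda>q. ft q (Z q) (W q)))"
    by (simp only: conn_metric[OF u l Z W])
  note L = this[unfolded metric_second_derivative[OF X u Yu Z W] metric_second_derivative[OF Y u Xu Z W]]
  \<comment> \<open>\<open>a\<close>, \<open>b\<close>, \<open>c\<close> are the products of
    \<open>W\<close> with the three parts of the curvature applied to \<open>Z\<close>, the primed
    letters those with the roles exchanged; \<open>x\<close> and \<open>y\<close> are the mixed
    products of first derivatives.\<close>
  have arith: "c + c' = (b + y + (x + b')) - (a + x + (y + a')) \<Longrightarrow> a - b + c = - (a' - b' + c')"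
    for a b c a' b' c' x y :: real by linarith
  show ?thesis
    unfolding curvature_form_def exp[OF T(1-3,8)] exp'[OF T(4-7)] by (rule arith[OF L])
qed

text \<open>Tensoriality in the last argument follows from the skew symmetry, which moves the
  differentiation to the other argument of the metric.\<close>

lemma curvature_tensorial:
  assumes X: "X \<in> vector_fields (slit_atlas A)" and Y: "Y \<in> vector_fields (slit_atlas A)"
    and u: "u \<in> slit_bundle A" and Z: "Z \<in> pi_vector_fields A" and Z': "Z' \<in> pi_vector_fields A" and eq: "Z u = Z' u"
  shows "curvature_form A N X Y Z u = curvature_form A N X Y Z' u"
  by (rule ft_eqI[OF u curvature_in[OF X Y u Z] curvature_in[OF X Y u Z']])
    (simp add: curvature_antisym[OF X Y u Z] curvature_antisym[OF X Y u Z'] eq)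

text \<open>Tensoriality replaces \<open>Z\<close> by \<open>\<eta>\<close>, whose horizontal
  derivatives vanish over the whole slit bundle. Both iterated derivatives drop out, and
  \<open>K\<close> of the bracket remains.\<close>

lemma horizontal_curvature_fundamental:
  assumes X: "X \<in> pi_vector_fields A" and Y: "Y \<in> pi_vector_fields A" and Z: "Z \<in> pi_vector_fields A"
    and u: "u \<in> slit_bundle A" and Zu: "Z u = snd u"
  shows "horizontal_curvature A N X Y Z u
    = N u (lie_bracket (slit_atlas A) (\<lambda>u. beta A N u (X u)) (\<lambda>u. beta A N u (Y u)) u) fundamental_field"
proof -
  note bX = beta_vector_field[OF X] and bY = beta_vector_field[OF Y]
  have 0: "N u v (\<lambda>w. N w (beta A N w (V w)) fundamental_field) = 0"
    if v: "v \<in> tangent_space (slit_atlas A) u" and V: "V \<in> pi_vector_fields A" for v V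
  proof -
    have "N u v (\<lambda>w. N w (beta A N w (V w)) fundamental_field) = N u v 0"
      by (rule conn_cong[OF u v zero_pi_field[OF atlas]]) (simp add: conn_beta_fundamental pi_vector_fieldD[OF V])
    then show ?thesis by (simp add: conn_zero[OF u v])
  qed
  have "horizontal_curvature A N X Y Z u = horizontal_curvature A N X Y fundamental_field u"
    unfolding horizontal_curvature_def
    by (rule curvature_tensorial[OF bX bY u Z fund_in]) (simp add: Zu fundamental_field_def)
  also have "\<dots> = N u (lie_bracket (slit_atlas A) (\<lambda>u. beta A N u (X u)) (\<lambda>u. beta A N u (Y u)) u) fundamental_field"
    unfolding horizontal_curvature_def curvature_form_def
    by (simp add: 0[OF slit_field_in[OF bX u] Y] 0[OF slit_field_in[OF bY u] X])
  finally show ?thesis .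
qed

end

section \<open>Covariant derivatives along curves\<close>

lemma tscale_one [simp]: "1 \<cdot> v = v"
  by (simp add: tscale_def)

lemma tscale_zero_left [simp]: "0 \<cdot> v = 0"
  by (auto simp: tscale_def)

context cartan
begin

lemma slit_points: "points (slit_atlas A) = slit_bundle A"
  by (simp add: atlas)

lemma slit_velocity:
  assumes \<sigma>: "smooth_curve (slit_atlas A) I \<sigma>" and t: "t \<in> I" "at t within I \<noteq> bot"
  shows "\<sigma> t \<in> slit_bundle A" "velocity (slit_atlas A) I \<sigma> t \<in> tangent_space (slit_atlas A) (\<sigma> t)"
    and "smooth_near (slit_atlas A) (\<sigma> t) f \<Longrightarrow>
      ((\<lambda>s. f (\<sigma> s)) has_vector_derivative velocity (slit_atlas A) I \<sigma> t f) (at t within I)"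
proof -
  obtain U \<phi> d where c: "(U, \<phi>) \<in> slit_atlas A" and d: "d > 0" "\<sigma> ` (I \<inter> ball t d) \<subseteq> U"
    using \<sigma> t(1) unfolding smooth_curve_def by blast
  interpret chart "slit_atlas A" U \<phi> using slit_atlas c by unfold_locales
  have u: "\<sigma> t \<in> U" using d t(1) by auto
  then have "\<sigma> t \<in> points (slit_atlas A)" using U_subset_points by blast
  then show "\<sigma> t \<in> slit_bundle A" by (simp add: slit_points)
  show "velocity (slit_atlas A) I \<sigma> t \<in> tangent_space (slit_atlas A) (\<sigma> t)"
    using velocity_smooth_curve[OF \<sigma> t(1) u t(2)] tvec_in[OF u] by metis
  show "smooth_near (slit_atlas A) (\<sigma> t) f \<Longrightarrow>
      ((\<lambda>s. f (\<sigma> s)) has_vector_derivative velocity (slit_atlas A) I \<sigma> t f) (at t within I)"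
    by (rule velocity_has_vector_derivative[OF \<sigma> t(1) u t(2)])
qed

text \<open>The predicate under the \<open>THE\<close> of \<open>cov_deriv_along\<close>, named so
  that it can be compared for two connections.\<close>

definition cov_deriv_repr where
  "cov_deriv_repr I \<sigma> W t z \<longleftrightarrow> (\<exists>(n::nat) E a. \<exists>d>0.
        (\<forall>i<n. E i \<in> pi_vector_fields A \<and> smooth_on (I \<inter> ball t d) (a i :: real \<Rightarrow> real)) \<and>
        (\<forall>s\<in>I \<inter> ball t d. W s = (\<Sum>i<n. a i s \<cdot> E i (\<sigma> s))) \<and>
        z = (\<Sum>i<n. vector_derivative (a i) (at t within I) \<cdot> E i (\<sigma> t)
                     + a i t \<cdot> N (\<sigma> t) (velocity (slit_atlas A) I \<sigma> t) (E i)))"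

lemma cov_deriv_along_eq: "cov_deriv_along A N I \<sigma> W t = (THE z. cov_deriv_repr I \<sigma> W t z)"
  by (simp only: cov_deriv_along_def cov_deriv_repr_def)

text \<open>Metricity gives a formula for \<open>g(z, Z)\<close> in which the representation of \<open>W\<close> no longer occurs.\<close>

lemma cov_deriv_repr_metric:
  assumes \<sigma>: "smooth_curve (slit_atlas A) I \<sigma>" and t: "t \<in> I" "at t within I \<noteq> bot"
    and z: "cov_deriv_repr I \<sigma> W t z"
  shows "z \<in> tangent_space A (fst (\<sigma> t))"
    and "Z \<in> pi_vector_fields A \<Longrightarrow> ft (\<sigma> t) z (Z (\<sigma> t))
      = vector_derivative (\<lambda>s. ft (\<sigma> s) (W s) (Z (\<sigma> s))) (at t within I)
        - ft (\<sigma> t) (W t) (N (\<sigma> t) (velocity (slit_atlas A) I \<sigma> t) Z)"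
proof -
  define v where "v = velocity (slit_atlas A) I \<sigma> t"
  note u = slit_velocity(1)[OF \<sigma> t] and v = slit_velocity(2)[OF \<sigma> t, folded v_def]
  have \<sigma>in: "\<sigma> s \<in> slit_bundle A" if "s \<in> I" for s
  proof -
    from \<sigma>[unfolded smooth_curve_def, rule_format, OF that]
    obtain V \<psi> d where V: "(V, \<psi>) \<in> slit_atlas A" "d > 0" "\<sigma> ` (I \<inter> ball s d) \<subseteq> V" by blast
    then have "\<sigma> s \<in> V" using that by auto
    then have "\<sigma> s \<in> points (slit_atlas A)" using V(1) by (auto simp: points_def)
    then show ?thesis by (simp add: slit_points)
  qed
  obtain n :: nat and E a d where d: "d > 0"
    and E: "\<And>i. i < n \<Longrightarrow> E i \<in> pi_vector_fields A" and a: "\<And>i. i < n \<Longrightarrow> smooth_on (I \<inter> ball t d) (a i :: real \<Rightarrow> real)"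
    and W: "\<And>s. s \<in> I \<inter> ball t d \<Longrightarrow> W s = (\<Sum>i<n. a i s \<cdot> E i (\<sigma> s))"
    and z': "z = (\<Sum>i<n. vector_derivative (a i) (at t within I) \<cdot> E i (\<sigma> t) + a i t \<cdot> N (\<sigma> t) v (E i))"
    using z unfolding cov_deriv_repr_def v_def by blast
  define a' where "a' i = vector_derivative (a i) (at t within I)" for i
  have da: "(a i has_vector_derivative a' i) (at t within I)" if "i < n" for i
  proof -
    obtain D where "(a i has_derivative D) (at t within I \<inter> ball t d)"
      using smooth_on_has_derivative[OF a[OF \<open>i < n\<close>], of t] t d by auto
    then have "(a i has_derivative D) (at t within I)"
      using at_within_nhd[of t "ball t d" "I \<inter> ball t d" I] d by auto
    then show ?thesis
      unfolding a'_def using differentiableI vector_derivative_works by blast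
  qed
  note p = slit_bundleD(1)[OF u]
  have tE: "a' i \<cdot> E i (\<sigma> t) \<in> tangent_space A (fst (\<sigma> t))" "a i t \<cdot> E i (\<sigma> t) \<in> tangent_space A (fst (\<sigma> t))"
    and tN: "a i t \<cdot> N (\<sigma> t) v (E i) \<in> tangent_space A (fst (\<sigma> t))" if "i < n" for i
    by (intro tangent_space_scale atlas p pi_vector_fieldD E that u conn_in v)+
  have sum_in: "a' i \<cdot> E i (\<sigma> t) + a i t \<cdot> N (\<sigma> t) v (E i) \<in> tangent_space A (fst (\<sigma> t))" if "i < n" for i
    by (intro tangent_space_add atlas p tE tN that)
  show "z \<in> tangent_space A (fst (\<sigma> t))"
    unfolding z' a'_def[symmetric] by (intro tangent_space_sum atlas p sum_in)
  assume Z: "Z \<in> pi_vector_fields A"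
  define f where "f = (\<lambda>i w. ft w (E i w) (Z w))"
  have "((\<lambda>s. \<Sum>i<n. a i s * f i (\<sigma> s)) has_vector_derivative (\<Sum>i<n. a i t * v (f i) + a' i * f i (\<sigma> t))) (at t within I)"
    unfolding f_def v_def
    by (intro has_vector_derivative_sum has_vector_derivative_mult da slit_velocity(3)[OF \<sigma> t] ft_smooth_near u E Z)
      simp_all
  then have "((\<lambda>s. ft (\<sigma> s) (W s) (Z (\<sigma> s))) has_vector_derivative (\<Sum>i<n. a i t * v (f i) + a' i * f i (\<sigma> t))) (at t within I)"
  proof (rule has_vector_derivative_transform_within[OF _ d t(1)])
    fix s assume s: "s \<in> I" "dist s t < d"
    then have W': "W s = (\<Sum>i<n. a i s \<cdot> E i (\<sigma> s))" by (intro W) (simp add: dist_commute)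
    have "ft (\<sigma> s) (W s) (Z (\<sigma> s)) = (\<Sum>i<n. ft (\<sigma> s) (a i s \<cdot> E i (\<sigma> s)) (Z (\<sigma> s)))"
      unfolding W' by (intro ft_sum \<sigma>in s pi_vector_fieldD Z tangent_space_scale atlas slit_bundleD E)
    also have "\<dots> = (\<Sum>i<n. a i s * f i (\<sigma> s))"
      unfolding f_def by (intro sum.cong refl ft_scale \<sigma>in s pi_vector_fieldD Z E) simp_all
    finally show "(\<Sum>i<n. a i s * f i (\<sigma> s)) = ft (\<sigma> s) (W s) (Z (\<sigma> s))" by simp
  qed
  then have vd: "vector_derivative (\<lambda>s. ft (\<sigma> s) (W s) (Z (\<sigma> s))) (at t within I)
      = (\<Sum>i<n. a i t * v (f i) + a' i * f i (\<sigma> t))"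
    using t(2) by (rule vector_derivative_within[rotated])
  note Zt = pi_vector_fieldD[OF Z u] and NZ = conn_in[OF u v Z]
  have "ft (\<sigma> t) z (Z (\<sigma> t)) = (\<Sum>i<n. ft (\<sigma> t) (a' i \<cdot> E i (\<sigma> t) + a i t \<cdot> N (\<sigma> t) v (E i)) (Z (\<sigma> t)))"
    unfolding z' a'_def[symmetric] by (rule ft_sum[OF u Zt sum_in])
  also have "\<dots> = (\<Sum>i<n. (a i t * v (f i) + a' i * f i (\<sigma> t)) - ft (\<sigma> t) (a i t \<cdot> E i (\<sigma> t)) (N (\<sigma> t) v Z))"
  proof (rule sum.cong[OF refl])
    fix i assume "i \<in> {..<n}"
    then have i: "i < n" by simp
    show "ft (\<sigma> t) (a' i \<cdot> E i (\<sigma> t) + a i t \<cdot> N (\<sigma> t) v (E i)) (Z (\<sigma> t))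
      = (a i t * v (f i) + a' i * f i (\<sigma> t)) - ft (\<sigma> t) (a i t \<cdot> E i (\<sigma> t)) (N (\<sigma> t) v Z)"
      using conn_metric[OF u v E[OF i] Z]
      by (simp add: ft_add[OF u tE(1)[OF i] tN[OF i] Zt] ft_scale[OF u pi_vector_fieldD[OF E[OF i] u] Zt]
          ft_scale[OF u conn_in[OF u v E[OF i]] Zt] ft_scale[OF u pi_vector_fieldD[OF E[OF i] u] NZ] f_def algebra_simps)
  qed
  also have "\<dots> = (\<Sum>i<n. a i t * v (f i) + a' i * f i (\<sigma> t)) - (\<Sum>i<n. ft (\<sigma> t) (a i t \<cdot> E i (\<sigma> t)) (N (\<sigma> t) v Z))"
    by (simp add: sum_subtractf)
  also have "(\<Sum>i<n. ft (\<sigma> t) (a i t \<cdot> E i (\<sigma> t)) (N (\<sigma> t) v Z)) = ft (\<sigma> t) (\<Sum>i<n. a i t \<cdot> E i (\<sigma> t)) (N (\<sigma> t) v Z)"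
    by (rule ft_sum[OF u NZ tE(2), symmetric])
  also have "(\<Sum>i<n. a i t \<cdot> E i (\<sigma> t)) = W t" using W[of t] t d by simp
  finally show "ft (\<sigma> t) z (Z (\<sigma> t)) = vector_derivative (\<lambda>s. ft (\<sigma> s) (W s) (Z (\<sigma> s))) (at t within I)
        - ft (\<sigma> t) (W t) (N (\<sigma> t) (velocity (slit_atlas A) I \<sigma> t) Z)"
    unfolding vd v_def .
qed

lemma cov_deriv_repr_unique:
  assumes \<sigma>: "smooth_curve (slit_atlas A) I \<sigma>" and t: "t \<in> I" "at t within I \<noteq> bot"
    and z: "cov_deriv_repr I \<sigma> W t z" and z': "cov_deriv_repr I \<sigma> W t z'"
  shows "z = z'"
  by (rule ft_eqI[OF slit_velocity(1)[OF \<sigma> t] cov_deriv_repr_metric(1)[OF \<sigma> t z] cov_deriv_repr_metric(1)[OF \<sigma> t z']])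
    (simp add: cov_deriv_repr_metric(2)[OF \<sigma> t z] cov_deriv_repr_metric(2)[OF \<sigma> t z'])

text \<open>\<open>\<eta>\<close> is itself a global section and represents itself with one term and
  coefficient 1; uniqueness then evaluates the \<open>THE\<close>.\<close>

lemma cov_deriv_fundamental:
  assumes \<sigma>: "smooth_curve (slit_atlas A) I \<sigma>" and t: "t \<in> I" "at t within I \<noteq> bot"
  shows "cov_deriv_along A N I \<sigma> (\<lambda>s. fundamental_field (\<sigma> s)) t
    = N (\<sigma> t) (velocity (slit_atlas A) I \<sigma> t) fundamental_field"
  unfolding cov_deriv_along_eq
proof (rule the_equality)
  let ?z = "N (\<sigma> t) (velocity (slit_atlas A) I \<sigma> t) fundamental_field"
  have vd: "vector_derivative (\<lambda>s. 1 :: real) (at t within I) = 0"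
    by (rule vector_derivative_within[OF t(2)]) simp
  show *: "cov_deriv_repr I \<sigma> (\<lambda>s. fundamental_field (\<sigma> s)) t ?z"
    unfolding cov_deriv_repr_def
    by (rule exI[of _ 1], rule exI[of _ "\<lambda>_. fundamental_field"], rule exI[of _ "\<lambda>_ _. 1"], rule exI[of _ 1])
      (simp add: fund_in smooth_on_const vd)
  show "z = ?z" if "cov_deriv_repr I \<sigma> (\<lambda>s. fundamental_field (\<sigma> s)) t z" for z
    by (rule cov_deriv_repr_unique[OF \<sigma> t that *])
qed

end


section \<open>Geodesics\<close>

text \<open>A connected set other than a singleton has no isolated points, so derivatives within the
  interval are unique also at its endpoints.\<close>

lemma interval_at_within:
  fixes t :: real
  assumes "is_interval I" "interior I \<noteq> {}" "t \<in> I"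
  shows "at t within I \<noteq> bot"
proof -
  have "I \<noteq> {t}"
  proof
    assume "I = {t}"
    then have "interior I = {}" by (simp add: interior_singleton)
    then show False using assms(2) by simp
  qed
  then have "t islimpt I"
    using assms(1,3) by (intro connected_imp_perfect) (auto simp: is_interval_connected_1)
  then show ?thesis by (simp add: trivial_limit_within)
qed

lemma smooth_on_vector_derivative:
  fixes x :: "real \<Rightarrow> 'b::euclidean_space"
  assumes J: "\<And>s. s \<in> J \<Longrightarrow> at s within J \<noteq> bot" and x: "smooth_on J x"
  shows "smooth_on J (\<lambda>s. vector_derivative x (at s within J))"
  unfolding smooth_on_def
proof
  fix k
  have "Ck_on (Suc k) J x" using x smooth_on_def by blast
  then obtain D where D: "\<forall>s\<in>J. (x has_derivative D s) (at s within J)" "\<forall>h. Ck_on k J (\<lambda>s. D s h)"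
    by auto
  have "D s 1 = vector_derivative x (at s within J)" if s: "s \<in> J" for s
  proof -
    have D': "(x has_derivative D s) (at s within J)" using D(1) s by blast
    have "(x has_vector_derivative D s 1) (at s within J)"
      unfolding has_vector_derivative_def
      by (rule has_derivative_eq_rhs[OF D'])
        (auto simp: fun_eq_iff simp flip: linear_cmul[OF has_derivative_linear[OF D']])
    then show ?thesis using J[OF s] by (simp add: vector_derivative_within)
  qed
  then show "Ck_on k J (\<lambda>s. vector_derivative x (at s within J))"
    by (intro Ck_on_cong[OF D(2)[rule_format, of 1]])
qed

lemma regular_curve_at_within: "regular_curve A I c \<Longrightarrow> t \<in> I \<Longrightarrow> at t within I \<noteq> bot"
  unfolding regular_curve_def using interval_at_within by blast

text \<open>In a chart the lift is (x, x'). Smoothness of x gives that of x', nonvanishing velocity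
  puts the lift into the slit bundle, and the foot part of its own velocity is x' again.\<close>

lemma canonical_lift_smooth:
  assumes A: "smooth_atlas A" and c: "regular_curve A I c"
  shows "smooth_curve (slit_atlas A) I (canonical_lift A I c)"
    and "t \<in> I \<Longrightarrow> rho A (canonical_lift A I c t) (velocity (slit_atlas A) I (canonical_lift A I c) t) = velocity A I c t"
proof -
  define \<sigma> where "\<sigma> = canonical_lift A I c"
  have sc: "smooth_curve A I c" using c by (simp add: regular_curve_def)
  have nb: "at s within I \<noteq> bot" if "s \<in> I" for s by (rule regular_curve_at_within[OF c that])
  have main: "\<exists>U \<phi>. slit_chart A U \<phi> \<and> (\<exists>d>0. \<sigma> ` (I \<inter> ball t d) \<subseteq> {u\<in>slit_bundle A. fst u \<in> U} \<and>
      smooth_on (I \<inter> ball t d) (\<lambda>s. tangent_coords \<phi> (\<sigma> s)) \<and>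
      (\<forall>s\<in>I \<inter> ball t d. ((\<lambda>s. \<phi> (c s)) has_vector_derivative comps \<phi> (snd (\<sigma> s))) (at s within I)))"
    if t: "t \<in> I" for t
  proof -
    obtain V \<psi> d0 where V: "(V, \<psi>) \<in> A" "d0 > 0" "c ` (I \<inter> ball t d0) \<subseteq> V"
      using sc t unfolding smooth_curve_def by blast
    then have "c t \<in> V" using t by auto
    then have "c t \<in> points A" using V(1) by (auto simp: points_def)
    then obtain U \<phi> where "chart A U \<phi>" and p: "c t \<in> U" by (rule obtain_chart[OF A])
    then interpret slit_chart A U \<phi> by (simp add: slit_chartI)
    obtain d where d: "d > 0" "c ` (I \<inter> ball t d) \<subseteq> U" "smooth_on (I \<inter> ball t d) (\<lambda>s. \<phi> (c s))"
      using smooth_curve_in_chart[OF sc t p] .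
    \<comment> \<open>Intersecting with an open ball does not affect derivatives, so those within
      \<open>J\<close> and within \<open>I\<close> agree at points of \<open>J\<close>.\<close>
    define J where "J = I \<inter> ball t d"
    have at_J: "at s within J = at s within I" if "s \<in> J" for s
      using that by (intro at_within_nhd[of s "ball t d"]) (auto simp: J_def)
    define w where "w s = vector_derivative (\<lambda>s. \<phi> (c s)) (at s within J)" for s
    have w: "smooth_on J w"
      unfolding w_def by (rule smooth_on_vector_derivative) (use at_J nb d(3) in \<open>auto simp: J_def\<close>)
    have \<sigma>: "\<sigma> s \<in> SU \<and> comps \<phi> (snd (\<sigma> s)) = w s \<and> ((\<lambda>s. \<phi> (c s)) has_vector_derivative w s) (at s within I)"
      if s: "s \<in> J" for s
    proof -
      have sI: "s \<in> I" "c s \<in> U" using s d(2) by (auto simp: J_def)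
      obtain w' where w': "((\<lambda>s. \<phi> (c s)) has_vector_derivative w') (at s within I)"
        "velocity A I c s = tvec A U \<phi> (c s) w'"
        using velocity_smooth_curve[OF sc sI nb[OF sI(1)]] .
      have ws: "w s = w'" using w'(1) nb[OF sI(1)] at_J[OF s] by (simp add: w_def vector_derivative_within)
      have "w' \<noteq> 0"
      proof
        assume "w' = 0"
        then have "velocity A I c s = 0" using w'(2) tvec_zero[OF sI(2)] by simp
        then show False using c sI(1) by (simp add: regular_curve_def)
      qed
      then show ?thesis
        using tvec_in_slit[OF sI(2)] w' sI ws by (simp add: \<sigma>_def canonical_lift_def)
    qed
    have "smooth_on J (\<lambda>s. (\<phi> (c s), w s))"
      by (rule smooth_on_Pair[OF _ w]) (use d(3) in \<open>simp add: J_def\<close>)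
    then have "smooth_on J (\<lambda>s. \<Phi> (\<sigma> s))"
      by (rule smooth_on_cong) (use \<sigma> in \<open>simp add: tangent_coords_eq \<sigma>_def canonical_lift_def\<close>)
    then show ?thesis
      by (intro exI[of _ U] exI[of _ \<phi>] exI[of _ d] conjI slit_chart_axioms d(1))
        (use \<sigma> in \<open>auto simp: J_def\<close>)
  qed
  show sm: "smooth_curve (slit_atlas A) I (canonical_lift A I c)"
    unfolding smooth_curve_def \<sigma>_def[symmetric]
  proof
    fix t assume "t \<in> I"
    then obtain U \<phi> d where *: "slit_chart A U \<phi>" "d > 0" "\<sigma> ` (I \<inter> ball t d) \<subseteq> {u\<in>slit_bundle A. fst u \<in> U}"
      "smooth_on (I \<inter> ball t d) (\<lambda>s. tangent_coords \<phi> (\<sigma> s))" using main by meson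
    interpret slit_chart A U \<phi> by fact
    show "\<exists>(U, \<phi>)\<in>slit_atlas A. \<exists>d>0. \<sigma> ` (I \<inter> ball t d) \<subseteq> U \<and> smooth_on (I \<inter> ball t d) (\<phi> \<circ> \<sigma>)"
      using * by (intro bexI[OF _ S.chart] case_prodI exI[of _ d]) (simp add: o_def)
  qed
  assume t: "t \<in> I"
  obtain U \<phi> d where *: "slit_chart A U \<phi>" "d > 0" "\<sigma> ` (I \<inter> ball t d) \<subseteq> {u\<in>slit_bundle A. fst u \<in> U}"
    "\<forall>s\<in>I \<inter> ball t d. ((\<lambda>s. \<phi> (c s)) has_vector_derivative comps \<phi> (snd (\<sigma> s))) (at s within I)"
    using main[OF t] by meson
  interpret slit_chart A U \<phi> by fact
  have "\<sigma> t \<in> \<sigma> ` (I \<inter> ball t d)" using *(2) t by simp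
  then have u: "\<sigma> t \<in> SU" using *(3) by blast
  obtain W where W: "((\<lambda>s. \<Phi> (\<sigma> s)) has_vector_derivative W) (at t within I)"
    "velocity (slit_atlas A) I \<sigma> t = stvec (\<sigma> t) W"
    using S.velocity_smooth_curve[OF sm[folded \<sigma>_def] t u nb[OF t]] .
  have "((\<lambda>s. fst (\<Phi> (\<sigma> s))) has_vector_derivative fst W) (at t within I)"
    using bounded_linear.has_vector_derivative[OF bounded_linear_fst W(1)] .
  then have "((\<lambda>s. \<phi> (c s)) has_vector_derivative fst W) (at t within I)"
    by (simp add: fst_Phi \<sigma>_def canonical_lift_def)
  moreover have "((\<lambda>s. \<phi> (c s)) has_vector_derivative comps \<phi> (snd (\<sigma> t))) (at t within I)"
    using *(2,4) t by simp
  ultimately have "fst W = comps \<phi> (snd (\<sigma> t))"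
    using vector_derivative_within[OF nb[OF t]] by metis
  then have "rho A (\<sigma> t) (velocity (slit_atlas A) I \<sigma> t) = snd (\<sigma> t)"
    using rho_stvec[OF u] snd_eq_tvec[OF u] by (simp add: W(2))
  then show "rho A (canonical_lift A I c t) (velocity (slit_atlas A) I (canonical_lift A I c) t) = velocity A I c t"
    by (simp add: \<sigma>_def canonical_lift_def)
qed

context cartan
begin

text \<open>The covariant derivative of \<open>\<eta>\<close> along the lift is \<open>K\<close> of
  its velocity, so the geodesic equation involves the connection through \<open>K\<close>
  alone.\<close>

lemma geodesic_iff:
  "geodesic A N I c \<longleftrightarrow> regular_curve A I c \<and>
    (\<forall>t\<in>I. N (canonical_lift A I c t) (velocity (slit_atlas A) I (canonical_lift A I c) t) fundamental_field = 0)"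
  using cov_deriv_fundamental[OF canonical_lift_smooth(1)[OF atlas]] regular_curve_at_within
  unfolding geodesic_def by (metis (no_types, lifting))

lemma lift_in_slit: "regular_curve A I c \<Longrightarrow> t \<in> I \<Longrightarrow> canonical_lift A I c t \<in> slit_bundle A"
  using slit_velocity(1)[OF canonical_lift_smooth(1)[OF atlas]] regular_curve_at_within by blast

text \<open>The velocity of the lift projects to the velocity of the curve, which is
  \<open>\<eta>\<close>, and for a geodesic it is horizontal; so it is the horizontal lift of
  \<open>\<eta>\<close>.\<close>

lemma geodesic_velocity:
  assumes c: "geodesic A N I c" and t: "t \<in> I"
  shows "velocity (slit_atlas A) I (canonical_lift A I c) t
    = beta A N (canonical_lift A I c t) (fundamental_field (canonical_lift A I c t))"
proof -
  define \<sigma> where "\<sigma> = canonical_lift A I c"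
  have rc: "regular_curve A I c" using c by (simp add: geodesic_def)
  note sm = canonical_lift_smooth(1)[OF atlas rc, folded \<sigma>_def]
  note u = slit_velocity(1)[OF sm t regular_curve_at_within[OF rc t]]
    and v = slit_velocity(2)[OF sm t regular_curve_at_within[OF rc t]]
  have "velocity (slit_atlas A) I \<sigma> t \<in> horizontal_space A N (\<sigma> t)"
    using v c t geodesic_iff by (simp add: horizontal_space_def connection_map_def \<sigma>_def)
  moreover have rho: "rho A (\<sigma> t) (velocity (slit_atlas A) I \<sigma> t) = fundamental_field (\<sigma> t)"
    using canonical_lift_smooth(2)[OF atlas rc t] by (simp add: \<sigma>_def fundamental_field_def canonical_lift_def)
  ultimately have "beta A N (\<sigma> t) (rho A (\<sigma> t) (velocity (slit_atlas A) I \<sigma> t)) = velocity (slit_atlas A) I \<sigma> t"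
    using pi_vector_fieldD[OF fund_in u] by (intro beta_unique[OF u]) simp_all
  then show ?thesis unfolding rho by (simp add: \<sigma>_def)
qed

text \<open>Integral curves of the spray: its foot part is the fibre coordinate, so such a curve is
  the canonical lift of its own foot curve.\<close>

lemma geodesic_exists:
  assumes u: "u \<in> slit_bundle A"
  obtains I c where "geodesic A N I c" "0 \<in> I" "canonical_lift A I c 0 = u"
proof -
  obtain U \<phi> where "cartan_chart A U \<phi> L N" and u': "u \<in> {u\<in>slit_bundle A. fst u \<in> U}"
    by (rule cartan_chart_at[OF u])
  then interpret cartan_chart A U \<phi> L N by simp
  \<comment> \<open>The chart form of the spray \<open>\<beta>\<eta>\<close>, by the coordinate
    formula for \<open>\<beta>\<close>.\<close>
  define F where "F z = (snd z, - Pc z (snd z))" for z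
  have F: "smooth_on \<Omega> F"
    unfolding F_def by (intro smooth_on_Pair smooth_on_minus smooth_on_snd smooth_on_family[OF Pc_linear Pc_smooth])
  obtain \<epsilon> \<zeta> where e: "\<epsilon> > 0" "\<zeta> 0 = \<Phi> u"
    and \<zeta>: "\<And>t. t \<in> {0..\<epsilon>} \<Longrightarrow> \<zeta> t \<in> \<Omega> \<and> (\<zeta> has_vector_derivative F (\<zeta> t)) (at t within {0..\<epsilon>})"
    using integral_curve_exists[OF F open_Omega Phi_in[OF u']] by blast
  define I where "I = {0..\<epsilon>}"
  define \<sigma> where "\<sigma> t = S.\<iota> (\<zeta> t)" for t
  define c where "c t = fst (\<sigma> t)" for t
  have z: "\<zeta> t \<in> \<Omega>" "(\<zeta> has_vector_derivative F (\<zeta> t)) (at t within I)" if "t \<in> I" for t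
    using \<zeta>[of t] that by (auto simp: I_def)
  have sm: "smooth_on I \<zeta>" by (rule smooth_on_integral_curve[OF F]) (use z in blast)
  have I: "is_interval I" "interior I \<noteq> {}" using e by (auto simp: I_def is_interval_cc)
  note nb = interval_at_within[OF I]
  have \<sigma>: "\<sigma> t \<in> SU" "\<Phi> (\<sigma> t) = \<zeta> t" if "t \<in> I" for t
    using iota_SU[OF z(1)[OF that]] slit_iota_in(3)[OF z(1)[OF that]] by (simp_all add: \<sigma>_def)
  have c: "c t \<in> U" "\<phi> (c t) = fst (\<zeta> t)" if "t \<in> I" for t
    using \<sigma>[OF that] fst_Phi[of "\<sigma> t"] by (simp_all add: c_def)
  have "smooth_on I (\<lambda>t. fst (\<zeta> t))" by (rule smooth_on_fst_comp[OF sm])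
  then have "smooth_on I (\<lambda>t. \<phi> (c t))" by (rule smooth_on_cong) (simp add: c)
  then have sc: "smooth_curve A I c"
    unfolding smooth_curve_def
    by (intro ballI bexI[OF _ chart] case_prodI exI[of _ 1]) (auto simp: c o_def intro: smooth_on_subset)
  have lift: "canonical_lift A I c t = \<sigma> t" if t: "t \<in> I" for t
  proof -
    have "((\<lambda>t. fst (\<zeta> t)) has_vector_derivative fst (F (\<zeta> t))) (at t within I)"
      using bounded_linear.has_vector_derivative[OF bounded_linear_fst z(2)[OF t]] .
    then have "((\<lambda>t. fst (\<zeta> t)) has_vector_derivative snd (\<zeta> t)) (at t within I)"
      by (simp add: F_def)
    then have "((\<lambda>t. \<phi> (c t)) has_vector_derivative snd (\<zeta> t)) (at t within I)"
      by (rule has_vector_derivative_transform_within[OF _ zero_less_one t]) (simp add: c)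
    then have "velocity A I c t = tvec A U \<phi> (c t) (snd (\<zeta> t))"
      by (rule velocity_eq_tvec[OF t nb[OF t] zero_less_one, rotated]) (auto simp: c)
    then show ?thesis
      using snd_eq_tvec[OF \<sigma>(1)[OF t]] snd_Phi[of "\<sigma> t"] \<sigma>(2)[OF t]
      by (simp add: canonical_lift_def c_def prod_eq_iff)
  qed
  have "velocity A I c t \<noteq> 0" if "t \<in> I" for t
    using arg_cong[OF lift[OF that], of snd] slit_bundleD(3)[of "\<sigma> t" A] \<sigma>(1)[OF that]
    by (simp add: canonical_lift_def)
  then have rc: "regular_curve A I c" using I sc by (simp add: regular_curve_def)
  have "N (canonical_lift A I c t) (velocity (slit_atlas A) I (canonical_lift A I c) t) fundamental_field = 0"
    if t: "t \<in> I" for t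
  proof -
    let ?l = "canonical_lift A I c"
    have "((\<lambda>t. \<Phi> (?l t)) has_vector_derivative F (\<zeta> t)) (at t within I)"
      by (rule has_vector_derivative_transform_within[OF z(2)[OF t] zero_less_one t]) (simp add: lift \<sigma>)
    then have "velocity (slit_atlas A) I ?l t = stvec (?l t) (F (\<zeta> t))"
      by (rule S.velocity_eq_tvec[OF t nb[OF t] zero_less_one, rotated]) (use lift \<sigma> in auto)
    moreover have "kap (\<sigma> t) (F (\<zeta> t)) = 0"
      using kap_eq[OF \<sigma>(1)[OF t], of "snd (\<zeta> t)" "- Pc (\<zeta> t) (snd (\<zeta> t))"] by (simp add: F_def Pc_def \<sigma>_def)
    ultimately have k: "comps \<phi> (N (\<sigma> t) (velocity (slit_atlas A) I ?l t) fundamental_field) = 0"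
      by (simp add: lift[OF t] kap_def)
    have "velocity (slit_atlas A) I ?l t \<in> tangent_space (slit_atlas A) (\<sigma> t)"
      using slit_velocity(2)[OF canonical_lift_smooth(1)[OF atlas rc] t nb[OF t]] by (simp add: lift[OF t])
    from conn_in[OF in_slit[OF \<sigma>(1)[OF t]] this fund_in] show ?thesis
      using k comps_eq_zero_iff[of "fst (\<sigma> t)"] \<sigma>(1)[OF t] by (simp add: lift[OF t])
  qed
  then have "geodesic A N I c" using rc geodesic_iff by blast
  moreover have "0 \<in> I" using e by (simp add: I_def)
  moreover have "canonical_lift A I c 0 = u" using lift[OF \<open>0 \<in> I\<close>] u' by (simp add: \<sigma>_def e(2))
  ultimately show ?thesis using that by blast
qed

end


section \<open>Two Finsler structures with the same spray\<close>

text \<open>The added assumption is the pointwise content of the hypothesis on the difference of the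
  connections: the spray of \<open>L\<close> is horizontal for the second connection.\<close>

locale two_cartan = cartan A L N + P: cartan A L' N'
  for A :: "('a, 'e::euclidean_space) chart set" and L L' and N N' :: "'a pi_conn" +
  assumes same_spray: "\<And>u. u \<in> slit_bundle A \<Longrightarrow> N' u (beta A N u (snd u)) fundamental_field = 0"
begin

lemma connection_map_eq:
  assumes u: "u \<in> slit_bundle A" and X: "X \<in> tangent_space (slit_atlas A) u"
  shows "N u X fundamental_field = N' u X fundamental_field"
proof -
  obtain U \<phi> where c: "cartan_chart A U \<phi> L N" and u': "u \<in> {u\<in>slit_bundle A. fst u \<in> U}"
    by (rule cartan_chart_at[OF u])
  then interpret C: cartan_chart A U \<phi> L N by simp
  interpret C': cartan_chart A U \<phi> L' N'
    using C.slit_chart_axioms P.cartan_axioms P.finsler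
    by (simp add: cartan_chart_def finsler_chart_def finsler_chart_axioms_def)
  \<comment> \<open>Horizontality of the spray for the second connection says, by
    \<open>kap_eq\<close>, that the fibre parts of both sprays agree.\<close>
  have H: "C.Pc z (snd z) = C'.Pc z (snd z)" if z: "z \<in> C.\<Omega>" for z
  proof -
    let ?w = "C.S.\<iota> z"
    have w: "?w \<in> C.SU" by (rule C.iota_SU[OF z])
    have s: "snd ?w \<in> tangent_space A (fst ?w)" "comps \<phi> (snd ?w) = snd z"
      using slit_bundleD(2)[of ?w A] w C.fund_coords[OF z] by (simp_all add: fundamental_field_def)
    have "C'.kap ?w (snd z, - C.Pc z (snd z)) = 0"
      using same_spray[of ?w] w C.beta_eq[OF w s(1)] by (simp add: C'.kap_def s(2) C.Pc_def)
    then show ?thesis using C'.kap_eq[OF w, of "snd z" "- C.Pc z (snd z)"] by (simp add: C'.Pc_def)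
  qed
  \<comment> \<open>Equality of the sprays on the open set \<open>\<Omega>\<close> gives equality of
    their vertical derivatives, which are twice the coefficients.\<close>
  have P: "C.Pc z w = C'.Pc z w" if z: "z \<in> C.\<Omega>" for z w
  proof -
    have "fder (\<lambda>y. C.Pc y (snd y)) z = fder (\<lambda>y. C'.Pc y (snd y)) z"
      by (rule fder_cong[OF C.open_Omega z]) (rule H)
    then show ?thesis using C.Pc_determined[OF z, of w] C'.Pc_determined[OF z, of w] by simp
  qed
  obtain a b where ab: "comps C.\<Phi> X = (a, b)" by force
  have X': "X = C.stvec u (a, b)" using C.S.tvec_comps[OF u' X] ab by simp
  have "comps \<phi> (N u X fundamental_field) = C.Pc (C.\<Phi> u) a + b"
    using C.kap_eq[OF u', of a b] C.Pc_Phi[OF u'] by (simp add: X' C.kap_def)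
  moreover have "comps \<phi> (N' u X fundamental_field) = C'.Pc (C.\<Phi> u) a + b"
    using C'.kap_eq[OF u', of a b] C'.Pc_Phi[OF u'] by (simp add: X' C'.kap_def)
  ultimately have "comps \<phi> (N u X fundamental_field) = comps \<phi> (N' u X fundamental_field)"
    using P[OF C.Phi_in[OF u']] by simp
  then show ?thesis
    using u' by (intro C.tangent_eqI[of "fst u"] conn_in[OF u X fund_in] P.conn_in[OF u X fund_in]) simp_all
qed

lemma horizontal_space_eq: "horizontal_space A N u = horizontal_space A N' u"
proof -
  have "u \<in> slit_bundle A" if "X \<in> tangent_space (slit_atlas A) u" for X
    using tangent_space_points[OF that] by (simp add: slit_points)
  then have "N u X fundamental_field = N' u X fundamental_field" if "X \<in> tangent_space (slit_atlas A) u" for X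
    using connection_map_eq[OF _ that] that by blast
  then show ?thesis unfolding horizontal_space_def connection_map_def by auto
qed

lemma beta_eq: "beta A N = beta A N'"
  by (auto simp: beta_def horizontal_space_eq fun_eq_iff)

text \<open>The connections may differ in other directions. Along the spray,
  \<open>torsion_free\<close> leaves only a bracket built from the common
  \<open>\<beta>\<close>.\<close>

lemma spray_derivative_eq:
  assumes u: "u \<in> slit_bundle A" and Y: "Y \<in> pi_vector_fields A"
  shows "N u (beta A N u (fundamental_field u)) Y = N' u (beta A N u (fundamental_field u)) Y"
  using torsion_free[OF fund_in Y u] P.torsion_free[OF fund_in Y u]
    conn_beta_fundamental[OF u pi_vector_fieldD[OF Y u]] P.conn_beta_fundamental[OF u pi_vector_fieldD[OF Y u]]
  by (simp add: beta_eq)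

lemma geodesic_eq: "geodesic A N I c \<longleftrightarrow> geodesic A N' I c"
proof -
  have "N (canonical_lift A I c t) (velocity (slit_atlas A) I (canonical_lift A I c) t) fundamental_field
      = N' (canonical_lift A I c t) (velocity (slit_atlas A) I (canonical_lift A I c) t) fundamental_field"
    if "regular_curve A I c" "t \<in> I" for t
  proof -
    note sm = canonical_lift_smooth(1)[OF atlas that(1)] and nb = regular_curve_at_within[OF that]
    show ?thesis
      by (rule connection_map_eq[OF slit_velocity(1)[OF sm that(2) nb] slit_velocity(2)[OF sm that(2) nb]])
  qed
  then show ?thesis unfolding geodesic_iff P.geodesic_iff by auto
qed

text \<open>Both sides are \<open>THE\<close> descriptions of the same predicate and so agree
  whether or not it can be satisfied. \<open>W\<close> and \<open>W'\<close> may differ off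
  \<open>I\<close>, since in an iterated derivative the inner ones are equated at parameters in
  \<open>I\<close> only.\<close>

lemma cov_deriv_eq:
  assumes c: "geodesic A N I c" and t: "t \<in> I" and W: "\<And>s. s \<in> I \<Longrightarrow> W s = W' s"
  shows "cov_deriv_along A N I (canonical_lift A I c) W t = cov_deriv_along A N' I (canonical_lift A I c) W' t"
proof -
  define \<sigma> where "\<sigma> = canonical_lift A I c"
  have rc: "regular_curve A I c" using c by (simp add: geodesic_def)
  have N: "N (\<sigma> t) (velocity (slit_atlas A) I \<sigma> t) E = N' (\<sigma> t) (velocity (slit_atlas A) I \<sigma> t) E"
    if "E \<in> pi_vector_fields A" for E
    unfolding \<sigma>_def geodesic_velocity[OF c t]
    by (rule spray_derivative_eq[OF lift_in_slit[OF rc t] that])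
  have "cov_deriv_repr I \<sigma> W t z \<longleftrightarrow> P.cov_deriv_repr I \<sigma> W' t z" for z
    unfolding cov_deriv_repr_def P.cov_deriv_repr_def
    by (intro ex_cong1 conj_cong refl ball_cong arg_cong2[where f = "(=)"] sum.cong) (auto simp: N W)
  then have "cov_deriv_repr I \<sigma> W t = P.cov_deriv_repr I \<sigma> W' t" by (rule ext)
  then show ?thesis
    unfolding cov_deriv_along_eq P.cov_deriv_along_eq \<sigma>_def by (simp only:)
qed

text \<open>The last argument is \<open>snd u\<close>, as in the Jacobi equation. For all admissible
  extensions the curvature is then \<open>K\<close> of a bracket of common horizontal lifts, so the
  predicates under \<open>THE\<close> coincide.\<close>

lemma curvature_at_eq:
  assumes u: "u \<in> slit_bundle A"
  shows "horizontal_curvature_at A N u x y (snd u) = horizontal_curvature_at A N' u x y (snd u)"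
proof -
  have R: "horizontal_curvature A N X Y Z u = horizontal_curvature A N' X Y Z u"
    if "X \<in> pi_vector_fields A" "Y \<in> pi_vector_fields A" "Z \<in> pi_vector_fields A" "Z u = snd u" for X Y Z
  proof -
    have "lie_bracket (slit_atlas A) (\<lambda>u. beta A N u (X u)) (\<lambda>u. beta A N u (Y u)) u \<in> tangent_space (slit_atlas A) u"
      by (rule lie_bracket_in[OF slit_atlas beta_vector_field beta_vector_field]) (simp_all add: that atlas u)
    from connection_map_eq[OF u this] show ?thesis
      by (simp add: horizontal_curvature_fundamental[OF that(1-3) u that(4)]
          P.horizontal_curvature_fundamental[OF that(1-3) u that(4)] beta_eq)
  qed
  have "(\<exists>X\<in>pi_vector_fields A. \<exists>Y\<in>pi_vector_fields A. \<exists>Z\<in>pi_vector_fields A.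
        X u = x \<and> Y u = y \<and> Z u = snd u \<and> r = horizontal_curvature A N X Y Z u)
    \<longleftrightarrow> (\<exists>X\<in>pi_vector_fields A. \<exists>Y\<in>pi_vector_fields A. \<exists>Z\<in>pi_vector_fields A.
        X u = x \<and> Y u = y \<and> Z u = snd u \<and> r = horizontal_curvature A N' X Y Z u)" for r
    by (intro bex_cong conj_cong refl arg_cong2[where f = "(=)"]) (rule R)
  then show ?thesis unfolding horizontal_curvature_at_def by (intro arg_cong[where f = The] ext)
qed

lemma jacobi_field_eq: "jacobi_field A N I c J \<longleftrightarrow> jacobi_field A N' I c J"
proof (cases "geodesic A N I c")
  case True
  have rc: "regular_curve A I c" using True by (simp add: geodesic_def)
  let ?\<sigma> = "canonical_lift A I c"
  have "cov_deriv_along A N I ?\<sigma> (cov_deriv_along A N I ?\<sigma> J) t = cov_deriv_along A N' I ?\<sigma> (cov_deriv_along A N' I ?\<sigma> J) t"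
    if "t \<in> I" for t
    by (intro cov_deriv_eq[OF True that] cov_deriv_eq[OF True] refl)
  moreover have "horizontal_curvature_at A N (?\<sigma> t) (fundamental_field (?\<sigma> t)) (J t) (fundamental_field (?\<sigma> t))
      = horizontal_curvature_at A N' (?\<sigma> t) (fundamental_field (?\<sigma> t)) (J t) (fundamental_field (?\<sigma> t))"
    if "t \<in> I" for t
    using curvature_at_eq[OF lift_in_slit[OF rc that]] by (simp add: fundamental_field_def)
  ultimately show ?thesis
    unfolding jacobi_field_def Let_def using geodesic_eq by simp
next
  case False
  then show ?thesis using geodesic_eq by (simp add: jacobi_field_def)
qed

end

theorem theorem4p3:
  fixes A :: "('a, 'e::euclidean_space) chart set"
    and L L' :: "'a \<times> 'a tvec \<Rightarrow> real"
    and N N' :: "'a pi_conn"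
  assumes "smooth_manifold A"
    and "finsler_structure A L" and "finsler_structure A L'"
    and "cartan_connection A L N" and "cartan_connection A L' N'"
    and "\<And>I c t. geodesic A N I c \<Longrightarrow> t \<in> I \<Longrightarrow>
           connection_difference A N N' fundamental_field fundamental_field (canonical_lift A I c t) = 0"
  shows "\<forall>I c J. jacobi_field A N I c J \<longleftrightarrow> jacobi_field A N' I c J"
proof -
  interpret cartan A L N using assms by unfold_locales
  interpret P: cartan A L' N' using assms by unfold_locales
  have "N' u (beta A N u (snd u)) fundamental_field = 0" if u: "u \<in> slit_bundle A" for u
  proof -
    obtain I c where c: "geodesic A N I c" "0 \<in> I" "canonical_lift A I c 0 = u"
      by (rule geodesic_exists[OF u])
    have "connection_difference A N N' fundamental_field fundamental_field u = 0"
      using assms(6)[OF c(1,2)] c(3) by simp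
    then show ?thesis
      using conn_beta_fundamental[OF u slit_bundleD(2)[OF u]]
      by (simp add: connection_difference_def fundamental_field_def)
  qed
  then interpret two_cartan A L L' N N' by unfold_locales
  show ?thesis by (simp add: jacobi_field_eq)
qed

end
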